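(* Let $T$ be a complete theory with monster model $\mathbb{M}$, let $A$ be a set of parameters and $b$ a real tuple. If there is a cardinal $\lambda$ satisfying $\lambda \to (\omega+1)^{<\omega}_{2^{|Ab|+|T|}}$, then there is a total $\perp^{\mathrm{bu}}$-Morley sequence $(b_i)_{i<\omega}$ over $A$ with $b_0 = b$. In particular, this holds if there is an Erdős cardinal $\kappa(\alpha)$ with $|Ab|+|T| < \kappa(\alpha)$ for some limit ordinal $\alpha \geq \omega$.
   Context: Parameters may be real elements or hyperimaginaries. $\mathbb{M}$ is a monster model; "small" means of cardinality less than its saturation. An ultraimaginary is a class $a_E$ of a tuple $a$ under an invariant equivalence relation $E$ (an equivalence relation such that $ab\equiv cd$ implies ($aEb\iff cEd$)); tuples, sequences, sets and collections of (hyper/ultra)imaginaries are regarded as ultraimaginaries via product relations. $b_F$ is bounded over $a_E$ if its orbit under $\operatorname{Aut}(\mathbb{M}/a_E)=\{\sigma: a \mathrel E \sigma(a)\}$ is small; $\operatorname{bdd}^u(a_E)$ is the class of such. $b \perp^{\mathrm{bu}}_A c$ iff $\operatorname{bdd}^u(Ab)\cap\operatorname{bdd}^u(Ac)=\operatorname{bdd}^u(A)$. $I \equiv^{\mathrm{EM}}_A J$ means increasing finite tuples of the same length from $I$ and $J$ have the same type over $A$; $I+J$ is concatenation. A total $\perp^{\mathrm{bu}}$-Morley sequence over $A$ is an $A$-indiscernible sequence $(b_i)_{i<\omega}$ such that for any sequences $I,J$ (any order types) with $I+J \equiv^{\mathrm{EM}}_A b_{<\omega}$, $I \perp^{\mathrm{bu}}_A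 J$. The partition relation $\kappa \to (\alpha)^{<\omega}_\gamma$ means that for every function $f : [\kappa]^{<\omega} \to \gamma$ there is $X \subseteq \kappa$ of order type $\alpha$ such that $f$ is constant on $[X]^n$ for each $n<\omega$. The Erdős cardinal $\kappa(\alpha)$ is the least cardinal $\kappa$ with $\kappa \to (\alpha)^{<\omega}_2$. *)

theory Defs
  imports "HOL-Library.Ramsey" "HOL-Library.FuncSet"
begin

unbundle cardinal_syntax

section \<open>First-order logic\<close>

text \<open>The symbols of a language are those with a declared arity.\<close>

record ('f, 'r) lang =
  fun_ar :: "'f \<Rightarrow> nat option"
  rel_ar :: "'r \<Rightarrow> nat option"

datatype 'f tm = Var nat | App 'f "'f tm list"

datatype ('f, 'r) fm =
    Eq "'f tm" "'f tm"
  | Rel 'r "'f tm list"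
  | Neg "('f, 'r) fm"
  | Conj "('f, 'r) fm" "('f, 'r) fm"
  | All nat "('f, 'r) fm"

fun wf_tm :: "('f, 'r) lang \<Rightarrow> 'f tm \<Rightarrow> bool" where
  "wf_tm L (Var n) \<longleftrightarrow> True"
| "wf_tm L (App f ts) \<longleftrightarrow> fun_ar L f = Some (length ts) \<and> (\<forall>t \<in> set ts. wf_tm L t)"

fun wf_fm :: "('f, 'r) lang \<Rightarrow> ('f, 'r) fm \<Rightarrow> bool" where
  "wf_fm L (Eq t u) \<longleftrightarrow> wf_tm L t \<and> wf_tm L u"
| "wf_fm L (Rel R ts) \<longleftrightarrow> rel_ar L R = Some (length ts) \<and> (\<forall>t \<in> set ts. wf_tm L t)"
| "wf_fm L (Neg \<phi>) \<longleftrightarrow> wf_fm L \<phi>"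
| "wf_fm L (Conj \<phi> \<psi>) \<longleftrightarrow> wf_fm L \<phi> \<and> wf_fm L \<psi>"
| "wf_fm L (All n \<phi>) \<longleftrightarrow> wf_fm L \<phi>"

fun fv_tm :: "'f tm \<Rightarrow> nat set" where
  "fv_tm (Var n) = {n}"
| "fv_tm (App f ts) = (\<Union>t \<in> set ts. fv_tm t)"

fun fv :: "('f, 'r) fm \<Rightarrow> nat set" where
  "fv (Eq t u) = fv_tm t \<union> fv_tm u"
| "fv (Rel R ts) = (\<Union>t \<in> set ts. fv_tm t)"
| "fv (Neg \<phi>) = fv \<phi>"
| "fv (Conj \<phi> \<psi>) = fv \<phi> \<union> fv \<psi>"
| "fv (All n \<phi>) = fv \<phi> - {n}"

definition sentences :: "('f, 'r) lang \<Rightarrow> ('f, 'r) fm set" where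
  "sentences L = {\<phi>. wf_fm L \<phi> \<and> fv \<phi> = {}}"

text \<open>The universe of a structure is the whole type \<open>'m\<close>.\<close>

record ('f, 'r, 'm) struc =
  fun_int :: "'f \<Rightarrow> 'm list \<Rightarrow> 'm"
  rel_int :: "'r \<Rightarrow> 'm list \<Rightarrow> bool"

fun eval_tm :: "('f, 'r, 'm) struc \<Rightarrow> (nat \<Rightarrow> 'm) \<Rightarrow> 'f tm \<Rightarrow> 'm" where
  "eval_tm M e (Var n) = e n"
| "eval_tm M e (App f ts) = fun_int M f (map (eval_tm M e) ts)"

fun sat :: "('f, 'r, 'm) struc \<Rightarrow> (nat \<Rightarrow> 'm) \<Rightarrow> ('f, 'r) fm \<Rightarrow> bool" where
  "sat M e (Eq t u) \<longleftrightarrow> eval_tm M e t = eval_tm M e u"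
| "sat M e (Rel R ts) \<longleftrightarrow> rel_int M R (map (eval_tm M e) ts)"
| "sat M e (Neg \<phi>) \<longleftrightarrow> \<not> sat M e \<phi>"
| "sat M e (Conj \<phi> \<psi>) \<longleftrightarrow> sat M e \<phi> \<and> sat M e \<psi>"
| "sat M e (All n \<phi>) \<longleftrightarrow> (\<forall>x. sat M (e(n := x)) \<phi>)"

definition models :: "('f, 'r, 'm) struc \<Rightarrow> ('f, 'r) fm set \<Rightarrow> bool" where
  "models M T \<longleftrightarrow> (\<forall>\<phi> \<in> T. \<forall>e. sat M e \<phi>)"

text \<open>
  A complete theory contains each sentence or its negation; consistency is supplied by the
  presence of a model. Hence the cardinal of \<open>T\<close> is literally the cardinal of
  the language plus \<open>\<aleph>\<^sub>0\<close>.
\<close>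

definition complete_theory :: "('f, 'r) lang \<Rightarrow> ('f, 'r) fm set \<Rightarrow> bool" where
  "complete_theory L T \<longleftrightarrow>
     T \<subseteq> sentences L \<and> (\<forall>\<phi> \<in> sentences L. \<phi> \<in> T \<or> Neg \<phi> \<in> T)"

definition automorphisms :: "('f, 'r) lang \<Rightarrow> ('f, 'r, 'm) struc \<Rightarrow> ('m \<Rightarrow> 'm) set" where
  "automorphisms L M = {\<sigma>. bij \<sigma> \<and>
     (\<forall>f xs. fun_ar L f = Some (length xs) \<longrightarrow>
        \<sigma> (fun_int M f xs) = fun_int M f (map \<sigma> xs)) \<and>
     (\<forall>R xs. rel_ar L R = Some (length xs) \<longrightarrow>
        (rel_int M R (map \<sigma> xs) \<longleftrightarrow> rel_int M R xs))}"


section \<open>Monster models\<close>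

text \<open>
  A pair \<open>(\<phi>, e)\<close> stands for the formula obtained from \<open>\<phi>\<close> by
  replacing each free variable \<open>n\<close> by \<open>e n\<close>.  Here \<open>p\<close> is
  a partial type over \<open>C\<close> in the single variable \<open>0\<close>.
\<close>

definition saturated ::
  "('f, 'r) lang \<Rightarrow> ('f, 'r, 'm) struc \<Rightarrow> 'k rel \<Rightarrow> bool" where
  "saturated L M \<kappa> \<longleftrightarrow>
     (\<forall>C :: 'm set. \<forall>p :: (('f, 'r) fm \<times> (nat \<Rightarrow> 'm)) set.
        |C| <o \<kappa> \<and>
        (\<forall>(\<phi>, e) \<in> p. wf_fm L \<phi> \<and> e ` (fv \<phi> - {0}) \<subseteq> C) \<and>
        (\<forall>q \<subseteq> p. finite q \<longrightarrow> (\<exists>x. \<forall>(\<phi>, e) \<in> q. sat M (e(0 := x)) \<phi>)) \<longrightarrow>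
        (\<exists>x. \<forall>(\<phi>, e) \<in> p. sat M (e(0 := x)) \<phi>))"

definition elementary_on ::
  "('f, 'r) lang \<Rightarrow> ('f, 'r, 'm) struc \<Rightarrow> 'm set \<Rightarrow> ('m \<Rightarrow> 'm) \<Rightarrow> bool" where
  "elementary_on L M C h \<longleftrightarrow>
     (\<forall>\<phi> e. wf_fm L \<phi> \<and> e ` fv \<phi> \<subseteq> C \<longrightarrow>
        (sat M e \<phi> \<longleftrightarrow> sat M (h \<circ> e) \<phi>))"

definition strongly_homogeneous ::
  "('f, 'r) lang \<Rightarrow> ('f, 'r, 'm) struc \<Rightarrow> 'k rel \<Rightarrow> bool" where
  "strongly_homogeneous L M \<kappa> \<longleftrightarrow>
     (\<forall>C h. |C| <o \<kappa> \<and> elementary_on L M C h \<longrightarrow>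
        (\<exists>\<sigma> \<in> automorphisms L M. \<forall>c \<in> C. \<sigma> c = h c))"

text \<open>
  The cardinal \<open>\<kappa>\<close> is the saturation of the monster model; as usual it is a strong
  limit above the size of the theory, and small means of cardinality less than \<open>\<kappa>\<close>.
\<close>

definition strong_limit :: "'k rel \<Rightarrow> bool" where
  "strong_limit \<kappa> \<longleftrightarrow> (\<forall>X :: 'k set. |X| <o \<kappa> \<longrightarrow> |Pow X| <o \<kappa>)"

definition monster_model ::
  "('f, 'r) lang \<Rightarrow> ('f, 'r) fm set \<Rightarrow> ('f, 'r, 'm) struc \<Rightarrow> 'k rel \<Rightarrow> bool" where
  "monster_model L T M \<kappa> \<longleftrightarrow>
     models M T \<and> Card_order \<kappa> \<and> |T| <o \<kappa> \<and> strong_limit \<kappa> \<and>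
     saturated L M \<kappa> \<and> strongly_homogeneous L M \<kappa>"


section \<open>Tuples, ultraimaginaries and hyperimaginaries\<close>

text \<open>
  A tuple is a family of elements of the monster indexed by a set (the domain of the partial
  map) of indices of type \<open>'k\<close>, the type carrying \<open>\<kappa>\<close>; every small
  index set has a copy there.
\<close>

type_synonym ('k, 'm) tuple = "'k \<rightharpoonup> 'm"

definition app :: "('m \<Rightarrow> 'm) \<Rightarrow> ('k, 'm) tuple \<Rightarrow> ('k, 'm) tuple" where
  "app \<sigma> a = map_option \<sigma> \<circ> a"

definition same_type ::
  "('f, 'r) lang \<Rightarrow> ('f, 'r, 'm) struc \<Rightarrow> ('i, 'm) tuple \<Rightarrow> ('i, 'm) tuple \<Rightarrow> bool" where
  "same_type L M u v \<longleftrightarrow> dom u = dom v \<and>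
     (\<forall>\<phi> s. wf_fm L \<phi> \<and> s ` fv \<phi> \<subseteq> dom u \<longrightarrow>
        (sat M (the \<circ> u \<circ> s) \<phi> \<longleftrightarrow> sat M (the \<circ> v \<circ> s) \<phi>))"

text \<open>The concatenation of the tuples \<open>a\<close> and \<open>b\<close> is \<open>case_sum a b\<close>.\<close>

definition invariant_equiv ::
  "('f, 'r) lang \<Rightarrow> ('f, 'r, 'm) struc \<Rightarrow> 'k set \<Rightarrow> ('k, 'm) tuple rel \<Rightarrow> bool" where
  "invariant_equiv L M I E \<longleftrightarrow> equiv {c. dom c = I} E \<and>
     (\<forall>a b c d. dom a = I \<and> dom b = I \<and> dom c = I \<and> dom d = I \<and>
        same_type L M (case_sum a b) (case_sum c d) \<longrightarrow>
        ((a, b) \<in> E \<longleftrightarrow> (c, d) \<in> E))"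

text \<open>
  The ultraimaginary \<open>a\<^sub>E\<close> is given by the pair \<open>(a, E)\<close>; nothing
  below depends on the choice of the representative \<open>a\<close> in its class.
\<close>

type_synonym ('k, 'm) imaginary = "('k, 'm) tuple \<times> ('k, 'm) tuple rel"

definition ultraimaginary ::
  "('f, 'r) lang \<Rightarrow> ('f, 'r, 'm) struc \<Rightarrow> 'k rel \<Rightarrow> ('k, 'm) imaginary \<Rightarrow> bool" where
  "ultraimaginary L M \<kappa> = (\<lambda>(a, E). |dom a| <o \<kappa> \<and> invariant_equiv L M (dom a) E)"

definition type_definable ::
  "('f, 'r) lang \<Rightarrow> ('f, 'r, 'm) struc \<Rightarrow> 'k set \<Rightarrow> ('k, 'm) tuple rel \<Rightarrow> bool" where
  "type_definable L M I E \<longleftrightarrow>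
     (\<exists>\<Phi> :: (('f, 'r) fm \<times> (nat \<Rightarrow> 'k + 'k)) set.
        (\<forall>(\<phi>, s) \<in> \<Phi>. wf_fm L \<phi> \<and> s ` fv \<phi> \<subseteq> I <+> I) \<and>
        E = {(c, d). dom c = I \<and> dom d = I \<and>
               (\<forall>(\<phi>, s) \<in> \<Phi>. sat M (the \<circ> case_sum c d \<circ> s) \<phi>)})"

definition hyperimaginary ::
  "('f, 'r) lang \<Rightarrow> ('f, 'r, 'm) struc \<Rightarrow> 'k rel \<Rightarrow> ('k, 'm) imaginary \<Rightarrow> bool" where
  "hyperimaginary L M \<kappa> = (\<lambda>(a, E). |dom a| <o \<kappa> \<and>
     equiv {c. dom c = dom a} E \<and> type_definable L M (dom a) E)"

text \<open>Real tuples (and, with a one-element domain, real elements) as imaginaries:\<close>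

definition real_im :: "('k, 'm) tuple \<Rightarrow> ('k, 'm) imaginary" where
  "real_im a = (a, Id_on {c. dom c = dom a})"

lemma hyperimaginary_real_im:
  fixes L :: "('f, 'r) lang" and M :: "('f, 'r, 'm) struc" and a :: "('k, 'm) tuple"
  assumes "|dom a| <o \<kappa>"
  shows "hyperimaginary L M \<kappa> (real_im a)"
proof -
  define \<Phi> :: "(('f, 'r) fm \<times> (nat \<Rightarrow> 'k + 'k)) set" where
    "\<Phi> = {(Eq (Var 0) (Var 1), s) | s. \<exists>i \<in> dom a. s 0 = Inl i \<and> s 1 = Inr i}"
  have wf: "\<forall>(\<phi>, s) \<in> \<Phi>. wf_fm L \<phi> \<and> s ` fv \<phi> \<subseteq> dom a <+> dom a"
    by (auto simp: \<Phi>_def)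
  have "c = d"
    if dom: "dom c = dom a" "dom d = dom a"
      and sat: "\<forall>(\<phi>, s) \<in> \<Phi>. sat M (the \<circ> case_sum c d \<circ> s) \<phi>" for c d
  proof
    fix i
    show "c i = d i"
    proof (cases "i \<in> dom a")
      case True
      have "(Eq (Var 0) (Var 1), \<lambda>n. if n = 0 then Inl i else Inr i) \<in> \<Phi>"
        using True by (auto simp: \<Phi>_def)
      with sat have "the (c i) = the (d i)"
        by fastforce
      moreover have "i \<in> dom c" "i \<in> dom d"
        using True dom by auto
      ultimately show ?thesis
        by (auto simp: dom_def)
    next
      case False
      then show ?thesis
        using dom by (metis domIff)
    qed
  qed
  then have "Id_on {c. dom c = dom a} = {(c, d). dom c = dom a \<and> dom d = dom a \<and>
      (\<forall>(\<phi>, s) \<in> \<Phi>. sat M (the \<circ> case_sum c d \<circ> s) \<phi>)}"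
    by (auto simp: \<Phi>_def)
  with wf have "type_definable L M (dom a) (Id_on {c. dom c = dom a})"
    unfolding type_definable_def by blast
  moreover have "equiv {c. dom c = dom a} (Id_on {c. dom c = dom a})"
    by (auto simp: equiv_def refl_on_def sym_def trans_def)
  ultimately show ?thesis
    using assms by (simp add: hyperimaginary_def real_im_def)
qed

text \<open>
  For a collection \<open>P\<close> of imaginaries, regarded as a single one via the product
  relation, the condition \<open>a E \<sigma>(a)\<close> is the conjunction of the conditions for the members.
  Equality of types over \<open>P\<close> is conjugacy under this group.
\<close>

definition aut_over ::
  "('f, 'r) lang \<Rightarrow> ('f, 'r, 'm) struc \<Rightarrow> ('k, 'm) imaginary set \<Rightarrow> ('m \<Rightarrow> 'm) set" where
  "aut_over L M P = {\<sigma> \<in> automorphisms L M. \<forall>(a, E) \<in> P. (a, app \<sigma> a) \<in> E}"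

definition orbit ::
  "('f, 'r) lang \<Rightarrow> ('f, 'r, 'm) struc \<Rightarrow> ('k, 'm) imaginary set \<Rightarrow> ('k, 'm) imaginary \<Rightarrow>
   ('k, 'm) tuple set set" where
  "orbit L M P = (\<lambda>(b, F). {F `` {app \<sigma> b} | \<sigma>. \<sigma> \<in> aut_over L M P})"

definition bddu ::
  "('f, 'r) lang \<Rightarrow> ('f, 'r, 'm) struc \<Rightarrow> 'k rel \<Rightarrow> ('k, 'm) imaginary set \<Rightarrow>
   ('k, 'm) imaginary set" where
  "bddu L M \<kappa> P = {x. ultraimaginary L M \<kappa> x \<and> |orbit L M P x| <o \<kappa>}"

definition bu_indep ::
  "('f, 'r) lang \<Rightarrow> ('f, 'r, 'm) struc \<Rightarrow> 'k rel \<Rightarrow> ('k, 'm) imaginary set \<Rightarrow>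
   ('k, 'm) imaginary set \<Rightarrow> ('k, 'm) imaginary set \<Rightarrow> bool" where
  "bu_indep L M \<kappa> A B C \<longleftrightarrow>
     bddu L M \<kappa> (A \<union> B) \<inter> bddu L M \<kappa> (A \<union> C) = bddu L M \<kappa> A"

text \<open>
  The size of a set of parameters counts the coordinates of the representatives.  This is the
  number of elements for a set of real elements, and agrees with the number of elements up to
  \<open>\<aleph>\<^sub>0\<close> for hyperimaginaries represented by countable tuples.  A hyperimaginary
  represented by a long tuple has to be counted with that length, as it may code just as many
  real elements.
\<close>

definition param_card :: "('k, 'm) imaginary set \<Rightarrow> (('k, 'm) imaginary \<times> 'k) rel" where
  "param_card A = |SIGMA x : A. dom (fst x)|"


section \<open>Sequences and total Morley sequences\<close>

text \<open>A sequence of tuples is a linear order, given on its field, with a family of tuples.\<close>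

type_synonym ('i, 'k, 'm) seq = "'i rel \<times> ('i \<Rightarrow> ('k, 'm) tuple)"

definition ord_sum :: "'i rel \<Rightarrow> 'j rel \<Rightarrow> ('i + 'j) rel" where
  "ord_sum r s = map_prod Inl Inl ` r \<union> map_prod Inr Inr ` s \<union>
     {(Inl x, Inr y) | x y. x \<in> Field r \<and> y \<in> Field s}"

definition seq_append :: "('i, 'k, 'm) seq \<Rightarrow> ('j, 'k, 'm) seq \<Rightarrow> ('i + 'j, 'k, 'm) seq" where
  "seq_append I J = (ord_sum (fst I) (fst J), case_sum (snd I) (snd J))"

definition seq_params :: "('i, 'k, 'm) seq \<Rightarrow> ('k, 'm) imaginary set" where
  "seq_params I = {real_im (snd I i) | i. i \<in> Field (fst I)}"

definition increasing :: "'i rel \<Rightarrow> 'i list \<Rightarrow> bool" where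
  "increasing r xs \<longleftrightarrow> set xs \<subseteq> Field r \<and> sorted_wrt (\<lambda>x y. (x, y) \<in> r \<and> x \<noteq> y) xs"

definition em_equiv ::
  "('f, 'r) lang \<Rightarrow> ('f, 'r, 'm) struc \<Rightarrow> ('k, 'm) imaginary set \<Rightarrow>
   ('i, 'k, 'm) seq \<Rightarrow> ('j, 'k, 'm) seq \<Rightarrow> bool" where
  "em_equiv L M A I J \<longleftrightarrow>
     (\<forall>xs ys. increasing (fst I) xs \<and> increasing (fst J) ys \<and> length xs = length ys \<longrightarrow>
        (\<exists>\<sigma> \<in> aut_over L M A. \<forall>n < length xs. app \<sigma> (snd I (xs ! n)) = snd J (ys ! n)))"

definition indiscernible ::
  "('f, 'r) lang \<Rightarrow> ('f, 'r, 'm) struc \<Rightarrow> ('k, 'm) imaginary set \<Rightarrow> ('i, 'k, 'm) seq \<Rightarrow> bool"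
  where "indiscernible L M A I \<longleftrightarrow> em_equiv L M A I I"

text \<open>
  As all sequences in the monster are small, linear orders on subsets of \<open>'k\<close>
  represent all order types.
\<close>

definition total_bu_Morley ::
  "('f, 'r) lang \<Rightarrow> ('f, 'r, 'm) struc \<Rightarrow> 'k rel \<Rightarrow> ('k, 'm) imaginary set \<Rightarrow>
   (nat \<Rightarrow> ('k, 'm) tuple) \<Rightarrow> bool" where
  "total_bu_Morley L M \<kappa> A B \<longleftrightarrow>
     indiscernible L M A (natLeq, B) \<and>
     (\<forall>(I :: ('k, 'k, 'm) seq) (J :: ('k, 'k, 'm) seq).
        Linear_order (fst I) \<and> |Field (fst I)| <o \<kappa> \<and>
        Linear_order (fst J) \<and> |Field (fst J)| <o \<kappa> \<and>
        em_equiv L M A (seq_append I J) (natLeq, B) \<longrightarrow>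
        bu_indep L M \<kappa> A (seq_params I) (seq_params J))"


section \<open>Partition relations and Erdos cardinals\<close>

text \<open>Ordinals are well-orders up to isomorphism.\<close>

definition partition_rel :: "'l rel \<Rightarrow> 'o rel \<Rightarrow> 'c rel \<Rightarrow> bool" where
  "partition_rel lam \<alpha> \<gamma> \<longleftrightarrow>
     (\<forall>f \<in> Fpow (Field lam) \<rightarrow> Field \<gamma>.
        \<exists>X \<subseteq> Field lam. Restr lam X =o \<alpha> \<and>
          (\<forall>n. \<forall>x \<in> [X]\<^bsup>n\<^esup>. \<forall>y \<in> [X]\<^bsup>n\<^esup>. f x = f y))"

definition omega_plus_one :: "(nat + unit) rel" where
  "omega_plus_one = ord_sum natLeq {((), ())}"

definition limit_ordinal :: "'o rel \<Rightarrow> bool" where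
  "limit_ordinal \<alpha> \<longleftrightarrow> Well_order \<alpha> \<and> Field \<alpha> \<noteq> {} \<and>
     (\<forall>x \<in> Field \<alpha>. \<exists>y \<in> Field \<alpha>. (x, y) \<in> \<alpha> \<and> x \<noteq> y)"

text \<open>
  For leastness it suffices to compare with cardinals on the same type, since every smaller
  cardinal has a copy there.
\<close>

definition Erdos_cardinal :: "'l rel \<Rightarrow> 'o rel \<Rightarrow> bool" where
  "Erdos_cardinal \<mu> \<alpha> \<longleftrightarrow>
     Card_order \<mu> \<and> partition_rel \<mu> \<alpha> ctwo \<and>
     (\<forall>\<nu> :: 'l rel. Card_order \<nu> \<and> partition_rel \<nu> \<alpha> ctwo \<longrightarrow> \<mu> \<le>o \<nu>)"

end

theory Submission
  imports Defs "HOL-Analysis.Analysis"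
begin

text \<open>
  Choose a small elementary set \<open>N\<close> containing \<open>b\<close> and representatives of \<open>A\<close> such that the monoid of
  self-maps of \<open>N\<close> induced by automorphisms over \<open>A\<close> is dense in the set of all conjugates of \<open>N\<close> over
  \<open>A\<close>. Let \<open>u\<close> be a minimal idempotent ultrafilter on this monoid. Starting from the identity, let
  each copy of \<open>N\<close> be a limit along \<open>u\<close> of reindexings of the previous one. As \<open>u\<close> is idempotent this is
  an indiscernible sequence, each final segment of which is finitely satisfiable, over the
  preceding part, in the copy where this part ends. The images of \<open>b\<close> form the required sequence.

  Given \<open>I + J\<close> with the same EM-type, compactness extends it to copies of \<open>N\<close>, with three more
  copies in the middle. By finite satisfiability, an ultraimaginary bounded over both \<open>I\<close> and \<open>J\<close> is
  bounded over, hence fixed by the stabilizer of, each of two consecutive middle copies. Such an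
  ultraimaginary is unchanged along steps of type \<open>u\<close>; minimality of \<open>u\<close> then shows that its
  conjugate by an automorphism over \<open>A\<close> depends only on the type over \<open>N\<close> of the conjugate of \<open>N\<close>.
  As there are few such types, the ultraimaginary is bounded over \<open>A\<close>.
\<close>

section \<open>Ultrafilters as a compact semigroup\<close>

text \<open>The tuple \<open>b\<close> alone has no self-maps to speak of; a set closed under many
  of them has a whole monoid. Reindexing a copy \<open>q\<close> of \<open>N\<close> by a self-map
  \<gamma> gives \<open>q \<circ> \<gamma>\<close>, and limits of such reindexings compose like
  ultrafilters in the Ellis semigroup of the monoid. So \<open>u \<star> u = u\<close> says that two
  steps of type \<open>u\<close> look like one. For any \<open>w\<close>, minimality yields
  \<open>v\<close> with \<open>v \<star> (w \<star> u) = u\<close>: after steps \<open>v\<close> and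
  \<open>w\<close>, a step \<open>u\<close> completes a single step of type \<open>u\<close>. An
  ultraimaginary constant along \<open>u\<close>-steps is therefore unchanged by \<open>v\<close>
  followed by \<open>w\<close>. Density of the self-maps makes every conjugate of \<open>N\<close>
  over \<open>A\<close> a limit along some such \<open>w\<close>. Being elementary is what improves
  "bounded over a copy" to "fixed by its stabilizer". Of the three middle copies the first two form
  a \<open>u\<close>-step; the third ensures that some copy lies to the right of both, so that
  fixing the right part pointwise implies being over \<open>A\<close>, even if \<open>J\<close> is
  empty.\<close>

definition ultra :: "('a set \<Rightarrow> bool) \<Rightarrow> bool" where
  "ultra u \<longleftrightarrow> (\<forall>A B. u (A \<inter> B) = (u A \<and> u B)) \<and> (\<forall>A. u (- A) = (\<not> u A))"

lemma ultra_Int: "ultra u \<Longrightarrow> u (A \<inter> B) \<longleftrightarrow> u A \<and> u B"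
  and ultra_Compl: "ultra u \<Longrightarrow> u (- A) \<longleftrightarrow> \<not> u A"
  by (simp_all add: ultra_def)

lemma ultra_empty: "ultra u \<Longrightarrow> \<not> u {}"
  by (metis Compl_disjoint ultra_Compl ultra_Int)

lemma ultra_mono: "ultra u \<Longrightarrow> u A \<Longrightarrow> A \<subseteq> B \<Longrightarrow> u B"
  by (metis inf.absorb_iff1 ultra_Int)

lemma ultra_nonempty: "ultra u \<Longrightarrow> u A \<Longrightarrow> \<exists>x. x \<in> A"
  using ultra_empty by (metis equals0I)

lemma ultra_UNIV: "ultra u \<Longrightarrow> u UNIV"
  by (metis Compl_empty_eq ultra_Compl ultra_empty)

text \<open>An ultrafilter may be evaluated on any one of its members. Limits along \<open>u\<close>
  are thus computed on self-maps only, and coheirs on \<open>N\<close>-valued maps only.\<close>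

lemma ultra_cong:
  assumes "ultra u" "u S" "\<And>x. x \<in> S \<Longrightarrow> x \<in> A \<longleftrightarrow> x \<in> B"
  shows "u A \<longleftrightarrow> u B"
proof -
  have "S \<inter> A = S \<inter> B"
    using assms(3) by blast
  then show ?thesis
    using assms(1,2) by (metis ultra_Int)
qed

lemma ultra_principal: "ultra (\<lambda>A. x \<in> A)"
  by (simp add: ultra_def)

lemma ultra_image: "ultra u \<Longrightarrow> ultra (\<lambda>A. u (f -` A))"
  by (auto simp: ultra_def vimage_Int vimage_Compl)

lemma compact_UNIV_pred: "compact (UNIV :: ('a \<Rightarrow> bool) set)"
proof -
  have "compact_space (product_topology (\<lambda>i::'a. euclidean :: bool topology) UNIV)"
    unfolding compact_space_product_topology
    by (simp add: compact_space_def finite_imp_compact)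
  then show ?thesis
    by (simp add: euclidean_product_topology[symmetric] compact_space_def flip: compactin_euclidean_iff)
qed

lemma compact_imp_closed_pred:
  fixes K :: "('a \<Rightarrow> bool) set"
  assumes "compact K"
  shows "closed K"
proof -
  have "Hausdorff_space (product_topology (\<lambda>i::'a. euclidean :: bool topology) UNIV)"
    unfolding Hausdorff_space_product_topology
    by (metis Hausdorff_space_def disjnt_def hausdorff open_openin)
  then show ?thesis
    using assms compactin_imp_closedin[of "euclidean :: ('a \<Rightarrow> bool) topology" K]
    by (simp add: euclidean_product_topology)
qed

lemma continuous_on_apply: "continuous_on S (\<lambda>u :: 'a \<Rightarrow> bool. u A)"
  by (rule continuous_on_subset[OF continuous_on_product_coordinates]) simp

lemma closed_apply: "closed {u :: 'a \<Rightarrow> bool. u A}"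
proof -
  have "closed {u :: 'a \<Rightarrow> bool. u A = True}"
    by (intro closed_Collect_eq continuous_on_apply continuous_on_const)
  then show ?thesis by simp
qed

lemma closed_not_apply: "closed {u :: 'a \<Rightarrow> bool. \<not> u A}"
proof -
  have "closed {u :: 'a \<Rightarrow> bool. u A = False}"
    by (intro closed_Collect_eq continuous_on_apply continuous_on_const)
  then show ?thesis by simp
qed

text \<open>Each defining identity involves finitely many coordinates, so the ultrafilters form a
  closed subset of a power of \<open>bool\<close>. The induced topology is the usual Stone
  topology.\<close>

lemma closed_ultra: "closed {u :: 'a set \<Rightarrow> bool. ultra u}"
proof -
  have 1: "closed {u :: 'a set \<Rightarrow> bool. u (A \<inter> B) = (u A \<and> u B)}" for A B
  proof -
    have "{u :: 'a set \<Rightarrow> bool. u (A \<inter> B) = (u A \<and> u B)} =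
      ({u. u (A \<inter> B)} \<inter> {u. u A} \<inter> {u. u B}) \<union> ({u. \<not> u (A \<inter> B)} \<inter> ({u. \<not> u A} \<union> {u. \<not> u B}))"
      by auto
    also have "closed \<dots>"
      by (intro closed_Un closed_Int closed_apply closed_not_apply)
    finally show ?thesis .
  qed
  have 2: "closed {u :: 'a set \<Rightarrow> bool. u (- A) = (\<not> u A)}" for A
  proof -
    have "{u :: 'a set \<Rightarrow> bool. u (- A) = (\<not> u A)} =
      ({u. u (- A)} \<inter> {u. \<not> u A}) \<union> ({u. \<not> u (- A)} \<inter> {u. u A})"
      by auto
    also have "closed \<dots>"
      by (intro closed_Un closed_Int closed_apply closed_not_apply)
    finally show ?thesis .
  qed
  have "{u :: 'a set \<Rightarrow> bool. ultra u} =
    (\<Inter>A. \<Inter>B. {u. u (A \<inter> B) = (u A \<and> u B)}) \<inter> (\<Inter>A. {u. u (- A) = (\<not> u A)})"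
    by (auto simp: ultra_def)
  also have "closed \<dots>"
    by (intro closed_Int closed_INT ballI 1 2)
  finally show ?thesis .
qed

text \<open>The sets \<open>{u. u A}\<close> are closed, and the principal ultrafilter at a point of
  a finite intersection shows that finitely many of them meet; compactness does the rest.\<close>

lemma ultra_extension:
  fixes \<F> :: "'a set set"
  assumes "\<And>G. finite G \<Longrightarrow> G \<subseteq> \<F> \<Longrightarrow> \<Inter> G \<noteq> {}"
  shows "\<exists>u. ultra u \<and> (\<forall>A \<in> \<F>. u A)"
proof -
  let ?C = "\<lambda>A. {u :: 'a set \<Rightarrow> bool. u A}"
  have "compact {u :: 'a set \<Rightarrow> bool. ultra u}"
    using compact_Int_closed[OF compact_UNIV_pred] closed_ultra by fastforce
  then have "{u. ultra u} \<inter> \<Inter> (?C ` \<F>) \<noteq> {}"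
  proof (rule compact_imp_fip)
    show "closed T" if "T \<in> ?C ` \<F>" for T
    proof -
      from that obtain A where "T = ?C A" unfolding image_iff by blast
      then show ?thesis by (simp only: closed_apply)
    qed
    fix H assume "finite H" "H \<subseteq> ?C ` \<F>"
    then obtain G where G: "finite G" "G \<subseteq> \<F>" "H = ?C ` G"
      by (metis finite_subset_image)
    then obtain x where "x \<in> \<Inter> G"
      using assms by blast
    then have "(\<lambda>A. x \<in> A) \<in> {u. ultra u} \<inter> \<Inter> H"
      using G ultra_principal by auto
    then show "{u. ultra u} \<inter> \<Inter> H \<noteq> {}"
      by blast
  qed
  then obtain u where "u \<in> {u. ultra u} \<inter> \<Inter> (?C ` \<F>)"
    unfolding ex_in_conv[symmetric] by (rule exE)
  then have "ultra u" "\<forall>A \<in> \<F>. u A"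
    by simp_all
  then show ?thesis by (intro exI[of _ u] conjI)
qed

section \<open>Idempotents in compact semigroups with one-sided continuity\<close>

lemma minimal_closed:
  fixes S :: "'a::topological_space set"
  assumes S: "compact S" "closed S" "S \<noteq> {}" "P S"
    and Inter: "\<And>\<C>. \<C> \<noteq> {} \<Longrightarrow> (\<And>C. C \<in> \<C> \<Longrightarrow> P C) \<Longrightarrow> P (\<Inter> \<C>)"
  obtains R where "R \<subseteq> S" "closed R" "R \<noteq> {}" "P R"
    "\<And>R'. R' \<subseteq> R \<Longrightarrow> closed R' \<Longrightarrow> R' \<noteq> {} \<Longrightarrow> P R' \<Longrightarrow> R' = R"
proof -
  \<comment> \<open>Complements turn a minimal closed set into a maximal open one, to which Zorn's
    lemma for unions of chains applies.\<close>
  define \<A> where "\<A> = {U. - U \<subseteq> S \<and> closed (- U) \<and> - U \<noteq> {} \<and> P (- U)}"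
  have "\<exists>M \<in> \<A>. \<forall>X \<in> \<A>. M \<subseteq> X \<longrightarrow> X = M"
  proof (rule subset_Zorn_nonempty)
    have "- S \<in> \<A>"
      using S by (simp add: \<A>_def)
    then show "\<A> \<noteq> {}"
      by blast
    fix C assume C: "C \<noteq> {}" "subset.chain \<A> C"
    have D: "- X \<subseteq> S" "closed (- X)" "- X \<noteq> {}" "P (- X)" if "X \<in> C" for X
      using that C(2) by (auto simp: subset_chain_def \<A>_def)
    have ch: "X \<subseteq> Y \<or> Y \<subseteq> X" if "X \<in> C" "Y \<in> C" for X Y
      using that C(2) by (auto simp: subset_chain_def)
    have fin: "\<exists>X \<in> C. \<Union> H \<subseteq> X" if "finite H" "H \<subseteq> C" for H
      using that
    proof (induction H rule: finite_induct)
      case empty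
      then show ?case using C(1) by auto
    next
      case (insert Y H)
      then obtain X where X: "X \<in> C" "\<Union> H \<subseteq> X" and Y: "Y \<in> C" by auto
      have "X \<subseteq> Y \<or> Y \<subseteq> X" by (rule ch[OF X(1) Y])
      then show ?case
      proof
        assume "X \<subseteq> Y"
        then have "\<Union> (insert Y H) \<subseteq> Y" using X(2) by simp
        then show ?thesis using Y by (rule bexI)
      next
        assume "Y \<subseteq> X"
        then have "\<Union> (insert Y H) \<subseteq> X" using X(2) by simp
        then show ?thesis using X(1) by (rule bexI)
      qed
    qed
    have "S \<inter> \<Inter> (uminus ` C) \<noteq> {}"
    proof (rule compact_imp_fip[OF S(1)])
      fix X assume "X \<in> uminus ` C"
      then show "closed X" using D(2) by (metis imageE)
    next
      fix H assume H: "finite H" "H \<subseteq> uminus ` C"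
      then obtain H' where H': "finite H'" "H' \<subseteq> C" "H = uminus ` H'"
        by (metis finite_subset_image)
      obtain X where X: "X \<in> C" "\<Union> H' \<subseteq> X"
        using fin[OF H'(1,2)] by (rule bexE)
      obtain y where y: "y \<in> - X" using D(3)[OF X(1)] by blast
      have "y \<in> S \<inter> \<Inter> H"
        using D(1)[OF X(1)] X(2) y H'(3) by auto
      then show "S \<inter> \<Inter> H \<noteq> {}" by (metis empty_iff)
    qed
    then have "\<Inter> (uminus ` C) \<noteq> {}" by (metis inf_bot_right)
    moreover have "closed (\<Inter> (uminus ` C))"
      using D(2) by (intro closed_Inter) auto
    moreover have "P (\<Inter> (uminus ` C))"
      using Inter[of "uminus ` C"] D(4) C(1) by auto
    moreover have "\<Inter> (uminus ` C) \<subseteq> S"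
      using D(1) C(1) by auto
    moreover have "- \<Union> C = \<Inter> (uminus ` C)"
      by auto
    ultimately show "\<Union> C \<in> \<A>"
      unfolding \<A>_def mem_Collect_eq by metis
  qed
  then obtain M where M: "M \<in> \<A>" and min: "\<forall>X \<in> \<A>. M \<subseteq> X \<longrightarrow> X = M"
    by (rule bexE)
  show ?thesis
  proof (rule that)
    show "- M \<subseteq> S" "closed (- M)" "- M \<noteq> {}" "P (- M)"
      using M unfolding \<A>_def by simp_all
    fix R' assume R': "R' \<subseteq> - M" "closed R'" "R' \<noteq> {}" "P R'"
    then have "- R' \<in> \<A>"
      using M by (auto simp: \<A>_def)
    moreover have "M \<subseteq> - R'"
      using R'(1) by blast
    ultimately have "- R' = M"
      using min by (metis)
    then show "R' = - M"
      by auto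
  qed
qed

text \<open>
  Ellis' argument inside a minimal right ideal \<open>I\<close>: for the idempotent \<open>u\<close> found there, \<open>I * u\<close> is a
  group with unit \<open>u\<close>, which provides the left inverses.
\<close>

lemma minimal_idempotent:
  fixes mul :: "'a::topological_space \<Rightarrow> 'a \<Rightarrow> 'a" (infixl \<open>\<star>\<close> 70)
  assumes comp: "compact S" "closed S" and ne: "S \<noteq> {}"
    and mult: "\<And>u v. u \<in> S \<Longrightarrow> v \<in> S \<Longrightarrow> u \<star> v \<in> S"
    and assoc: "\<And>u v w. (u \<star> v) \<star> w = u \<star> (v \<star> w)"
    and img: "\<And>u C. u \<in> S \<Longrightarrow> closed C \<Longrightarrow> C \<subseteq> S \<Longrightarrow> closed ((\<lambda>v. u \<star> v) ` C)"
    and fixd: "\<And>u. closed {v. u \<star> v = u}"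
  obtains u where "u \<in> S" "u \<star> u = u" "\<And>w. w \<in> S \<Longrightarrow> \<exists>v \<in> S. v \<star> (w \<star> u) = u"
proof -
  obtain I where I: "I \<subseteq> S" "closed I" "I \<noteq> {}" "\<forall>u \<in> I. \<forall>v \<in> S. u \<star> v \<in> I"
    and minI: "\<And>R'. R' \<subseteq> I \<Longrightarrow> closed R' \<Longrightarrow> R' \<noteq> {} \<Longrightarrow>
      \<forall>u \<in> R'. \<forall>v \<in> S. u \<star> v \<in> R' \<Longrightarrow> R' = I"
    by (rule minimal_closed[OF comp ne, of "\<lambda>R. \<forall>u \<in> R. \<forall>v \<in> S. u \<star> v \<in> R"])
       (use mult in auto)
  \<comment> \<open>For \<open>u\<close> in the minimal closed right ideal \<open>I\<close>, the
    image \<open>u \<star> S\<close> is a closed right ideal inside \<open>I\<close>, hence equal to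
    \<open>I\<close>.\<close>
  have right: "\<exists>w \<in> S. u \<star> w = v" if "u \<in> I" "v \<in> I" for u v
  proof -
    have "closed ((\<lambda>v. u \<star> v) ` S)"
      using that I comp by (intro img) auto
    then have "(\<lambda>v. u \<star> v) ` S = I"
      using that I ne assoc mult by (intro minI) auto
    then show ?thesis using that by (metis imageE)
  qed
  have "compact I"
    using comp(1) I by (metis compact_Int_closed inf.absorb2)
  \<comment> \<open>The Ellis-Numakura argument: for \<open>u\<close> in a minimal closed
    subsemigroup \<open>R\<close>, both \<open>u \<star> R\<close> and the set \<open>?K\<close> of
    right units of \<open>u\<close> in \<open>R\<close> are closed subsemigroups. The first being
    \<open>R\<close> makes the second nonempty, and so equal to \<open>R\<close>.\<close>
  then obtain R where R: "R \<subseteq> I" "closed R" "R \<noteq> {}" "\<forall>u \<in> R. \<forall>v \<in> R. u \<star> v \<in> R"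
    and minR: "\<And>R'. R' \<subseteq> R \<Longrightarrow> closed R' \<Longrightarrow> R' \<noteq> {} \<Longrightarrow>
      \<forall>u \<in> R'. \<forall>v \<in> R'. u \<star> v \<in> R' \<Longrightarrow> R' = R"
    by (rule minimal_closed[OF _ I(2,3), of "\<lambda>R. \<forall>u \<in> R. \<forall>v \<in> R. u \<star> v \<in> R"])
       (use I in auto)
  obtain u where u: "u \<in> R"
    using R(3) by blast
  have uI: "u \<in> I" and uS: "u \<in> S"
    using u R I by auto
  have "closed ((\<lambda>v. u \<star> v) ` R)"
    using uS R I by (intro img) auto
  then have "(\<lambda>v. u \<star> v) ` R = R"
    using R u assoc by (intro minR) auto
  then obtain v0 where v0: "v0 \<in> R" "u \<star> v0 = u"
    using u by (metis imageE)
  let ?K = "R \<inter> {v. u \<star> v = u}"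
  have "closed ?K"
    using R(2) fixd by blast
  moreover have "\<forall>v \<in> ?K. \<forall>w \<in> ?K. v \<star> w \<in> ?K"
    using R(4) by (auto simp: assoc[symmetric])
  ultimately have "?K = R"
    using v0 by (intro minR) auto
  then have idem: "u \<star> u = u"
    using u by blast
  show ?thesis
  proof (rule that[OF uS idem])
    fix w assume w: "w \<in> S"
    define g where "g = u \<star> w \<star> u"
    have gI: "g \<in> I" using uI uS w I(4) by (auto simp: g_def)
    obtain h where h: "h \<in> S" "g \<star> h = u"
      using right[OF gI uI] by blast
    define h' where "h' = u \<star> h \<star> u"
    have gu: "g \<star> u = g" by (simp add: g_def assoc idem)
    have gh': "g \<star> h' = u"
      using gu h(2) idem unfolding h'_def by (simp flip: assoc)
    have h'u: "h' \<star> u = h'" by (simp add: h'_def assoc idem)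
    have h'I: "h' \<in> I" using uI uS h I(4) by (auto simp: h'_def)
    \<comment> \<open>As in a monoid with right inverses: the right inverse \<open>k\<close> of
      \<open>h'\<close> turns the right inverse \<open>h'\<close> of \<open>g\<close> into a left
      inverse.\<close>
    obtain k where k: "k \<in> S" "h' \<star> k = u"
      using right[OF h'I uI] by blast
    have "g = g \<star> (h' \<star> k)"
      using k gu by simp
    also have "\<dots> = u \<star> k"
      by (simp add: gh' flip: assoc)
    finally have "h' \<star> g = (h' \<star> u) \<star> k"
      by (simp add: assoc)
    then have "h' \<star> g = u"
      by (simp add: h'u k)
    moreover have "h' \<star> g = (h' \<star> u) \<star> (w \<star> u)"
      by (simp add: g_def assoc)
    ultimately show "\<exists>v \<in> S. v \<star> (w \<star> u) = u" using h'I I(1) h'u by auto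
  qed
qed

text \<open>The Ellis product, a pushforward along composition. The map \<open>g\<close>, drawn from
  the right factor, acts first; in \<open>q \<circ> f \<circ> g\<close> the right factor is thus the
  later of two reindexing steps.\<close>

definition ultra_comp :: "(('a \<Rightarrow> 'a) set \<Rightarrow> bool) \<Rightarrow> (('a \<Rightarrow> 'a) set \<Rightarrow> bool) \<Rightarrow>
    ('a \<Rightarrow> 'a) set \<Rightarrow> bool" (infixl \<open>\<star>\<close> 70) where
  "(u \<star> v) A = v {g. u {f. f \<circ> g \<in> A}}"

lemma ultra_ultra_comp:
  fixes u v :: "('a \<Rightarrow> 'a) set \<Rightarrow> bool"
  assumes uv: "ultra u" "ultra v"
  shows "ultra (u \<star> v)"
proof -
  have "u {f. f \<circ> g \<in> A \<inter> B} \<longleftrightarrow> u {f. f \<circ> g \<in> A} \<and> u {f. f \<circ> g \<in> B}"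
    for A B :: "('a \<Rightarrow> 'a) set" and g
  proof -
    have "{f. f \<circ> g \<in> A \<inter> B} = {f. f \<circ> g \<in> A} \<inter> {f. f \<circ> g \<in> B}"
      by auto
    then show ?thesis by (simp only: ultra_Int[OF uv(1)])
  qed
  moreover have "u {f. f \<circ> g \<in> - A} \<longleftrightarrow> \<not> u {f. f \<circ> g \<in> A}"
    for A :: "('a \<Rightarrow> 'a) set" and g
  proof -
    have "{f. f \<circ> g \<in> - A} = - {f. f \<circ> g \<in> A}"
      by auto
    then show ?thesis by (simp only: ultra_Compl[OF uv(1)])
  qed
  ultimately have "{g. u {f. f \<circ> g \<in> A \<inter> B}} = {g. u {f. f \<circ> g \<in> A}} \<inter> {g. u {f. f \<circ> g \<in> B}}"
    and "{g. u {f. f \<circ> g \<in> - A}} = - {g. u {f. f \<circ> g \<in> A}}" for A B :: "('a \<Rightarrow> 'a) set"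
    by (simp_all only: Collect_conj_eq Collect_neg_eq)
  then have "(u \<star> v) (A \<inter> B) \<longleftrightarrow> (u \<star> v) A \<and> (u \<star> v) B"
    and "(u \<star> v) (- A) \<longleftrightarrow> \<not> (u \<star> v) A" for A B
    by (simp_all only: ultra_comp_def ultra_Int[OF uv(2)] ultra_Compl[OF uv(2)])
  then show ?thesis
    unfolding ultra_def by blast
qed

text \<open>Each coordinate of \<open>u \<star> v\<close> is a coordinate of \<open>v\<close>, so
  the product is continuous in its right factor; the ultrafilters containing the monoid \<Gamma>
  form a closed subsemigroup.\<close>

lemma minimal_idempotent_ultra:
  fixes \<Gamma> :: "('a \<Rightarrow> 'a) set"
  assumes "id \<in> \<Gamma>" "\<And>f g. f \<in> \<Gamma> \<Longrightarrow> g \<in> \<Gamma> \<Longrightarrow> f \<circ> g \<in> \<Gamma>"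
  obtains u where "ultra u" "u \<Gamma>" "u \<star> u = u"
    "\<And>w. ultra w \<Longrightarrow> w \<Gamma> \<Longrightarrow> \<exists>v. ultra v \<and> v \<Gamma> \<and> v \<star> (w \<star> u) = u"
proof -
  let ?S = "{u. ultra u} \<inter> {u. u \<Gamma>}"
  have 1: "compact ?S"
    using compact_Int_closed[OF compact_UNIV_pred closed_Int[OF closed_ultra closed_apply]] by simp
  have 2: "(\<lambda>A. id \<in> A) \<in> ?S"
    using assms(1) ultra_principal by auto
  have 3: "u \<star> v \<in> ?S" if "u \<in> ?S" "v \<in> ?S" for u v
  proof -
    have "\<Gamma> \<subseteq> {f. f \<circ> g \<in> \<Gamma>}" if "g \<in> \<Gamma>" for g
      using that assms(2) by auto
    then have "\<Gamma> \<subseteq> {g. u {f. f \<circ> g \<in> \<Gamma>}}"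
      using \<open>u \<in> ?S\<close> by (auto intro: ultra_mono)
    then have "(u \<star> v) \<Gamma>"
      using \<open>v \<in> ?S\<close> unfolding ultra_comp_def by (auto intro: ultra_mono)
    then show ?thesis using that ultra_ultra_comp by auto
  qed
  have 4: "(u \<star> v) \<star> w = u \<star> (v \<star> w)" for u v w :: "('a \<Rightarrow> 'a) set \<Rightarrow> bool"
    by (rule ext) (simp add: ultra_comp_def comp_assoc)
  have cont: "continuous_on UNIV (\<lambda>v. u \<star> v)" for u :: "('a \<Rightarrow> 'a) set \<Rightarrow> bool"
  proof (rule continuous_on_coordinatewise_then_product)
    show "continuous_on UNIV (\<lambda>v. (u \<star> v) A)" for A
      unfolding ultra_comp_def by (rule continuous_on_apply)
  qed
  have 5: "closed ((\<lambda>v. u \<star> v) ` C)" if "closed C" for u :: "('a \<Rightarrow> 'a) set \<Rightarrow> bool" and C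
  proof (intro compact_imp_closed_pred compact_continuous_image)
    show "compact C"
      using compact_Int_closed[OF compact_UNIV_pred that] by simp
    show "continuous_on C (\<lambda>v. u \<star> v)"
      using cont continuous_on_subset by blast
  qed
  have 6: "closed {v. u \<star> v = u}" for u :: "('a \<Rightarrow> 'a) set \<Rightarrow> bool"
  proof -
    have "closed {v. (u \<star> v) A = u A}" for A
      unfolding ultra_comp_def
      by (intro closed_Collect_eq continuous_on_apply continuous_on_const)
    then have "closed (\<Inter>A. {v. (u \<star> v) A = u A})"
      by blast
    also have "(\<Inter>A. {v. (u \<star> v) A = u A}) = {v. u \<star> v = u}"
      by auto
    finally show ?thesis .
  qed
  have 7: "closed ?S"
    by (intro closed_Int closed_ultra closed_apply)
  have ne: "?S \<noteq> {}"
    using 2 by blast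
  show ?thesis
  proof (rule minimal_idempotent[OF 1 7 ne 3 4 5 6])
    fix u
    assume u: "u \<in> ?S" "u \<star> u = u" "\<And>w. w \<in> ?S \<Longrightarrow> \<exists>v \<in> ?S. v \<star> (w \<star> u) = u"
    show thesis
      using u by (intro that[of u]) blast+
  qed
qed

section \<open>Definable sets of assignments\<close>

lemma eval_tm_cong: "(\<And>n. n \<in> fv_tm t \<Longrightarrow> e n = e' n) \<Longrightarrow> eval_tm M e t = eval_tm M e' t"
proof (induction t)
  case (App f ts)
  then have "map (eval_tm M e) ts = map (eval_tm M e') ts"
    by auto
  then show ?case by (simp only: eval_tm.simps)
qed simp

lemma sat_cong: "(\<And>n. n \<in> fv \<phi> \<Longrightarrow> e n = e' n) \<Longrightarrow> sat M e \<phi> = sat M e' \<phi>"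
proof (induction \<phi> arbitrary: e e')
  case (Eq t u)
  then have "eval_tm M e t = eval_tm M e' t" "eval_tm M e u = eval_tm M e' u"
    by (auto intro: eval_tm_cong)
  then show ?case by simp
next
  case (Rel R ts)
  then have "map (eval_tm M e) ts = map (eval_tm M e') ts"
    by (auto intro: eval_tm_cong)
  then show ?case by (simp only: sat.simps)
next
  case (Neg \<phi>)
  have "sat M e \<phi> = sat M e' \<phi>"
    by (rule Neg.IH) (rule Neg.prems, simp)
  then show ?case by (simp only: sat.simps)
next
  case (Conj \<phi> \<psi>)
  have "sat M e \<phi> = sat M e' \<phi>" "sat M e \<psi> = sat M e' \<psi>"
    by (rule Conj.IH, rule Conj.prems, simp)+
  then show ?case by (simp only: sat.simps)
next
  case (All n \<phi>)
  have "sat M (e(n := x)) \<phi> = sat M (e'(n := x)) \<phi>" for x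
    by (rule All.IH) (use All.prems in auto)
  then show ?case by (simp only: sat.simps)
qed

lemma finite_fv_tm: "finite (fv_tm t)"
  by (induction t) auto

lemma finite_fv: "finite (fv \<phi>)"
  by (induction \<phi>) (auto simp: finite_fv_tm)

section \<open>Renaming of variables in formulas\<close>

fun ren_tm :: "(nat \<Rightarrow> nat) \<Rightarrow> 'f tm \<Rightarrow> 'f tm" where
  "ren_tm \<rho> (Var n) = Var (\<rho> n)"
| "ren_tm \<rho> (App f ts) = App f (map (ren_tm \<rho>) ts)"

lemma fv_ren_tm: "fv_tm (ren_tm \<rho> t) = \<rho> ` fv_tm t"
  by (induction t) auto

lemma wf_ren_tm: "wf_tm L (ren_tm \<rho> t) = wf_tm L t"
  by (induction t) auto

lemma eval_ren_tm: "eval_tm M e (ren_tm \<rho> t) = eval_tm M (e \<circ> \<rho>) t"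
proof (induction t)
  case (App f ts)
  then have "map (eval_tm M e) (map (ren_tm \<rho>) ts) = map (eval_tm M (e \<circ> \<rho>)) ts"
    by (auto simp: comp_def)
  then show ?case by (simp only: eval_tm.simps ren_tm.simps)
qed simp

text \<open>A bound variable has to move away from the new names of the free ones to avoid capture.
  So the renamed formula is only claimed to exist, by induction over all \<rho> at once, which
  leaves room to change \<rho> at a quantifier.\<close>

lemma rename_fm:
  assumes "wf_fm L \<phi>"
  shows "\<exists>\<psi>. wf_fm L \<psi> \<and> fv \<psi> \<subseteq> \<rho> ` fv \<phi> \<and> (\<forall>e. sat M e \<psi> = sat M (e \<circ> \<rho>) \<phi>)"
  using assms
proof (induction \<phi> arbitrary: \<rho>)
  case (Eq t u)
  then show ?case
    by (intro exI[of _ "Eq (ren_tm \<rho> t) (ren_tm \<rho> u)"])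
       (simp add: wf_ren_tm fv_ren_tm eval_ren_tm image_Un comp_def)
next
  case (Rel R ts)
  have "map (eval_tm M e) (map (ren_tm \<rho>) ts) = map (eval_tm M (e \<circ> \<rho>)) ts" for e
    by (simp add: eval_ren_tm)
  then have "sat M e (Rel R (map (ren_tm \<rho>) ts)) = sat M (e \<circ> \<rho>) (Rel R ts)" for e
    by (simp only: sat.simps)
  moreover have "wf_fm L (Rel R (map (ren_tm \<rho>) ts))"
    using Rel by (simp add: wf_ren_tm)
  moreover have "fv (Rel R (map (ren_tm \<rho>) ts)) \<subseteq> \<rho> ` fv (Rel R ts)"
    by (auto simp: fv_ren_tm)
  ultimately show ?case by blast
next
  case (Neg \<phi>)
  have "wf_fm L \<phi>" using Neg.prems by simp
  from Neg.IH[OF this, of \<rho>] obtain \<psi> where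
    \<psi>: "wf_fm L \<psi>" "fv \<psi> \<subseteq> \<rho> ` fv \<phi>" "\<And>e. sat M e \<psi> = sat M (e \<circ> \<rho>) \<phi>"
    by blast
  show ?case
    by (rule exI[of _ "Neg \<psi>"]) (simp only: wf_fm.simps fv.simps sat.simps \<psi> simp_thms)
next
  case (Conj \<phi> \<psi>)
  have wf: "wf_fm L \<phi>" "wf_fm L \<psi>" using Conj.prems by simp_all
  from Conj.IH(1)[OF wf(1), of \<rho>] obtain \<phi>' where
    \<phi>': "wf_fm L \<phi>'" "fv \<phi>' \<subseteq> \<rho> ` fv \<phi>" "\<And>e. sat M e \<phi>' = sat M (e \<circ> \<rho>) \<phi>"
    by blast
  from Conj.IH(2)[OF wf(2), of \<rho>] obtain \<psi>' where
    \<psi>': "wf_fm L \<psi>'" "fv \<psi>' \<subseteq> \<rho> ` fv \<psi>" "\<And>e. sat M e \<psi>' = sat M (e \<circ> \<rho>) \<psi>"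
    by blast
  have "fv \<phi>' \<union> fv \<psi>' \<subseteq> \<rho> ` (fv \<phi> \<union> fv \<psi>)"
    using \<phi>'(2) \<psi>'(2) by blast
  then show ?case
    by (intro exI[of _ "Conj \<phi>' \<psi>'"]) (simp only: wf_fm.simps fv.simps sat.simps \<phi>' \<psi>' simp_thms)
next
  case (All n \<phi>)
  obtain m where m: "m \<notin> \<rho> ` fv \<phi>"
    using finite_fv[of \<phi>] by (meson ex_new_if_finite finite_imageI infinite_UNIV_nat)
  have "wf_fm L \<phi>"
    using All.prems by simp
  from All.IH[OF this, of "\<rho>(n := m)"] obtain \<psi> where
    \<psi>: "wf_fm L \<psi>" "fv \<psi> \<subseteq> (\<rho>(n := m)) ` fv \<phi>" "\<And>e. sat M e \<psi> = sat M (e \<circ> \<rho>(n := m)) \<phi>"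
    by blast
  have "sat M (e(m := x) \<circ> \<rho>(n := m)) \<phi> = sat M ((e \<circ> \<rho>)(n := x)) \<phi>" for e x
    using m by (intro sat_cong) auto
  then have "\<forall>e. sat M e (All m \<psi>) = sat M (e \<circ> \<rho>) (All n \<phi>)"
    by (simp add: \<psi>(3))
  moreover have "fv (All m \<psi>) \<subseteq> \<rho> ` fv (All n \<phi>)"
    using \<psi>(2) by (auto split: if_splits)
  moreover have "wf_fm L (All m \<psi>)"
    using \<psi>(1) by simp
  ultimately show ?case
    by (intro exI[of _ "All m \<psi>"] conjI)
qed

definition Ex :: "nat \<Rightarrow> ('f, 'r) fm \<Rightarrow> ('f, 'r) fm" where
  "Ex n \<phi> = Neg (All n (Neg \<phi>))"

lemma Ex_simps [simp]:
  "wf_fm L (Ex n \<phi>) = wf_fm L \<phi>" "fv (Ex n \<phi>) = fv \<phi> - {n}"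
  "sat M e (Ex n \<phi>) \<longleftrightarrow> (\<exists>x. sat M (e(n := x)) \<phi>)"
  by (simp_all add: Ex_def)

locale interpretation_of =
  fixes L :: "('f, 'r) lang" and M :: "('f, 'r, 'm) struc"
begin

text \<open>Variables come from an arbitrary type and are attached to the numbers in a formula by
  \<open>s\<close>. Parameters are no separate notion: an element \<open>x\<close> serves as a
  variable \<open>Inl x\<close>, to which \<open>case_sum id p\<close> gives the value
  \<open>x\<close>.\<close>

definition df :: "'v set \<Rightarrow> ('v \<Rightarrow> 'm) set \<Rightarrow> bool" where
  "df V Z \<longleftrightarrow> (\<exists>\<phi> s. wf_fm L \<phi> \<and> s ` fv \<phi> \<subseteq> V \<and> Z = {h. sat M (h \<circ> s) \<phi>})"

lemma dfI: "wf_fm L \<phi> \<Longrightarrow> s ` fv \<phi> \<subseteq> V \<Longrightarrow> df V {h. sat M (h \<circ> s) \<phi>}"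
  unfolding df_def by blast

lemma df_mono: "df V Z \<Longrightarrow> V \<subseteq> W \<Longrightarrow> df W Z"
  unfolding df_def by blast

lemma df_agree:
  assumes "df V Z" "\<And>v. v \<in> V \<Longrightarrow> g v = h v"
  shows "g \<in> Z \<longleftrightarrow> h \<in> Z"
proof -
  obtain \<phi> s where "s ` fv \<phi> \<subseteq> V" "Z = {h. sat M (h \<circ> s) \<phi>}"
    using assms(1) unfolding df_def by blast
  then show ?thesis
    using assms(2) sat_cong[of \<phi> "g \<circ> s" "h \<circ> s" M] by auto
qed

lemma df_finite:
  assumes "df V Z"
  obtains V0 where "finite V0" "V0 \<subseteq> V" "df V0 Z"
proof -
  obtain \<phi> s where s: "wf_fm L \<phi>" "s ` fv \<phi> \<subseteq> V" "Z = {h. sat M (h \<circ> s) \<phi>}"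
    using assms unfolding df_def by blast
  then show ?thesis
    using that[of "s ` fv \<phi>"] finite_fv[of \<phi>] dfI by blast
qed

text \<open>Numbering the free variables by their positions in a list codes a definable set by a
  formula and a finite list over \<open>V\<close>. Types are counted, and sets are closed under
  witnesses, by means of these codes.\<close>

lemma df_list:
  assumes "df V Z"
  obtains \<phi> vs where "wf_fm L \<phi>" "set vs \<subseteq> V" "fv \<phi> \<subseteq> {..<length vs}"
    "\<And>h. h \<in> Z \<longleftrightarrow> sat M (\<lambda>i. h (vs ! i)) \<phi>"
proof -
  obtain \<phi> s where s: "wf_fm L \<phi>" "s ` fv \<phi> \<subseteq> V" "Z = {h. sat M (h \<circ> s) \<phi>}"
    using assms unfolding df_def by blast
  obtain ns where ns: "set ns = fv \<phi>"
    using finite_list[OF finite_fv] by blast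
  define \<rho> where "\<rho> n = (SOME i. i < length ns \<and> ns ! i = n)" for n
  have \<rho>: "\<rho> n < length ns" "ns ! \<rho> n = n" if "n \<in> fv \<phi>" for n
  proof -
    have "\<exists>i. i < length ns \<and> ns ! i = n"
      using that ns by (metis in_set_conv_nth)
    then show "\<rho> n < length ns" "ns ! \<rho> n = n"
      unfolding \<rho>_def by (metis (mono_tags, lifting) someI_ex)+
  qed
  obtain \<psi> where \<psi>: "wf_fm L \<psi>" "fv \<psi> \<subseteq> \<rho> ` fv \<phi>" "\<And>e. sat M e \<psi> = sat M (e \<circ> \<rho>) \<phi>"
    using rename_fm[OF s(1), of \<rho> M] by blast
  have fv: "fv \<psi> \<subseteq> {..<length ns}"
    using \<psi>(2) \<rho>(1) by auto
  show ?thesis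
  proof (rule that[OF \<psi>(1)])
    show "set (map s ns) \<subseteq> V" "fv \<psi> \<subseteq> {..<length (map s ns)}"
      using s(2) ns fv by auto
    fix h
    have "sat M (\<lambda>i. h (map s ns ! i)) \<psi> = sat M ((\<lambda>i. h (map s ns ! i)) \<circ> \<rho>) \<phi>"
      by (rule \<psi>(3))
    also have "\<dots> = sat M (h \<circ> s) \<phi>"
      by (rule sat_cong) (simp add: \<rho>)
    finally show "h \<in> Z \<longleftrightarrow> sat M (\<lambda>i. h (map s ns ! i)) \<psi>"
      by (simp add: s(3))
  qed
qed

lemma df_vimage:
  assumes "df V Z" "r ` V \<subseteq> W"
  shows "df W {h. h \<circ> r \<in> Z}"
proof -
  obtain \<phi> s where s: "wf_fm L \<phi>" "s ` fv \<phi> \<subseteq> V" "Z = {h. sat M (h \<circ> s) \<phi>}"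
    using assms unfolding df_def by blast
  have "(r \<circ> s) ` fv \<phi> \<subseteq> W"
    using s(2) assms(2) by auto
  from dfI[OF s(1) this] show ?thesis
    by (simp add: s(3) comp_assoc)
qed

lemma df_Compl:
  assumes "df V Z" shows "df V (- Z)"
proof -
  obtain \<phi> s where s: "wf_fm L \<phi>" "s ` fv \<phi> \<subseteq> V" "Z = {h. sat M (h \<circ> s) \<phi>}"
    using assms unfolding df_def by blast
  have "df V {h. sat M (h \<circ> s) (Neg \<phi>)}"
    using s by (intro dfI) auto
  also have "{h. sat M (h \<circ> s) (Neg \<phi>)} = - Z"
    using s(3) by auto
  finally show ?thesis .
qed

lemma df_Int:
  assumes "df V Y" "df V Z" shows "df V (Y \<inter> Z)"
proof -
  obtain \<phi> vs where 1: "wf_fm L \<phi>" "set vs \<subseteq> V" "fv \<phi> \<subseteq> {..<length vs}"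
    "\<And>h. h \<in> Y \<longleftrightarrow> sat M (\<lambda>i. h (vs ! i)) \<phi>"
    using df_list[OF assms(1)] by metis
  obtain \<psi> ws where 2: "wf_fm L \<psi>" "set ws \<subseteq> V" "fv \<psi> \<subseteq> {..<length ws}"
    "\<And>h. h \<in> Z \<longleftrightarrow> sat M (\<lambda>i. h (ws ! i)) \<psi>"
    using df_list[OF assms(2)] by metis
  let ?\<rho> = "\<lambda>i. length vs + i"
  obtain \<psi>' where \<psi>': "wf_fm L \<psi>'" "fv \<psi>' \<subseteq> ?\<rho> ` fv \<psi>" "\<And>e. sat M e \<psi>' = sat M (e \<circ> ?\<rho>) \<psi>"
    using rename_fm[OF 2(1), of ?\<rho> M] by blast
  let ?s = "\<lambda>i. (vs @ ws) ! i"
  have "?s i \<in> V" if "i \<in> fv \<phi> \<union> fv \<psi>'" for i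
  proof -
    have "i < length (vs @ ws)"
      using that 1(3) 2(3) \<psi>'(2) by fastforce
    then have "?s i \<in> set (vs @ ws)"
      by (rule nth_mem)
    then show ?thesis using 1(2) 2(2) by auto
  qed
  then have "df V {h. sat M (h \<circ> ?s) (Conj \<phi> \<psi>')}"
    using 1 \<psi>' by (intro dfI) auto
  also have "{h. sat M (h \<circ> ?s) (Conj \<phi> \<psi>')} = Y \<inter> Z"
  proof -
    have "sat M (h \<circ> ?s) \<phi> = sat M (\<lambda>i. h (vs ! i)) \<phi>" for h
      using 1(3) by (intro sat_cong) (auto simp: nth_append)
    moreover have "sat M (h \<circ> ?s) \<psi>' = sat M (\<lambda>i. h (ws ! i)) \<psi>" for h
      unfolding \<psi>'(3) by (intro sat_cong) (auto simp: nth_append)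
    ultimately show ?thesis
      using 1(4) 2(4) by auto
  qed
  finally show ?thesis .
qed

lemma df_eq: "v \<in> V \<Longrightarrow> w \<in> V \<Longrightarrow> df V {h. h v = h w}"
  using dfI[of "Eq (Var 0) (Var 1)" "\<lambda>i. if i = 0 then v else w" V] by auto

lemma df_UNIV: "df V UNIV"
proof -
  have "df V {h. sat M (h \<circ> undefined) (All 0 (Eq (Var 0) (Var 0)))}"
    by (rule dfI) auto
  then show ?thesis by simp
qed

lemma df_Inter: "finite \<Z> \<Longrightarrow> (\<And>Z. Z \<in> \<Z> \<Longrightarrow> df V Z) \<Longrightarrow> df V (\<Inter> \<Z>)"
  by (induction \<Z> rule: finite_induct) (auto intro: df_UNIV df_Int)

lemma df_upd:
  assumes "df (insert v V) Z"
  obtains \<phi> s where "wf_fm L \<phi>" "s ` (fv \<phi> - {0}) \<subseteq> V - {v}"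
    "\<And>h x. h(v := x) \<in> Z \<longleftrightarrow> sat M ((h \<circ> s)(0 := x)) \<phi>"
proof -
  obtain \<phi> s where s: "wf_fm L \<phi>" "s ` fv \<phi> \<subseteq> insert v V" "Z = {h. sat M (h \<circ> s) \<phi>}"
    using assms unfolding df_def by blast
  \<comment> \<open>The variable \<open>v\<close> becomes number 0, the one variable of the types in
    \<open>saturated\<close>; the others are shifted by one to keep 0 free.\<close>
  let ?\<rho> = "\<lambda>i. if s i = v then 0 else Suc i"
  obtain \<psi> where \<psi>: "wf_fm L \<psi>" "fv \<psi> \<subseteq> ?\<rho> ` fv \<phi>" "\<And>e. sat M e \<psi> = sat M (e \<circ> ?\<rho>) \<phi>"
    using rename_fm[OF s(1), of ?\<rho> M] by blast
  show ?thesis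
  proof (rule that[OF \<psi>(1)])
    show "(\<lambda>i. s (i - 1)) ` (fv \<psi> - {0}) \<subseteq> V - {v}"
      using \<psi>(2) s(2) by (fastforce split: if_splits)
    fix h x
    have "sat M ((h \<circ> (\<lambda>i. s (i - 1)))(0 := x)) \<psi> = sat M (h(v := x) \<circ> s) \<phi>"
      unfolding \<psi>(3) by (intro sat_cong) auto
    then show "h(v := x) \<in> Z \<longleftrightarrow> sat M ((h \<circ> (\<lambda>i. s (i - 1)))(0 := x)) \<psi>"
      by (simp add: s(3))
  qed
qed

lemma df_ex:
  assumes "df (insert v V) Z"
  shows "df (V - {v}) {h. \<exists>x. h(v := x) \<in> Z}"
proof (rule df_upd[OF assms])
  fix \<phi> s
  assume s: "wf_fm L \<phi>" "s ` (fv \<phi> - {0}) \<subseteq> V - {v}"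
    "\<And>h x. h(v := x) \<in> Z \<longleftrightarrow> sat M ((h \<circ> s)(0 := x)) \<phi>"
  have "df (V - {v}) {h. sat M (h \<circ> s) (Ex 0 \<phi>)}"
    using s(1,2) by (intro dfI) auto
  then show "df (V - {v}) {h. \<exists>x. h(v := x) \<in> Z}"
    by (simp only: s(3) Ex_simps)
qed

definition tequiv :: "'v set \<Rightarrow> ('v \<Rightarrow> 'm) \<Rightarrow> ('v \<Rightarrow> 'm) \<Rightarrow> bool" where
  "tequiv V g h \<longleftrightarrow> (\<forall>Z. df V Z \<longrightarrow> (g \<in> Z \<longleftrightarrow> h \<in> Z))"

lemma tequivI: "(\<And>Z. df V Z \<Longrightarrow> g \<in> Z \<longleftrightarrow> h \<in> Z) \<Longrightarrow> tequiv V g h"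
  by (simp add: tequiv_def)

lemma tequivD: "tequiv V g h \<Longrightarrow> df V Z \<Longrightarrow> g \<in> Z \<longleftrightarrow> h \<in> Z"
  by (simp add: tequiv_def)

lemma tequiv_sym: "tequiv V g h \<Longrightarrow> tequiv V h g"
  and tequiv_trans: "tequiv V g h \<Longrightarrow> tequiv V h k \<Longrightarrow> tequiv V g k"
  by (simp_all add: tequiv_def)

lemma tequiv_agree: "(\<And>v. v \<in> V \<Longrightarrow> g v = h v) \<Longrightarrow> tequiv V g h"
  by (rule tequivI) (rule df_agree)

lemma tequiv_comp:
  assumes "tequiv W g h" "r ` V \<subseteq> W"
  shows "tequiv V (g \<circ> r) (h \<circ> r)"
proof (rule tequivI)
  fix Z assume "df V Z"
  then have "df W {k. k \<circ> r \<in> Z}"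
    using assms(2) by (rule df_vimage)
  then show "g \<circ> r \<in> Z \<longleftrightarrow> h \<circ> r \<in> Z"
    using tequivD[OF assms(1)] by fastforce
qed

lemma tequiv_eqD: "tequiv V g h \<Longrightarrow> v \<in> V \<Longrightarrow> w \<in> V \<Longrightarrow> g v = g w \<Longrightarrow> h v = h w"
  using tequivD[OF _ df_eq, of V g h v w] by simp

section \<open>Automorphisms\<close>

abbreviation Aut :: "('m \<Rightarrow> 'm) set" where
  "Aut \<equiv> automorphisms L M"

lemma aut_bij: "\<sigma> \<in> Aut \<Longrightarrow> bij \<sigma>"
  by (simp add: automorphisms_def)

lemma aut_id: "id \<in> Aut"
  by (simp add: automorphisms_def)

lemma aut_comp: "\<sigma> \<in> Aut \<Longrightarrow> \<tau> \<in> Aut \<Longrightarrow> \<sigma> \<circ> \<tau> \<in> Aut"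
  by (auto simp: automorphisms_def bij_comp simp flip: map_map)

lemma aut_inv:
  assumes "\<sigma> \<in> Aut"
  shows "inv \<sigma> \<in> Aut"
proof -
  have b: "bij \<sigma>" using assms by (rule aut_bij)
  have m: "map \<sigma> (map (inv \<sigma>) xs) = xs" for xs :: "'m list"
    using b by (simp add: map_idI bij_is_surj surj_f_inv_f)
  show ?thesis
    unfolding automorphisms_def
  proof (intro CollectI conjI allI impI)
    show "bij (inv \<sigma>)" using b by (rule bij_imp_bij_inv)
    fix f and xs :: "'m list" assume "fun_ar L f = Some (length xs)"
    then have "\<sigma> (fun_int M f (map (inv \<sigma>) xs)) = fun_int M f (map \<sigma> (map (inv \<sigma>) xs))"
      using assms by (simp add: automorphisms_def)
    then show "inv \<sigma> (fun_int M f xs) = fun_int M f (map (inv \<sigma>) xs)"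
      unfolding m using b by (metis bij_inv_eq_iff)
  next
    fix R and xs :: "'m list" assume "rel_ar L R = Some (length xs)"
    then have "rel_int M R (map \<sigma> (map (inv \<sigma>) xs)) = rel_int M R (map (inv \<sigma>) xs)"
      using assms by (simp add: automorphisms_def del: map_map)
    then show "rel_int M R (map (inv \<sigma>) xs) = rel_int M R xs"
      unfolding m by simp
  qed
qed

lemma aut_inv_apply: "\<sigma> \<in> Aut \<Longrightarrow> \<sigma> (inv \<sigma> x) = x" "\<sigma> \<in> Aut \<Longrightarrow> inv \<sigma> (\<sigma> x) = x"
  by (simp_all add: aut_bij bij_is_surj surj_f_inv_f bij_is_inj inv_f_f)

lemma aut_inv_comp: "\<sigma> \<in> Aut \<Longrightarrow> \<sigma> \<circ> inv \<sigma> = id" "\<sigma> \<in> Aut \<Longrightarrow> inv \<sigma> \<circ> \<sigma> = id"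
  by (rule ext, simp add: aut_inv_apply(1)[of \<sigma>] aut_inv_apply(2)[of \<sigma>])+

lemma aut_eval: "\<sigma> \<in> Aut \<Longrightarrow> wf_tm L t \<Longrightarrow> eval_tm M (\<sigma> \<circ> e) t = \<sigma> (eval_tm M e t)"
proof (induction t)
  case (App f ts)
  then have "map (eval_tm M (\<sigma> \<circ> e)) ts = map \<sigma> (map (eval_tm M e) ts)"
    by (auto simp: comp_def)
  then show ?case
    using App.prems by (simp only: eval_tm.simps) (simp add: automorphisms_def del: map_map)
qed simp

lemma aut_sat:
  assumes "\<sigma> \<in> Aut" "wf_fm L \<phi>"
  shows "sat M (\<sigma> \<circ> e) \<phi> = sat M e \<phi>"
  using assms(2)
proof (induction \<phi> arbitrary: e)
  case (Eq t u)
  then have "eval_tm M (\<sigma> \<circ> e) t = \<sigma> (eval_tm M e t)" "eval_tm M (\<sigma> \<circ> e) u = \<sigma> (eval_tm M e u)"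
    using aut_eval[OF assms(1)] by auto
  then show ?case
    using bij_is_inj[OF aut_bij[OF assms(1)]] by (simp only: sat.simps inj_eq)
next
  case (Rel R ts)
  then have "map (eval_tm M (\<sigma> \<circ> e)) ts = map \<sigma> (map (eval_tm M e) ts)"
    using aut_eval[OF assms(1)] by (auto simp: comp_def)
  then show ?case
    using Rel assms(1) by (simp only: sat.simps) (simp add: automorphisms_def del: map_map)
next
  case (All n \<phi>)
  have upd: "(\<sigma> \<circ> e)(n := \<sigma> x) = \<sigma> \<circ> e(n := x)" for x
    by auto
  have "(\<forall>x. sat M ((\<sigma> \<circ> e)(n := x)) \<phi>) = (\<forall>x. sat M ((\<sigma> \<circ> e)(n := \<sigma> x)) \<phi>)"
    using aut_inv_apply(1)[OF assms(1)] by metis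
  also have "\<dots> = (\<forall>x. sat M (e(n := x)) \<phi>)"
    using All unfolding upd wf_fm.simps by blast
  finally show ?case
    by (simp only: sat.simps)
next
  case (Neg \<phi>)
  then show ?case unfolding sat.simps wf_fm.simps by blast
next
  case (Conj \<phi> \<psi>)
  then show ?case unfolding sat.simps wf_fm.simps by blast
qed

lemma aut_df:
  assumes "\<sigma> \<in> Aut" "df V Z"
  shows "\<sigma> \<circ> h \<in> Z \<longleftrightarrow> h \<in> Z"
proof -
  obtain \<phi> s where s: "wf_fm L \<phi>" "s ` fv \<phi> \<subseteq> V" "Z = {h. sat M (h \<circ> s) \<phi>}"
    using assms unfolding df_def by blast
  show ?thesis
    unfolding s(3) mem_Collect_eq comp_assoc by (rule aut_sat[OF assms(1) s(1)])
qed

lemma aut_tequiv: "\<sigma> \<in> Aut \<Longrightarrow> tequiv V (\<sigma> \<circ> h) h"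
  by (rule tequivI) (rule aut_df)

definition fixer :: "'m set \<Rightarrow> ('m \<Rightarrow> 'm) set" where
  "fixer X = {\<sigma> \<in> Aut. \<forall>x \<in> X. \<sigma> x = x}"

lemma fixer_aut: "\<sigma> \<in> fixer X \<Longrightarrow> \<sigma> \<in> Aut"
  and fixerD: "\<sigma> \<in> fixer X \<Longrightarrow> x \<in> X \<Longrightarrow> \<sigma> x = x"
  and fixerI: "\<sigma> \<in> Aut \<Longrightarrow> (\<And>x. x \<in> X \<Longrightarrow> \<sigma> x = x) \<Longrightarrow> \<sigma> \<in> fixer X"
  by (auto simp: fixer_def)

lemma fixer_comp_inv:
  assumes "\<sigma> \<in> Aut" "\<tau> \<in> Aut" "\<And>x. x \<in> X \<Longrightarrow> \<sigma> x = \<tau> x"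
  shows "inv \<tau> \<circ> \<sigma> \<in> fixer X"
proof (rule fixerI)
  show "inv \<tau> \<circ> \<sigma> \<in> Aut"
    using assms(1,2) by (intro aut_comp aut_inv)
  show "(inv \<tau> \<circ> \<sigma>) x = x" if "x \<in> X" for x
    using assms(3)[OF that] aut_inv_apply(2)[OF assms(2)] by simp
qed

end

section \<open>Cardinality\<close>

lemma card_finite_infinite: "finite F \<Longrightarrow> infinite Y \<Longrightarrow> |F| \<le>o |Y|"
  by (rule ordLess_imp_ordLeq[OF finite_ordLess_infinite[OF card_of_Well_order card_of_Well_order]])
     (simp_all add: Field_card_of)

lemma card_Times_infinite:
  "infinite Y \<Longrightarrow> |X| \<le>o |Y| \<Longrightarrow> |Z| \<le>o |Y| \<Longrightarrow> |X \<times> Z| \<le>o |Y|"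
  by (rule card_of_Times_ordLeq_infinite_Field) (simp_all add: Field_card_of card_of_card_order_on)

lemma card_Un_infinite:
  "infinite Y \<Longrightarrow> |X| \<le>o |Y| \<Longrightarrow> |Z| \<le>o |Y| \<Longrightarrow> |X \<union> Z| \<le>o |Y|"
  by (rule card_of_Un_ordLeq_infinite_Field) (simp_all add: Field_card_of card_of_card_order_on)

lemma card_Plus_infinite:
  "infinite Y \<Longrightarrow> |X| \<le>o |Y| \<Longrightarrow> |Z| \<le>o |Y| \<Longrightarrow> |X <+> Z| \<le>o |Y|"
  by (rule card_of_Plus_ordLeq_infinite_Field) (simp_all add: Field_card_of card_of_card_order_on)

lemma card_lists_infinite:
  assumes inf: "infinite Y" and X: "|X| \<le>o |Y|"
  shows "|lists X| \<le>o |Y|"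
proof -
  have "|{xs \<in> lists X. length xs = n}| \<le>o |Y|" for n
  proof (induction n)
    case 0
    have "{xs \<in> lists X. length xs = 0} = {[]}" by auto
    then show ?case by (simp only:) (rule card_finite_infinite[OF _ inf], simp)
  next
    case (Suc n)
    have eq: "{xs \<in> lists X. length xs = Suc n} =
        (\<lambda>(x, xs). x # xs) ` (X \<times> {xs \<in> lists X. length xs = n})"
      by (auto simp: length_Suc_conv)
    have "|(\<lambda>(x, xs). x # xs) ` (X \<times> {xs \<in> lists X. length xs = n})| \<le>o
        |X \<times> {xs \<in> lists X. length xs = n}|"
      by (rule card_of_image)
    also have "|X \<times> {xs \<in> lists X. length xs = n}| \<le>o |Y|"
      using inf X Suc.IH by (rule card_Times_infinite)
    finally show ?case unfolding eq .
  qed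
  then have "|\<Union>n. {xs \<in> lists X. length xs = n}| \<le>o |Y|"
    using infinite_iff_card_of_nat[THEN iffD1, OF inf]
    by (intro card_of_UNION_ordLeq_infinite[OF inf]) auto
  moreover have "(\<Union>n. {xs \<in> lists X. length xs = n}) = lists X"
    by auto
  ultimately show ?thesis by simp
qed

text \<open>Countably many iterations suffice since \<open>S\<close> is finitary, which
  \<open>cont\<close> expresses. One infinite bound \<open>Y\<close> serves all stages.\<close>

lemma closure_exists:
  fixes S :: "'a set \<Rightarrow> 'a set"
  assumes inf: "infinite Y" and X: "|X| \<le>o |Y|"
    and S: "\<And>N. |N| \<le>o |Y| \<Longrightarrow> |S N| \<le>o |Y|"
    and cont: "\<And>f :: nat \<Rightarrow> 'a set. incseq f \<Longrightarrow> S (\<Union>i. f i) \<subseteq> (\<Union>i. S (f i))"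
  obtains N where "X \<subseteq> N" "S N \<subseteq> N" "|N| \<le>o |Y|"
proof -
  define f where "f k = ((\<lambda>N. N \<union> S N) ^^ k) X" for k
  have f0: "f 0 = X" and fS: "f (Suc k) = f k \<union> S (f k)" for k
    by (simp_all add: f_def)
  have card: "|f k| \<le>o |Y|" for k
    by (induction k) (simp_all add: f0 X fS card_Un_infinite[OF inf] S)
  have inc: "incseq f"
    by (rule incseq_SucI) (auto simp: fS)
  show ?thesis
  proof (rule that[of "\<Union>k. f k"])
    show "X \<subseteq> (\<Union>k. f k)" using f0 by blast
    have "S (\<Union>k. f k) \<subseteq> (\<Union>k. S (f k))" by (rule cont[OF inc])
    also have "\<dots> \<subseteq> (\<Union>k. f (Suc k))" by (auto simp: fS)
    also have "\<dots> \<subseteq> (\<Union>k. f k)" by blast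
    finally show "S (\<Union>k. f k) \<subseteq> (\<Union>k. f k)" .
    show "|\<Union>k. f k| \<le>o |Y|"
      using infinite_iff_card_of_nat[THEN iffD1, OF inf] card
      by (intro card_of_UNION_ordLeq_infinite[OF inf]) auto
  qed
qed

lemma lists_UN_incseq:
  fixes f :: "nat \<Rightarrow> 'a set"
  assumes "incseq f" "xs \<in> lists (\<Union>i. f i)"
  shows "\<exists>i. xs \<in> lists (f i)"
  using assms(2)
proof (induction xs)
  case (Cons x xs)
  then obtain i j where ij: "x \<in> f i" "xs \<in> lists (f j)" by auto
  have "f i \<subseteq> f (max i j)" "f j \<subseteq> f (max i j)"
    using assms(1) by (simp_all add: incseqD)
  then have "x # xs \<in> lists (f (max i j))"
    using ij by auto
  then show ?case ..
qed auto

lemma finite_linear_max: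
  assumes "finite F" "F \<noteq> {}" "trans r" "total r" "refl r"
  shows "\<exists>y \<in> F. \<forall>x \<in> F. (x, y) \<in> r"
  using assms(1,2)
proof (induction F rule: finite_ne_induct)
  case (singleton x)
  then show ?case using assms(5) by (auto simp: refl_on_def)
next
  case (insert x F)
  then obtain y where y: "y \<in> F" "\<forall>x \<in> F. (x, y) \<in> r" by blast
  show ?case
  proof (cases "(x, y) \<in> r")
    case True
    then show ?thesis using y by blast
  next
    case False
    then have "(y, x) \<in> r"
      using assms(4,5) by (metis refl_onD total_on_def UNIV_I)
    then have "\<forall>z \<in> F. (z, x) \<in> r"
      using y(2) assms(3) by (meson transD)
    moreover have "(x, x) \<in> r"
      using assms(5) by (simp add: refl_on_def)
    ultimately show ?thesis by blast
  qed
qed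

section \<open>Counting formulas by means of the complete theory\<close>

fun un_Neg :: "('f, 'r) fm \<Rightarrow> ('f, 'r) fm" where
  "un_Neg (Neg \<phi>) = \<phi>"
| "un_Neg \<phi> = \<phi>"

fun un_All :: "('f, 'r) fm \<Rightarrow> ('f, 'r) fm" where
  "un_All (All n \<phi>) = \<phi>"
| "un_All \<phi> = \<phi>"

text \<open>Stripping the quantifiers off recovers a formula from a universal closure, so a formula
  is determined by a sentence and a number.\<close>

lemma sentence_closure:
  "wf_fm L (foldr All ns \<phi>) = wf_fm L \<phi>" "fv (foldr All ns \<phi>) = fv \<phi> - set ns"
  "(un_All ^^ length ns) (foldr All ns \<phi>) = \<phi>"
  by (induction ns) (auto simp: funpow_swap1)

section \<open>Small sets in the monster model\<close>

locale monster = interpretation_of L M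
  for L :: "('f, 'r) lang" and M :: "('f, 'r, 'm) struc" +
  fixes T :: "('f, 'r) fm set" and \<kappa> :: "'k rel"
  assumes complete: "complete_theory L T" and monster: "monster_model L T M \<kappa>"
begin

abbreviation WF :: "('f, 'r) fm set" where
  "WF \<equiv> {\<phi>. wf_fm L \<phi>}"

definition small :: "'x set \<Rightarrow> bool" where
  "small X \<longleftrightarrow> |X| <o \<kappa>"

lemma Card_order_\<kappa>: "Card_order \<kappa>"
  using monster by (simp add: monster_model_def)

lemma small_card: "|X| \<le>o |Y| \<Longrightarrow> small Y \<Longrightarrow> small X"
  unfolding small_def by (rule ordLeq_ordLess_trans)

lemma small_subset: "small Y \<Longrightarrow> X \<subseteq> Y \<Longrightarrow> small X"
  by (rule small_card[OF card_of_mono1])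

lemma small_image: "small X \<Longrightarrow> small (f ` X)"
  by (rule small_card[OF card_of_image])

lemma small_T: "small T"
  using monster by (simp add: monster_model_def small_def)

lemma sentences_subset: "sentences L \<subseteq> T \<union> un_Neg ` T"
proof
  fix \<phi> assume "\<phi> \<in> sentences L"
  then have "\<phi> \<in> T \<or> Neg \<phi> \<in> T"
    using complete by (simp add: complete_theory_def)
  then show "\<phi> \<in> T \<union> un_Neg ` T"
    by (metis UnI1 UnI2 image_eqI un_Neg.simps(1))
qed

text \<open>Iterated negations of one sentence have increasing sizes, so there are infinitely many
  sentences; by completeness each is a member of \<open>T\<close> or obtained from one by removing a
  negation.\<close>

lemma infinite_T: "infinite T"
proof
  assume "finite T"
  then have "finite (T \<union> un_Neg ` T)"
    by simp
  then have "finite (sentences L)"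
    by (rule finite_subset[OF sentences_subset])
  define f :: "nat \<Rightarrow> ('f, 'r) fm" where "f n = (Neg ^^ n) (All 0 (Eq (Var 0) (Var 0)))" for n
  have sent: "f n \<in> sentences L" for n
    unfolding f_def by (induction n) (simp_all add: sentences_def)
  have f_Suc: "f (Suc n) = Neg (f n)" for n
    by (simp add: f_def)
  have "strict_mono (size \<circ> f)"
    unfolding strict_mono_Suc_iff by (simp add: f_Suc)
  then have "inj f"
    by (metis inj_on_imageI2 strict_mono_imp_inj_on)
  then have "infinite (range f)"
    by (rule range_inj_infinite)
  moreover have "range f \<subseteq> sentences L"
    using sent by (rule image_subsetI)
  ultimately show False
    using \<open>finite (sentences L)\<close> finite_subset by blast
qed

lemma small_ordLeq_Field: "small X \<Longrightarrow> |X| \<le>o |Field \<kappa>|"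
  unfolding small_def
  by (rule ordLeq_ordIso_trans[OF ordLess_imp_ordLeq ordIso_symmetric[OF card_of_Field_ordIso[OF Card_order_\<kappa>]]])

lemma infinite_Field_\<kappa>: "infinite (Field \<kappa>)"
proof
  assume "finite (Field \<kappa>)"
  then have "finite T"
    by (rule card_of_ordLeq_finite[OF small_ordLeq_Field[OF small_T]])
  then show False
    using infinite_T by contradiction
qed

lemma small_finite: "finite X \<Longrightarrow> small X"
  by (rule small_card[OF card_finite_infinite[OF _ infinite_T] small_T])

lemma small_Plus: "small X \<Longrightarrow> small Y \<Longrightarrow> small (X <+> Y)"
  unfolding small_def
  by (rule card_of_Plus_ordLess_infinite_Field[OF infinite_Field_\<kappa> Card_order_\<kappa>])

lemma small_Un: "small X \<Longrightarrow> small Y \<Longrightarrow> small (X \<union> Y)"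
  unfolding small_def
  by (rule card_of_Un_ordLess_infinite_Field[OF infinite_Field_\<kappa> Card_order_\<kappa>])

text \<open>The saturation cardinal may be singular, so small families are bounded by a common infinite small set.\<close>

lemma small_bound:
  assumes "small X" "small Y"
  obtains B :: "('x + 'y + ('f, 'r) fm) set" where "infinite B" "small B"
    "|X :: 'x set| \<le>o |B|" "|Y :: 'y set| \<le>o |B|" "|T| \<le>o |B|"
proof
  let ?B = "X <+> Y <+> T"
  show "infinite ?B" using infinite_T by (auto simp: Plus_def finite_image_iff)
  show "small ?B" by (rule small_Plus[OF assms(1) small_Plus[OF assms(2) small_T]])
  show "|X| \<le>o |?B|" by (rule card_of_Plus1)
  show "|Y| \<le>o |?B|" by (rule ordLeq_transitive[OF card_of_Plus1 card_of_Plus2])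
  show "|T| \<le>o |?B|" by (rule ordLeq_transitive[OF card_of_Plus2 card_of_Plus2])
qed

lemma small_Times:
  fixes X :: "'x set" and Y :: "'y set"
  assumes "small X" "small Y"
  shows "small (X \<times> Y)"
proof -
  obtain B :: "('x + 'y + ('f, 'r) fm) set" where
    B: "infinite B" "small B" "|X| \<le>o |B|" "|Y| \<le>o |B|" "|T| \<le>o |B|"
    by (rule small_bound[OF assms])
  show ?thesis by (rule small_card[OF card_Times_infinite[OF B(1,3,4)] B(2)])
qed

lemma small_lists:
  fixes X :: "'x set"
  assumes "small X"
  shows "small (lists X)"
proof -
  obtain B :: "('x + 'x + ('f, 'r) fm) set" where
    B: "infinite B" "small B" "|X| \<le>o |B|" "|X| \<le>o |B|" "|T| \<le>o |B|"
    by (rule small_bound[OF assms assms])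
  show ?thesis by (rule small_card[OF card_lists_infinite[OF B(1,3)] B(2)])
qed

lemma small_nat: "small (UNIV :: nat set)"
  using small_card[OF infinite_iff_card_of_nat[THEN iffD1, OF infinite_T] small_T] .

lemma small_WF: "small WF"
proof -
  have "WF \<subseteq> (\<lambda>(k, \<psi>). (un_All ^^ k) \<psi>) ` (UNIV \<times> sentences L)"
  proof
    fix \<phi> assume "\<phi> \<in> WF"
    obtain ns where ns: "set ns = fv \<phi>"
      using finite_list[OF finite_fv] by blast
    have "foldr All ns \<phi> \<in> sentences L"
      using \<open>\<phi> \<in> WF\<close> ns unfolding sentences_def mem_Collect_eq sentence_closure(1,2) by simp
    then have "(length ns, foldr All ns \<phi>) \<in> UNIV \<times> sentences L"
      by blast
    moreover have "\<phi> = (\<lambda>(k, \<psi>). (un_All ^^ k) \<psi>) (length ns, foldr All ns \<phi>)"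
      by (simp only: split sentence_closure(3))
    ultimately show "\<phi> \<in> (\<lambda>(k, \<psi>). (un_All ^^ k) \<psi>) ` (UNIV \<times> sentences L)"
      by (rule image_eqI[rotated])
  qed
  moreover have "small (sentences L)"
    by (rule small_subset[OF small_Un[OF small_T small_image[OF small_T]] sentences_subset])
  ultimately show ?thesis
    using small_subset[OF small_image[OF small_Times[OF small_nat]]] by blast
qed

lemma small_UN_image:
  assumes "small I" "small X"
  shows "small (\<Union>i \<in> I. f i ` X)"
proof -
  have "(\<Union>i \<in> I. f i ` X) = (\<lambda>(i, x). f i x) ` (I \<times> X)"
    by auto
  then show ?thesis
    by (simp only: small_image[OF small_Times[OF assms]])
qed

text \<open>The strong limit property speaks of sets of type \<open>'k\<close> only, hence the
  detour through a copy of \<open>X\<close> in \<open>Field \<kappa>\<close>.\<close>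

lemma small_Pow:
  fixes X :: "'x set"
  assumes "small X"
  shows "small (Pow X)"
proof -
  obtain f where f: "inj_on f X" "f ` X \<subseteq> Field \<kappa>"
    using small_ordLeq_Field[OF assms] unfolding card_of_ordLeq[symmetric] by blast
  have "small (f ` X)"
    using assms by (rule small_image)
  then have "small (Pow (f ` X))"
    using monster by (simp add: small_def monster_model_def strong_limit_def)
  moreover have "Pow X \<subseteq> (\<lambda>Z. {x \<in> X. f x \<in> Z}) ` Pow (f ` X)"
  proof
    fix Y assume Y: "Y \<in> Pow X"
    have "x \<in> Y" if "x \<in> X" "f x \<in> f ` Y" for x
      using that Y f(1) by (metis Pow_iff inj_on_image_mem_iff)
    then have "Y = {x \<in> X. f x \<in> f ` Y}"
      using Y by blast
    moreover have "f ` Y \<in> Pow (f ` X)"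
      using Y by blast
    ultimately show "Y \<in> (\<lambda>Z. {x \<in> X. f x \<in> Z}) ` Pow (f ` X)"
      by (rule image_eqI)
  qed
  ultimately show ?thesis
    using small_subset[OF small_image] by blast
qed

section \<open>Saturation and homogeneity for definable sets\<close>

lemma saturated: "saturated L M \<kappa>"
  using monster by (simp add: monster_model_def)

text \<open>Once \<open>g\<close> fixes all coordinates except \<open>v\<close>, a definable set
  becomes a formula in one variable with parameters in the image of \<open>D\<close> under
  \<open>g\<close>. This brings saturation into the form needed for definable sets.\<close>

lemma saturated_df:
  fixes g :: "'v \<Rightarrow> 'm"
  assumes D: "small D" and df: "\<And>Z. Z \<in> \<Z> \<Longrightarrow> df (insert v D) Z"
    and fin: "\<And>\<Q>. finite \<Q> \<Longrightarrow> \<Q> \<subseteq> \<Z> \<Longrightarrow> \<exists>x. \<forall>Z \<in> \<Q>. g(v := x) \<in> Z"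
  shows "\<exists>x. \<forall>Z \<in> \<Z>. g(v := x) \<in> Z"
proof -
  have "\<forall>Z \<in> \<Z>. \<exists>\<phi> s. wf_fm L \<phi> \<and> s ` (fv \<phi> - {0}) \<subseteq> D - {v} \<and>
      (\<forall>x. g(v := x) \<in> Z \<longleftrightarrow> sat M ((g \<circ> s)(0 := x)) \<phi>)"
  proof
    fix Z assume "Z \<in> \<Z>"
    then have "df (insert v D) Z" by (rule df)
    then show "\<exists>\<phi> s. wf_fm L \<phi> \<and> s ` (fv \<phi> - {0}) \<subseteq> D - {v} \<and>
      (\<forall>x. g(v := x) \<in> Z \<longleftrightarrow> sat M ((g \<circ> s)(0 := x)) \<phi>)"
    proof (rule df_upd)
      fix \<phi> s
      assume *: "wf_fm L \<phi>" "s ` (fv \<phi> - {0}) \<subseteq> D - {v}"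
        "\<And>h x. h(v := x) \<in> Z \<longleftrightarrow> sat M ((h \<circ> s)(0 := x)) \<phi>"
      show ?thesis
        by (rule exI[of _ \<phi>], rule exI[of _ s]) (intro conjI allI *)
    qed
  qed
  then have "\<exists>\<phi>. \<forall>Z \<in> \<Z>. \<exists>s. wf_fm L (\<phi> Z) \<and> s ` (fv (\<phi> Z) - {0}) \<subseteq> D - {v} \<and>
      (\<forall>x. g(v := x) \<in> Z \<longleftrightarrow> sat M ((g \<circ> s)(0 := x)) (\<phi> Z))"
    by (rule bchoice)
  then obtain \<phi> where "\<forall>Z \<in> \<Z>. \<exists>s. wf_fm L (\<phi> Z) \<and> s ` (fv (\<phi> Z) - {0}) \<subseteq> D - {v} \<and>
      (\<forall>x. g(v := x) \<in> Z \<longleftrightarrow> sat M ((g \<circ> s)(0 := x)) (\<phi> Z))"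
    by (rule exE)
  then have "\<exists>s. \<forall>Z \<in> \<Z>. wf_fm L (\<phi> Z) \<and> s Z ` (fv (\<phi> Z) - {0}) \<subseteq> D - {v} \<and>
      (\<forall>x. g(v := x) \<in> Z \<longleftrightarrow> sat M ((g \<circ> s Z)(0 := x)) (\<phi> Z))"
    by (rule bchoice)
  then obtain s where all: "\<forall>Z \<in> \<Z>. wf_fm L (\<phi> Z) \<and> s Z ` (fv (\<phi> Z) - {0}) \<subseteq> D - {v} \<and>
      (\<forall>x. g(v := x) \<in> Z \<longleftrightarrow> sat M ((g \<circ> s Z)(0 := x)) (\<phi> Z))"
    by (rule exE)
  have \<phi>: "wf_fm L (\<phi> Z)" and s: "s Z ` (fv (\<phi> Z) - {0}) \<subseteq> D - {v}"
    and sat: "g(v := x) \<in> Z \<longleftrightarrow> sat M ((g \<circ> s Z)(0 := x)) (\<phi> Z)" if "Z \<in> \<Z>" for Z x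
    using bspec[OF all that] by simp_all
  define F where "F Z = (\<phi> Z, g \<circ> s Z)" for Z
  have F: "(case F Z of (\<psi>, e) \<Rightarrow> Q \<psi> e) = Q (\<phi> Z) (g \<circ> s Z)" for Z Q
    by (simp add: F_def)
  have "|g ` D| <o \<kappa>"
    using small_image[OF D] by (simp add: small_def)
  moreover have "\<forall>(\<psi>, e) \<in> F ` \<Z>. wf_fm L \<psi> \<and> e ` (fv \<psi> - {0}) \<subseteq> g ` D"
    unfolding ball_simps(9) F
  proof
    fix Z assume "Z \<in> \<Z>"
    then have "wf_fm L (\<phi> Z)" "s Z ` (fv (\<phi> Z) - {0}) \<subseteq> D"
      using \<phi> s by blast+
    then show "wf_fm L (\<phi> Z) \<and> (g \<circ> s Z) ` (fv (\<phi> Z) - {0}) \<subseteq> g ` D"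
      unfolding image_comp[symmetric] by blast
  qed
  moreover have "\<forall>q \<subseteq> F ` \<Z>. finite q \<longrightarrow> (\<exists>x. \<forall>(\<psi>, e) \<in> q. sat M (e(0 := x)) \<psi>)"
  proof (intro allI impI)
    fix q assume "q \<subseteq> F ` \<Z>" "finite q"
    from finite_subset_image[OF \<open>finite q\<close> \<open>q \<subseteq> F ` \<Z>\<close>]
    obtain \<Q> where \<Q>: "\<Q> \<subseteq> \<Z>" "finite \<Q>" "q = F ` \<Q>"
      by blast
    obtain x where x: "\<forall>Z \<in> \<Q>. g(v := x) \<in> Z"
      using fin[OF \<Q>(2,1)] by (rule exE)
    have "\<forall>(\<psi>, e) \<in> q. sat M (e(0 := x)) \<psi>"
      unfolding \<Q>(3) ball_simps(9) F
    proof
      fix Z assume Z: "Z \<in> \<Q>"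
      then have "g(v := x) \<in> Z" using x by blast
      then show "sat M ((g \<circ> s Z)(0 := x)) (\<phi> Z)"
        using sat[OF subsetD[OF \<Q>(1) Z], of x] by (rule iffD1[rotated])
    qed
    then show "\<exists>x. \<forall>(\<psi>, e) \<in> q. sat M (e(0 := x)) \<psi>" ..
  qed
  ultimately have "|g ` D| <o \<kappa> \<and>
      (\<forall>(\<psi>, e) \<in> F ` \<Z>. wf_fm L \<psi> \<and> e ` (fv \<psi> - {0}) \<subseteq> g ` D) \<and>
      (\<forall>q \<subseteq> F ` \<Z>. finite q \<longrightarrow> (\<exists>x. \<forall>(\<psi>, e) \<in> q. sat M (e(0 := x)) \<psi>))"
    by (intro conjI)
  then have "\<exists>x. \<forall>(\<psi>, e) \<in> F ` \<Z>. sat M (e(0 := x)) \<psi>"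
    by (rule mp[OF spec[OF spec[OF saturated[unfolded saturated_def]]]])
  then obtain x where x: "\<forall>Z \<in> \<Z>. sat M ((g \<circ> s Z)(0 := x)) (\<phi> Z)"
    unfolding ball_simps(9) F by (rule exE)
  have "\<forall>Z \<in> \<Z>. g(v := x) \<in> Z"
  proof
    fix Z assume Z: "Z \<in> \<Z>"
    show "g(v := x) \<in> Z"
      using sat[OF Z, of x] bspec[OF x Z] by (rule iffD2)
  qed
  then show ?thesis ..
qed

lemma homogeneous:
  fixes g h :: "'v \<Rightarrow> 'm"
  assumes V: "small V" and eq: "tequiv V g h"
  obtains \<sigma> where "\<sigma> \<in> Aut" "\<forall>v \<in> V. \<sigma> (g v) = h v"
proof -
  \<comment> \<open>\<open>w\<close> picks an index for each value of \<open>g\<close>, so that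
    \<open>h \<circ> w\<close> sends \<open>g v\<close> to \<open>h v\<close>. The choice is
    immaterial because equalities between coordinates belong to the type.\<close>
  define w where "w c = (SOME v. v \<in> V \<and> g v = c)" for c
  have w: "w c \<in> V" "g (w c) = c" if "c \<in> g ` V" for c
  proof -
    have "\<exists>v. v \<in> V \<and> g v = c" using that by auto
    then show "w c \<in> V" "g (w c) = c"
      unfolding w_def by (metis (mono_tags, lifting) someI_ex)+
  qed
  have "elementary_on L M (g ` V) (h \<circ> w)"
    unfolding elementary_on_def
  proof (intro allI impI)
    fix \<phi> e assume e: "wf_fm L \<phi> \<and> e ` fv \<phi> \<subseteq> g ` V"
    then have "df V {k. sat M (k \<circ> (w \<circ> e)) \<phi>}"
      using w(1) by (intro dfI) auto
    then have "sat M (g \<circ> (w \<circ> e)) \<phi> = sat M (h \<circ> (w \<circ> e)) \<phi>"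
      using tequivD[OF eq] by fastforce
    moreover have "sat M (g \<circ> (w \<circ> e)) \<phi> = sat M e \<phi>"
      using w(2) e by (intro sat_cong) auto
    ultimately show "sat M e \<phi> = sat M (h \<circ> w \<circ> e) \<phi>"
      unfolding comp_assoc by blast
  qed
  moreover have "|g ` V| <o \<kappa>"
    using small_image[OF V] by (simp add: small_def)
  moreover have "strongly_homogeneous L M \<kappa>"
    using monster by (simp add: monster_model_def)
  ultimately obtain \<sigma> where \<sigma>: "\<sigma> \<in> Aut" "\<forall>c \<in> g ` V. \<sigma> c = (h \<circ> w) c"
    unfolding strongly_homogeneous_def by blast
  show ?thesis
  proof (rule that[OF \<sigma>(1)], rule ballI)
    fix v assume v: "v \<in> V"
    then have "g (w (g v)) = g v" "w (g v) \<in> V"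
      using w by blast+
    then have "h (w (g v)) = h v"
      using tequiv_eqD[OF eq _ v] by blast
    then show "\<sigma> (g v) = h v"
      using \<sigma>(2) v by simp
  qed
qed

text \<open>An ultrafilter on assignments decides every definable set and is thus a complete type in
  the variables \<open>V\<close>, here already realized by \<open>g0\<close> on \<open>W\<close>.
  Saturation provides the remaining coordinates one at a time along a well-order.\<close>

lemma realize:
  fixes \<UU> :: "('v \<Rightarrow> 'm) set \<Rightarrow> bool"
  assumes U: "ultra \<UU>" and V: "small V" and WV: "W \<subseteq> V"
    and g0: "\<And>Z. df W Z \<Longrightarrow> g0 \<in> Z \<longleftrightarrow> \<UU> Z"
  obtains g where "\<And>v. v \<in> W \<Longrightarrow> g v = g0 v" "\<And>Z. df V Z \<Longrightarrow> g \<in> Z \<longleftrightarrow> \<UU> Z"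
proof -
  obtain r :: "'v rel" where r: "well_order_on UNIV r"
    using well_order_on by blast
  then have r_lin: "trans r" "total r" "refl r" and wf: "wf (r - Id)"
    by (auto simp: well_order_on_def linear_order_on_def partial_order_on_def preorder_on_def)
  define lo where "lo v = {w \<in> V. (w, v) \<in> r - Id}" for v
  define merge where "merge f = (\<lambda>w. if w \<in> W then g0 w else f w)" for f :: "'v \<Rightarrow> 'm"
  define P where "P f v x \<longleftrightarrow> (v \<in> V - W \<longrightarrow>
      (\<forall>Z. df (insert v (W \<union> lo v)) Z \<longrightarrow> ((merge f)(v := x) \<in> Z \<longleftrightarrow> \<UU> Z)))" for f v x
  have claim: "merge f \<in> Z \<longleftrightarrow> \<UU> Z"
    if P: "\<And>y. y \<in> U \<Longrightarrow> P f y (f y)" and "U \<subseteq> V" and Z: "df (W \<union> U) Z" for f U Z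
  proof -
    obtain V0 where V0: "finite V0" "V0 \<subseteq> W \<union> U" "df V0 Z"
      by (rule df_finite[OF Z])
    show ?thesis
    proof (cases "V0 \<subseteq> W")
      case True
      have "merge f \<in> Z \<longleftrightarrow> g0 \<in> Z"
        using True by (intro df_agree[OF V0(3)]) (auto simp: merge_def)
      then show ?thesis
        using g0[OF df_mono[OF V0(3) True]] by simp
    next
      case False
      \<comment> \<open>\<open>Z\<close> has finitely many variables; the last one outside
        \<open>W\<close> is the stage at which the recursion took care of \<open>Z\<close>.\<close>
      then obtain y where y: "y \<in> V0 - W" "\<forall>x \<in> V0 - W. (x, y) \<in> r"
        using finite_linear_max[of "V0 - W" r] V0(1) r_lin by auto
      have "V0 \<subseteq> insert y (W \<union> lo y)"
        using y V0(2) \<open>U \<subseteq> V\<close> by (auto simp: lo_def)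
      then have "df (insert y (W \<union> lo y)) Z"
        by (rule df_mono[OF V0(3)])
      moreover have "y \<in> V - W" "y \<in> U"
        using y(1) V0(2) \<open>U \<subseteq> V\<close> by auto
      moreover have "(merge f)(y := f y) = merge f"
        using y(1) by (auto simp: merge_def)
      ultimately show ?thesis
        using P[of y] unfolding P_def by auto
    qed
  qed
  have "\<exists>f. \<forall>v. P f v (f v)"
  proof (rule dependent_wf_choice[OF wf])
    fix f g :: "'v \<Rightarrow> 'm" and v x
    assume fg: "\<And>z. (z, v) \<in> r - Id \<Longrightarrow> f z = g z"
    have "(merge f)(v := x) \<in> Z \<longleftrightarrow> (merge g)(v := x) \<in> Z" if "df (insert v (W \<union> lo v)) Z" for Z
      using fg by (intro df_agree[OF that]) (auto simp: merge_def lo_def)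
    then show "P f v x = P g v x"
      unfolding P_def by blast
  next
    fix v f assume IH: "\<And>y. (y, v) \<in> r - Id \<Longrightarrow> P f y (f y)"
    show "\<exists>x. P f v x"
    proof (cases "v \<in> V - W")
      case True
      let ?D = "W \<union> lo v"
      let ?\<Z> = "{Z. df (insert v ?D) Z \<and> \<UU> Z}"
      have "\<exists>x. \<forall>Z \<in> ?\<Z>. (merge f)(v := x) \<in> Z"
      proof (rule saturated_df)
        show "small ?D"
          using V by (rule small_subset) (use WV in \<open>auto simp: lo_def\<close>)
        show "df (insert v ?D) Z" if "Z \<in> ?\<Z>" for Z
          using that by simp
        fix \<Q> assume \<Q>: "finite \<Q>" "\<Q> \<subseteq> ?\<Z>"
        \<comment> \<open>The projection \<open>?Y\<close> belongs to the type and involves earlier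
          variables only, so the partial realization satisfies it. This is the consistency needed to
          choose the next value.\<close>
        let ?Y = "{h. \<exists>x. h(v := x) \<in> \<Inter> \<Q>}"
        have dfQ: "df (insert v ?D) (\<Inter> \<Q>)"
          using \<Q> by (intro df_Inter) auto
        have "\<UU> (\<Inter> \<Q>)"
          using \<Q>
        proof (induction \<Q> rule: finite_induct)
          case empty
          then show ?case using ultra_UNIV[OF U] by simp
        next
          case (insert Z \<Q>)
          then show ?case using ultra_Int[OF U, of Z "\<Inter> \<Q>"] by simp
        qed
        moreover have "\<Inter> \<Q> \<subseteq> ?Y"
          by (metis (mono_tags, lifting) fun_upd_triv mem_Collect_eq subsetI)
        ultimately have "\<UU> ?Y"
          by (rule ultra_mono[OF U])
        moreover have "df (W \<union> lo v) ?Y"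
          using df_ex[OF dfQ] by (rule df_mono) auto
        ultimately have "merge f \<in> ?Y"
          using claim[of "lo v" f ?Y] IH by (simp add: lo_def)
        then show "\<exists>x. \<forall>Z \<in> \<Q>. (merge f)(v := x) \<in> Z"
          by auto
      qed
      then obtain x where x: "\<forall>Z \<in> ?\<Z>. (merge f)(v := x) \<in> Z" ..
      have "(merge f)(v := x) \<in> Z \<longleftrightarrow> \<UU> Z" if Z: "df (insert v ?D) Z" for Z
      proof (cases "\<UU> Z")
        case True
        then show ?thesis using x Z by auto
      next
        case False
        then have "- Z \<in> ?\<Z>"
          using Z df_Compl ultra_Compl[OF U] by simp
        then show ?thesis using x False by auto
      qed
      then show ?thesis unfolding P_def by blast
    next
      case False
      then show ?thesis unfolding P_def by blast
    qed
  qed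
  then obtain f where f: "\<forall>v. P f v (f v)" ..
  show ?thesis
  proof (rule that)
    show "merge f v = g0 v" if "v \<in> W" for v
      using that by (simp add: merge_def)
    show "merge f \<in> Z \<longleftrightarrow> \<UU> Z" if "df V Z" for Z
      using claim[of V f Z] f that WV by (simp add: Un_absorb1)
  qed
qed

end

context monster
begin

section \<open>Limits of types along ultrafilters\<close>

text \<open>\<open>rlim C R U p\<close>: over \<open>C\<close>, the tuple \<open>p\<close> indexed by \<open>R\<close> realizes the type to which
  the tuples \<open>h\<close> converge along \<open>U\<close>.\<close>

definition rlim :: "'m set \<Rightarrow> 'x set \<Rightarrow> (('x \<Rightarrow> 'm) set \<Rightarrow> bool) \<Rightarrow> ('x \<Rightarrow> 'm) \<Rightarrow> bool" where
  "rlim C R U p \<longleftrightarrow> (\<forall>Z. df (C <+> R) Z \<longrightarrow> (case_sum id p \<in> Z \<longleftrightarrow> U {h. case_sum id h \<in> Z}))"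

lemma rlimD: "rlim C R U p \<Longrightarrow> df (C <+> R) Z \<Longrightarrow> case_sum id p \<in> Z \<longleftrightarrow> U {h. case_sum id h \<in> Z}"
  by (simp add: rlim_def)

lemma Plus_mono: "A \<subseteq> C \<Longrightarrow> B \<subseteq> D \<Longrightarrow> A <+> B \<subseteq> C <+> D"
  by (auto simp: Plus_def)

lemma rlim_mono: "rlim C R U p \<Longrightarrow> C' \<subseteq> C \<Longrightarrow> rlim C' R U p"
  unfolding rlim_def using df_mono[OF _ Plus_mono[OF _ order_refl]] by blast

lemma rlim_exists:
  fixes U :: "('x \<Rightarrow> 'm) set \<Rightarrow> bool"
  assumes U: "ultra U" and "small C" "small R"
  obtains p where "rlim C R U p"
proof -
  define \<UU> where "\<UU> A = U {h. case_sum id h \<in> A}" for A :: "('m + 'x \<Rightarrow> 'm) set"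
  have "ultra \<UU>"
    using ultra_image[OF U, of "case_sum id"] unfolding \<UU>_def vimage_def .
  moreover have "small (C <+> R)"
    using assms(2,3) by (rule small_Plus)
  moreover have "Inl ` C \<subseteq> C <+> R"
    by blast
  \<comment> \<open>The unspecified values are harmless, as only \<open>Inl\<close> variables occur
    in \<open>Z\<close>, and these have the same value under every
    \<open>case_sum id h\<close>.\<close>
  moreover have "case_sum id undefined \<in> Z \<longleftrightarrow> \<UU> Z" if Z: "df (Inl ` C) Z" for Z
  proof -
    have eq: "case_sum id h \<in> Z \<longleftrightarrow> case_sum id undefined \<in> Z" for h
      by (rule df_agree[OF Z]) auto
    then have "{h. case_sum id h \<in> Z} = (if case_sum id undefined \<in> Z then UNIV else {})"
      by auto
    then show ?thesis
      using ultra_UNIV[OF U] ultra_empty[OF U] by (simp add: \<UU>_def)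
  qed
  ultimately show ?thesis
  proof (rule realize)
    fix g assume g: "\<And>v. v \<in> Inl ` C \<Longrightarrow> g v = case_sum id undefined v"
      "\<And>Z. df (C <+> R) Z \<Longrightarrow> g \<in> Z \<longleftrightarrow> \<UU> Z"
    have "case_sum id (g \<circ> Inr) \<in> Z \<longleftrightarrow> g \<in> Z" if "df (C <+> R) Z" for Z
      using g(1) by (intro df_agree[OF that]) auto
    then have "rlim C R U (g \<circ> Inr)"
      using g(2) unfolding rlim_def \<UU>_def by blast
    then show ?thesis by (rule that)
  qed
qed

text \<open>Allows a tuple \<open>c\<close> of parameters, possibly with repetitions, by the change
  of variables \<open>map_sum c id\<close>.\<close>

lemma rlim_tuple:
  assumes "rlim C R U p" "c ` V \<subseteq> C" "df (V <+> R) Z"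
  shows "case_sum c p \<in> Z \<longleftrightarrow> U {h. case_sum c h \<in> Z}"
proof -
  have eq: "case_sum id h \<circ> map_sum c id = case_sum c h" for h :: "'a \<Rightarrow> 'm"
    by (auto simp: fun_eq_iff split: sum.splits)
  have "df (C <+> R) {k. k \<circ> map_sum c id \<in> Z}"
    using assms(2) by (intro df_vimage[OF assms(3)]) auto
  from rlimD[OF assms(1) this] show ?thesis
    by (simp only: mem_Collect_eq eq)
qed

section \<open>Elementary sets\<close>

text \<open>\<open>fin_sat C R N\<close>: the type of \<open>R\<close> over \<open>C\<close> is finitely satisfiable in \<open>N\<close>.\<close>

definition fin_sat :: "'m set \<Rightarrow> 'm set \<Rightarrow> 'm set \<Rightarrow> bool" where
  "fin_sat C R N \<longleftrightarrow> (\<forall>Z :: ('m + 'm \<Rightarrow> 'm) set. df (C <+> R) Z \<longrightarrow> case_sum id id \<in> Z \<longrightarrow>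
     (\<exists>h. range h \<subseteq> N \<and> case_sum id h \<in> Z))"

text \<open>The Tarski-Vaught test for several unknowns at once: with \<open>R\<close> being
  everything, each solution of a formula over \<open>N\<close> is named by its own elements, and a
  solution inside \<open>N\<close> is required.\<close>

definition elem :: "'m set \<Rightarrow> bool" where
  "elem N \<longleftrightarrow> fin_sat N UNIV N"

lemma fin_sat_mono: "fin_sat C R N \<Longrightarrow> C' \<subseteq> C \<Longrightarrow> R' \<subseteq> R \<Longrightarrow> fin_sat C' R' N"
  unfolding fin_sat_def using df_mono[OF _ Plus_mono] by blast

text \<open>An ultrafilter on \<open>N\<close>-valued maps, whose limit over \<open>C\<close> is the
  type of \<open>R\<close> enumerated by itself. As it is not tied to \<open>C\<close>, its limit
  can be realized over any other small set, and that limit does not change under automorphisms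
  fixing \<open>N\<close>.\<close>

definition coheir :: "'m set \<Rightarrow> 'm set \<Rightarrow> 'm set \<Rightarrow> (('m \<Rightarrow> 'm) set \<Rightarrow> bool) \<Rightarrow> bool" where
  "coheir C R N U \<longleftrightarrow> ultra U \<and> U {h. range h \<subseteq> N} \<and>
     (\<forall>Z. df (C <+> R) Z \<longrightarrow> (case_sum id id \<in> Z \<longleftrightarrow> U {h. case_sum id h \<in> Z}))"

lemma coheirD:
  assumes "coheir C R N U"
  shows "ultra U" "U {h. range h \<subseteq> N}"
    "df (C <+> R) Z \<Longrightarrow> case_sum id id \<in> Z \<longleftrightarrow> U {h. case_sum id h \<in> Z}"
  using assms by (simp_all add: coheir_def)

lemma fin_sat_coheir:
  assumes "fin_sat C R N"
  obtains U where "coheir C R N U"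
proof -
  let ?P = "\<lambda>Z. {h. range h \<subseteq> N \<and> case_sum id h \<in> Z}"
  let ?\<Z> = "{Z :: ('m + 'm \<Rightarrow> 'm) set. df (C <+> R) Z \<and> case_sum id id \<in> Z}"
  have "\<exists>U. ultra U \<and> (\<forall>A \<in> ?P ` ?\<Z>. U A)"
  proof (rule ultra_extension)
    fix G assume "finite G" "G \<subseteq> ?P ` ?\<Z>"
    then obtain \<Q> where \<Q>: "finite \<Q>" "\<Q> \<subseteq> ?\<Z>" "G = ?P ` \<Q>"
      by (metis (no_types, lifting) finite_subset_image)
    have "df (C <+> R) (\<Inter> \<Q>)"
      using \<Q> by (intro df_Inter) auto
    moreover have "case_sum id id \<in> \<Inter> \<Q>"
      using \<Q>(2) by auto
    ultimately obtain h where "range h \<subseteq> N" "case_sum id h \<in> \<Inter> \<Q>"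
      using assms unfolding fin_sat_def by blast
    then have "h \<in> \<Inter> G"
      unfolding \<Q>(3) by auto
    then show "\<Inter> G \<noteq> {}" by blast
  qed
  then obtain U where U: "ultra U" and UP: "\<And>Z. Z \<in> ?\<Z> \<Longrightarrow> U (?P Z)"
    by blast
  have 1: "U {h. case_sum id h \<in> Z}" if "Z \<in> ?\<Z>" for Z
    by (rule ultra_mono[OF U UP[OF that]]) blast
  have "coheir C R N U"
    unfolding coheir_def
  proof (intro conjI allI impI U)
    have "UNIV \<in> ?\<Z>" using df_UNIV by blast
    from UP[OF this] show "U {h. range h \<subseteq> N}"
      by simp
    fix Z assume Z: "df (C <+> R) Z"
    show "case_sum id id \<in> Z \<longleftrightarrow> U {h. case_sum id h \<in> Z}"
    proof (cases "case_sum id id \<in> Z")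
      case True
      then show ?thesis using 1 Z by blast
    next
      case False
      then have "U {h. case_sum id h \<in> - Z}"
        using Z df_Compl by (intro 1) blast
      moreover have "{h. case_sum id h \<in> - Z} = - {h. case_sum id h \<in> Z}"
        by blast
      ultimately show ?thesis
        using False by (simp add: ultra_Compl[OF U])
    qed
  qed
  then show ?thesis by (rule that)
qed

lemma fin_sat_image:
  assumes \<sigma>: "\<sigma> \<in> Aut" and fs: "fin_sat C R N"
  shows "fin_sat (\<sigma> ` C) (\<sigma> ` R) (\<sigma> ` N)"
  unfolding fin_sat_def
proof (intro allI impI)
  fix Z :: "('m + 'm \<Rightarrow> 'm) set"
  assume Z: "df (\<sigma> ` C <+> \<sigma> ` R) Z" and id: "case_sum id id \<in> Z"
  let ?r = "map_sum (inv \<sigma>) (inv \<sigma>)"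
  let ?Z = "{k. k \<circ> ?r \<in> Z}"
  have inv: "inv \<sigma> (\<sigma> x) = x" "\<sigma> (inv \<sigma> x) = x" for x
    by (simp_all add: aut_inv_apply[OF \<sigma>])
  have df: "df (C <+> R) ?Z"
    by (rule df_vimage[OF Z]) (auto simp: inv)
  have eq: "\<sigma> \<circ> (case_sum id h \<circ> ?r) = case_sum id (\<sigma> \<circ> h \<circ> inv \<sigma>)" for h
    by (auto simp: fun_eq_iff inv split: sum.splits)
  have eq': "case_sum id h \<in> ?Z \<longleftrightarrow> case_sum id (\<sigma> \<circ> h \<circ> inv \<sigma>) \<in> Z" for h
    using aut_df[OF \<sigma> Z, of "case_sum id h \<circ> ?r"] unfolding eq by simp
  have "\<sigma> \<circ> id \<circ> inv \<sigma> = id"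
    by (simp add: fun_eq_iff inv)
  then have "case_sum id id \<in> ?Z"
    using id eq'[of id] by simp
  then obtain h where h: "range h \<subseteq> N" "case_sum id h \<in> ?Z"
    using fs df unfolding fin_sat_def by blast
  then have "case_sum id (\<sigma> \<circ> h \<circ> inv \<sigma>) \<in> Z"
    using eq' by blast
  moreover have "range (\<sigma> \<circ> h \<circ> inv \<sigma>) \<subseteq> \<sigma> ` N"
    using h(1) by auto
  ultimately show "\<exists>h. range h \<subseteq> \<sigma> ` N \<and> case_sum id h \<in> Z"
    by blast
qed

lemma elem_image: "\<sigma> \<in> Aut \<Longrightarrow> elem N \<Longrightarrow> elem (\<sigma> ` N)"
  using fin_sat_image[of \<sigma> N UNIV N] aut_bij[of \<sigma>] unfolding elem_def by (simp add: bij_is_surj)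

section \<open>Existence of small elementary sets\<close>

definition witness :: "('f, 'r) fm \<Rightarrow> ('m + nat) list \<Rightarrow> nat \<Rightarrow> 'm" where
  "witness \<phi> vs = (SOME w. sat M (\<lambda>i. case_sum id w (vs ! i)) \<phi>)"

text \<open>Unknowns are numbers rather than elements of the monster, so that only few codes have to
  be witnessed. \<open>elemI\<close> numbers the finitely many unknowns of a given formula
  accordingly.\<close>

definition skolem_step :: "'m set \<Rightarrow> 'm set" where
  "skolem_step N = (\<lambda>(\<phi>, vs, k). witness \<phi> vs k) ` (WF \<times> lists (N <+> UNIV) \<times> UNIV)"

lemma elemI:
  assumes step: "skolem_step N \<subseteq> N"
  shows "elem N"
  unfolding elem_def fin_sat_def
proof (intro allI impI)
  fix Z :: "('m + 'm \<Rightarrow> 'm) set"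
  assume Z: "df (N <+> UNIV) Z" and id: "case_sum id id \<in> Z"
  show "\<exists>h. range h \<subseteq> N \<and> case_sum id h \<in> Z"
  proof (rule df_list[OF Z])
    fix \<phi> vs
    assume \<phi>: "wf_fm L \<phi>" "set vs \<subseteq> N <+> UNIV" "fv \<phi> \<subseteq> {..<length vs}"
      "\<And>h. h \<in> Z \<longleftrightarrow> sat M (\<lambda>i. h (vs ! i)) \<phi>"
    define D where "D = Inr -` set vs"
    have "finite D"
      unfolding D_def by (intro finite_vimageI) auto
    then obtain \<iota> :: "'m \<Rightarrow> nat" where \<iota>: "inj_on \<iota> D"
      using finite_imp_inj_to_nat_seg by blast
    let ?vs = "map (map_sum id \<iota>) vs"
    have vs: "vs ! i \<in> set vs" if "i \<in> fv \<phi>" for i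
      using \<phi>(3) that by (auto intro: nth_mem)
    have eq: "sat M (\<lambda>i. case_sum id w (?vs ! i)) \<phi> = sat M (\<lambda>i. case_sum id (w \<circ> \<iota>) (vs ! i)) \<phi>" for w
    proof (rule sat_cong)
      fix i assume "i \<in> fv \<phi>"
      then have "i < length vs" using \<phi>(3) by auto
      then show "case_sum id w (?vs ! i) = case_sum id (w \<circ> \<iota>) (vs ! i)"
        by (cases "vs ! i") simp_all
    qed
    have "sat M (\<lambda>i. case_sum id (inv_into D \<iota> \<circ> \<iota>) (vs ! i)) \<phi> = sat M (\<lambda>i. case_sum id id (vs ! i)) \<phi>"
    proof (rule sat_cong)
      fix i assume "i \<in> fv \<phi>"
      then have "vs ! i \<in> set vs" by (rule vs)
      moreover have "case_sum id (inv_into D \<iota> \<circ> \<iota>) x = case_sum id id x" if "x \<in> set vs" for x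
        by (cases x) (use that \<iota> in \<open>auto simp: D_def\<close>)
      ultimately show "case_sum id (inv_into D \<iota> \<circ> \<iota>) (vs ! i) = case_sum id id (vs ! i)"
        by blast
    qed
    then have "sat M (\<lambda>i. case_sum id (inv_into D \<iota>) (?vs ! i)) \<phi>"
      using id \<phi>(4) eq by simp
    then have "sat M (\<lambda>i. case_sum id (witness \<phi> ?vs) (?vs ! i)) \<phi>"
      unfolding witness_def by (rule someI[of "\<lambda>w. sat M (\<lambda>i. case_sum id w (?vs ! i)) \<phi>"])
    then have "case_sum id (witness \<phi> ?vs \<circ> \<iota>) \<in> Z"
      using \<phi>(4) eq by simp
    moreover have "witness \<phi> ?vs k \<in> N" for k
    proof -
      have "?vs \<in> lists (N <+> UNIV)"
        using \<phi>(2) by fastforce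
      then have "(\<lambda>(\<phi>, vs, k). witness \<phi> vs k) (\<phi>, ?vs, k) \<in> skolem_step N"
        unfolding skolem_step_def using \<phi>(1) by (intro imageI) blast
      then show ?thesis using step by auto
    qed
    then have "range (witness \<phi> ?vs \<circ> \<iota>) \<subseteq> N"
      by auto
    ultimately show ?thesis by blast
  qed
qed

lemma incseq_Plus: "incseq f \<Longrightarrow> incseq (\<lambda>i. f i <+> B)"
  unfolding incseq_def by (blast intro!: Plus_mono)

lemma skolem_step_cont:
  fixes f :: "nat \<Rightarrow> 'm set"
  assumes "incseq f"
  shows "skolem_step (\<Union>i. f i) \<subseteq> (\<Union>i. skolem_step (f i))"
proof
  fix y assume "y \<in> skolem_step (\<Union>i. f i)"
  then obtain \<phi> vs k where y: "y = witness \<phi> vs k" "\<phi> \<in> WF" and vs: "vs \<in> lists ((\<Union>i. f i) <+> UNIV)"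
    unfolding skolem_step_def by auto
  have "(\<Union>i. f i) <+> UNIV = (\<Union>i. f i <+> (UNIV :: nat set))"
    by auto
  with vs have "vs \<in> lists (\<Union>i. f i <+> UNIV)"
    by (simp only:)
  from lists_UN_incseq[OF incseq_Plus[OF assms] this] obtain i where "vs \<in> lists (f i <+> UNIV)"
    by (rule exE)
  then have "y \<in> skolem_step (f i)"
    unfolding skolem_step_def using y by force
  then show "y \<in> (\<Union>i. skolem_step (f i))"
    by blast
qed

lemma skolem_step_card:
  assumes Y: "infinite Y" "|WF| \<le>o |Y|" and N: "|N| \<le>o |Y|"
  shows "|skolem_step N| \<le>o |Y|"
proof -
  have nat: "|UNIV :: nat set| \<le>o |Y|"
    using Y(1) by (simp add: infinite_iff_card_of_nat)
  have "|WF \<times> lists (N <+> (UNIV :: nat set)) \<times> (UNIV :: nat set)| \<le>o |Y|"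
    by (intro card_Times_infinite[OF Y(1)] Y(2) nat card_lists_infinite[OF Y(1)] card_Plus_infinite[OF Y(1)] N)
  then show ?thesis
    unfolding skolem_step_def by (rule ordLeq_transitive[OF card_of_image])
qed

lemma elem_exists:
  assumes "small X"
  obtains N where "X \<subseteq> N" "elem N" "small N"
proof -
  obtain B :: "('m + ('f, 'r) fm + ('f, 'r) fm) set" where
    B: "infinite B" "small B" "|X| \<le>o |B|" "|WF| \<le>o |B|" "|T| \<le>o |B|"
    by (rule small_bound[OF assms small_WF])
  show ?thesis
  proof (rule closure_exists[OF B(1,3), of skolem_step])
    show "|skolem_step N| \<le>o |B|" if "|N| \<le>o |B|" for N
      using B(1,4) that by (rule skolem_step_card)
    show "skolem_step (\<Union>i. f i) \<subseteq> (\<Union>i. skolem_step (f i))" if "incseq f" for f :: "nat \<Rightarrow> 'm set"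
      using that by (rule skolem_step_cont)
    fix N assume N: "X \<subseteq> N" "skolem_step N \<subseteq> N" "|N| \<le>o |B|"
    show ?thesis
      by (rule that[OF N(1) elemI[OF N(2)] small_card[OF N(3) B(2)]])
  qed
qed

end

section \<open>Boundedness of ultraimaginaries\<close>

lemma app_id [simp]: "app id a = a"
  by (simp add: app_def option.map_id0)

lemma app_comp: "app (\<sigma> \<circ> \<tau>) a = app \<sigma> (app \<tau> a)"
  by (simp add: app_def fun_eq_iff option.map_comp)

lemma dom_app [simp]: "dom (app \<sigma> a) = dom a"
  by (auto simp: app_def dom_def)

lemma app_cong: "(\<And>x. x \<in> ran a \<Longrightarrow> \<sigma> x = \<tau> x) \<Longrightarrow> app \<sigma> a = app \<tau> a"
  by (auto simp: app_def fun_eq_iff ran_def intro!: option.map_cong)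

lemma the_app: "i \<in> dom a \<Longrightarrow> the (app \<sigma> a i) = \<sigma> (the (a i))"
  by (auto simp: app_def)

lemma the_in_ran: "i \<in> dom a \<Longrightarrow> the (a i) \<in> ran a"
  by (auto simp: ran_def)

lemma ran_eq: "ran a = (the \<circ> a) ` dom a"
  by (force simp: ran_def dom_def)

lemma (in interpretation_of) fixer_case_sum:
  assumes "\<sigma> \<in> fixer N" "range h \<subseteq> N"
  shows "case_sum \<sigma> h = \<sigma> \<circ> case_sum id h"
proof
  fix v
  show "case_sum \<sigma> h v = (\<sigma> \<circ> case_sum id h) v"
  proof (cases v)
    case (Inr y)
    have "\<sigma> (h y) = h y"
      using assms by (intro fixerD) auto
    then show ?thesis by (simp add: Inr)
  qed simp
qed

locale ultra_im = monster L M T \<kappa>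
  for L :: "('f, 'r) lang" and M :: "('f, 'r, 'm) struc" and T and \<kappa> :: "'k rel" +
  fixes c :: "('k, 'm) tuple" and F :: "('k, 'm) tuple rel"
  assumes ultraim: "ultraimaginary L M \<kappa> (c, F)"
begin

lemma equiv_F: "equiv {d. dom d = dom c} F"
  using ultraim by (simp add: ultraimaginary_def invariant_equiv_def)

lemma small_ran: "small (ran c)"
  unfolding ran_eq using ultraim by (intro small_image) (simp add: ultraimaginary_def small_def)

lemma F_aut:
  assumes \<sigma>: "\<sigma> \<in> Aut" and dom: "dom d = dom c" "dom e = dom c"
  shows "(app \<sigma> d, app \<sigma> e) \<in> F \<longleftrightarrow> (d, e) \<in> F"
proof -
  have dom': "dom (case_sum d e) = dom (case_sum (app \<sigma> d) (app \<sigma> e))"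
    by (auto simp: app_def dom_def split: sum.splits)
  have "same_type L M (case_sum d e) (case_sum (app \<sigma> d) (app \<sigma> e))"
    unfolding same_type_def
  proof (intro conjI allI impI)
    fix \<phi> s assume *: "wf_fm L \<phi> \<and> s ` fv \<phi> \<subseteq> dom (case_sum d e)"
    have H: "the (case_sum (app \<sigma> d) (app \<sigma> e) y) = \<sigma> (the (case_sum d e y))"
      if "y \<in> dom (case_sum d e)" for y
      using that by (cases y) (auto simp: app_def)
    have "sat M (the \<circ> case_sum (app \<sigma> d) (app \<sigma> e) \<circ> s) \<phi> =
        sat M (\<sigma> \<circ> (the \<circ> case_sum d e \<circ> s)) \<phi>"
    proof (rule sat_cong)
      fix n assume "n \<in> fv \<phi>"
      then have "s n \<in> dom (case_sum d e)" using * by blast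
      from H[OF this] show "(the \<circ> case_sum (app \<sigma> d) (app \<sigma> e) \<circ> s) n =
          (\<sigma> \<circ> (the \<circ> case_sum d e \<circ> s)) n"
        by simp
    qed
    then show "sat M (the \<circ> case_sum d e \<circ> s) \<phi> =
        sat M (the \<circ> case_sum (app \<sigma> d) (app \<sigma> e) \<circ> s) \<phi>"
      using aut_sat[OF \<sigma>] * by blast
  qed (rule dom')
  moreover have "invariant_equiv L M (dom c) F"
    using ultraim by (simp add: ultraimaginary_def)
  ultimately show ?thesis
    unfolding invariant_equiv_def using dom dom_app by metis
qed

text \<open>The arguments may be any maps, and only their values on \<open>ran c\<close> matter. A
  realization \<open>p\<close> of a limit type can so be compared with automorphisms
  directly.\<close>

definition eqv :: "('m \<Rightarrow> 'm) \<Rightarrow> ('m \<Rightarrow> 'm) \<Rightarrow> bool" where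
  "eqv \<sigma> \<tau> \<longleftrightarrow> (app \<sigma> c, app \<tau> c) \<in> F"

lemma eqv_sym: "eqv \<sigma> \<tau> \<Longrightarrow> eqv \<tau> \<sigma>"
  using equiv_F unfolding eqv_def equiv_def by (meson symD)

lemma eqv_trans: "eqv \<sigma> \<tau> \<Longrightarrow> eqv \<tau> \<rho> \<Longrightarrow> eqv \<sigma> \<rho>"
  using equiv_F unfolding eqv_def equiv_def by (meson transD)

lemma eqv_comp: "\<rho> \<in> Aut \<Longrightarrow> eqv (\<rho> \<circ> \<sigma>) (\<rho> \<circ> \<tau>) \<longleftrightarrow> eqv \<sigma> \<tau>"
  unfolding eqv_def app_comp by (rule F_aut) simp_all

lemma eqv_cong: "(\<And>x. x \<in> ran c \<Longrightarrow> \<sigma> x = \<tau> x) \<Longrightarrow> eqv \<sigma> \<rho> = eqv \<tau> \<rho>"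
  unfolding eqv_def by (simp only: app_cong[of c \<sigma> \<tau>])

lemma class_eq: "F `` {app \<sigma> c} = F `` {app \<tau> c} \<longleftrightarrow> eqv \<sigma> \<tau>"
  unfolding eqv_def by (rule eq_equiv_class_iff[OF equiv_F]) simp_all

definition orb :: "('m \<Rightarrow> 'm) set \<Rightarrow> ('k, 'm) tuple set set" where
  "orb G = (\<lambda>\<sigma>. F `` {app \<sigma> c}) ` G"

lemma orbit_eq: "orbit L M P (c, F) = orb (aut_over L M P)"
  by (auto simp: orbit_def orb_def)

lemma orb_mono: "G \<subseteq> H \<Longrightarrow> small (orb H) \<Longrightarrow> small (orb G)"
  unfolding orb_def by (erule small_subset) (rule image_mono)

lemma orb_choose:
  obtains \<tau> where "\<forall>z \<in> orb G. \<tau> z \<in> G \<and> z = F `` {app (\<tau> z) c}"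
proof -
  have "\<forall>z \<in> orb G. \<exists>\<sigma>. \<sigma> \<in> G \<and> z = F `` {app \<sigma> c}"
    unfolding orb_def by blast
  then have "\<exists>\<tau>. \<forall>z \<in> orb G. \<tau> z \<in> G \<and> z = F `` {app (\<tau> z) c}"
    by (rule bchoice)
  then show ?thesis by (rule exE) (rule that)
qed

text \<open>
  A representative generic over representatives of the whole orbit lies in one of
  the classes of the orbit; as its type is invariant, it lies in all of them.
\<close>

lemma elem_fixed:
  assumes N: "elem N" "small N" and bdd: "small (orb (fixer N))" and \<sigma>: "\<sigma> \<in> fixer N"
  shows "eqv id \<sigma>"
proof -
  let ?D = "ran c"
  have "fin_sat N ?D N"
    using N(1) unfolding elem_def by (rule fin_sat_mono) auto
  then obtain U where "coheir N ?D N U"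
    by (rule fin_sat_coheir)
  note U = coheirD[OF this]
  obtain \<tau> where "\<forall>z \<in> orb (fixer N). \<tau> z \<in> fixer N \<and> z = F `` {app (\<tau> z) c}"
    by (rule orb_choose)
  note \<tau> = bspec[OF this, THEN conjunct1] bspec[OF this, THEN conjunct2]
  define C where "C = N \<union> ?D \<union> \<sigma> ` ?D \<union> (\<Union>z \<in> orb (fixer N). \<tau> z ` ?D)"
  have "small C"
    unfolding C_def by (intro small_Un N(2) small_ran small_image small_UN_image bdd)
  then obtain p where p: "rlim C ?D U p"
    by (rule rlim_exists[OF U(1) _ small_ran])
  have key: "tequiv (?D <+> ?D) (case_sum \<rho> p) (case_sum id p)"
    if \<rho>: "\<rho> \<in> fixer N" "\<rho> ` ?D \<subseteq> C" for \<rho>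
  proof (rule tequivI)
    fix Z :: "('m + 'm \<Rightarrow> 'm) set" assume Z: "df (?D <+> ?D) Z"
    have "case_sum \<rho> h \<in> Z \<longleftrightarrow> case_sum id h \<in> Z" if "range h \<subseteq> N" for h
    proof -
      have "case_sum \<rho> h = \<rho> \<circ> case_sum id h"
        using \<rho>(1) that by (rule fixer_case_sum)
      then show ?thesis
        using aut_df[OF fixer_aut[OF \<rho>(1)] Z] by simp
    qed
    then have "U {h. case_sum \<rho> h \<in> Z} \<longleftrightarrow> U {h. case_sum id h \<in> Z}"
      by (intro ultra_cong[OF U(1,2)]) simp
    moreover have "case_sum \<rho> p \<in> Z \<longleftrightarrow> U {h. case_sum \<rho> h \<in> Z}"
      by (rule rlim_tuple[OF p \<rho>(2) Z])
    moreover have "case_sum id p \<in> Z \<longleftrightarrow> U {h. case_sum id h \<in> Z}"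
      by (rule rlim_tuple[OF p _ Z]) (auto simp: C_def)
    ultimately show "case_sum \<rho> p \<in> Z \<longleftrightarrow> case_sum id p \<in> Z"
      by blast
  qed
  have move: "eqv \<rho> p \<longleftrightarrow> eqv id p" if \<rho>: "\<rho> \<in> fixer N" "\<rho> ` ?D \<subseteq> C" for \<rho>
  proof -
    obtain \<beta> where \<beta>: "\<beta> \<in> Aut"
      "\<forall>v \<in> ?D <+> ?D. \<beta> (case_sum \<rho> p v) = case_sum id p v"
      by (rule homogeneous[OF small_Plus[OF small_ran small_ran] key[OF \<rho>]])
    have "\<beta> (\<rho> d) = d" if "d \<in> ?D" for d
      using bspec[OF \<beta>(2), of "Inl d"] that by auto
    moreover have "\<beta> (p d) = p d" if "d \<in> ?D" for d
      using bspec[OF \<beta>(2), of "Inr d"] that by auto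
    ultimately have "app \<beta> (app \<rho> c) = app id c" "app \<beta> (app p c) = app p c"
      unfolding app_comp[symmetric] by (intro app_cong; simp)+
    then show ?thesis
      using F_aut[OF \<beta>(1), of "app \<rho> c" "app p c"] by (simp add: eqv_def)
  qed
  \<comment> \<open>Over \<open>N\<close> alone, \<open>p\<close> realizes the type of
    \<open>c\<close> itself, so the class of its image of \<open>c\<close> belongs to the
    orbit.\<close>
  have "tequiv (N <+> ?D) (case_sum id id) (case_sum id p)"
  proof (rule tequivI)
    fix Z :: "('m + 'm \<Rightarrow> 'm) set" assume Z: "df (N <+> ?D) Z"
    have "rlim N ?D U p" by (rule rlim_mono[OF p]) (auto simp: C_def)
    from rlimD[OF this Z] show "case_sum id id \<in> Z \<longleftrightarrow> case_sum id p \<in> Z"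
      using U(3)[OF Z] by blast
  qed
  then obtain \<pi> where \<pi>: "\<pi> \<in> Aut"
    "\<forall>v \<in> N <+> ?D. \<pi> (case_sum id id v) = case_sum id p v"
    by (rule homogeneous[OF small_Plus[OF N(2) small_ran]])
  have "\<pi> x = x" if "x \<in> N" for x
    using bspec[OF \<pi>(2), of "Inl x"] that by auto
  then have "\<pi> \<in> fixer N"
    using \<pi>(1) by (intro fixerI)
  then have z: "F `` {app \<pi> c} \<in> orb (fixer N)"
    unfolding orb_def by (rule imageI)
  have "\<pi> d = p d" if "d \<in> ?D" for d
    using bspec[OF \<pi>(2), of "Inr d"] that by auto
  then have "eqv \<pi> (\<tau> (F `` {app \<pi> c})) \<longleftrightarrow> eqv p (\<tau> (F `` {app \<pi> c}))"
    by (rule eqv_cong)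
  moreover have "eqv \<pi> (\<tau> (F `` {app \<pi> c}))"
    using \<tau>(2)[OF z] unfolding class_eq .
  ultimately have "eqv (\<tau> (F `` {app \<pi> c})) p"
    by (metis eqv_sym)
  moreover have "\<tau> (F `` {app \<pi> c}) ` ?D \<subseteq> C"
    using z unfolding C_def by blast
  ultimately have "eqv id p"
    using move[OF \<tau>(1)[OF z]] by blast
  moreover have "\<sigma> ` ?D \<subseteq> C"
    unfolding C_def by blast
  ultimately have "eqv \<sigma> p"
    using move[OF \<sigma>] by blast
  then show ?thesis
    by (rule eqv_trans[OF \<open>eqv id p\<close> eqv_sym])
qed

text \<open>
  Realizing the coheir of the type of \<open>Y\<close> over \<open>X\<close> over all conjugates of \<open>X\<close> yields one conjugate of
  \<open>Y\<close> over which all the conjugates of the ultraimaginary are in its bounded orbit.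
\<close>

lemma bounded_fixed_fin_sat:
  assumes fs: "fin_sat X Y N" and small: "small X" "small Y"
    and X: "\<And>\<sigma>. \<sigma> \<in> fixer X \<Longrightarrow> eqv id \<sigma>" and Y: "small (orb (fixer Y))"
  shows "small (orb (fixer N))"
proof (rule ccontr)
  assume "\<not> small (orb (fixer N))"
  then have "\<kappa> \<le>o |orb (fixer N)|"
    using Card_order_\<kappa> unfolding small_def
    by (simp add: card_of_Well_order card_order_on_well_order_on not_ordLess_iff_ordLeq)
  moreover have "|Pow (orb (fixer Y))| <o \<kappa>"
    using small_Pow[OF Y] by (simp add: small_def)
  ultimately have "|Pow (orb (fixer Y))| \<le>o |orb (fixer N)|"
    using ordLess_ordLeq_trans ordLess_imp_ordLeq by blast
  then obtain f where f: "inj_on f (Pow (orb (fixer Y)))" "f ` Pow (orb (fixer Y)) \<subseteq> orb (fixer N)"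
    unfolding card_of_ordLeq[symmetric] by blast
  \<comment> \<open>Parameters must stay small, so only part of the orbit is treated: as many
    classes as \<open>orb (fixer Y)\<close> has subsets. They are few because \<kappa> is a strong
    limit, yet too many to embed into \<open>orb (fixer Y)\<close>, by Cantor's theorem.\<close>
  define Q where "Q = f ` Pow (orb (fixer Y))"
  have Q: "small Q" "Q \<subseteq> orb (fixer N)"
    unfolding Q_def using small_image[OF small_Pow[OF Y]] f(2) by auto
  obtain \<tau> where "\<forall>z \<in> orb (fixer N). \<tau> z \<in> fixer N \<and> z = F `` {app (\<tau> z) c}"
    by (rule orb_choose)
  note \<tau> = bspec[OF this, THEN conjunct1] bspec[OF this, THEN conjunct2]
  obtain U where "coheir X Y N U"
    by (rule fin_sat_coheir[OF fs])
  note U = coheirD[OF this]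
  define C where "C = (\<Union>z \<in> Q. \<tau> z ` X)"
  have "small C"
    unfolding C_def by (intro small_UN_image Q small)
  then obtain p where p: "rlim C Y U p"
    by (rule rlim_exists[OF U(1) _ small(2)])
  \<comment> \<open>\<beta> continues \<open>\<tau> z\<close> on \<open>X\<close> and
    \<open>p\<close> on \<open>Y\<close>. The first keeps it in the class of
    \<open>\<tau> z\<close>, since the class is fixed over \<open>X\<close>; the second does not
    depend on \<open>z\<close>.\<close>
  have "\<exists>\<beta>. \<beta> \<in> Aut \<and> eqv (\<tau> z) \<beta> \<and> (\<forall>y \<in> Y. \<beta> y = p y)" if z: "z \<in> Q" for z
  proof -
    have t: "\<tau> z \<in> fixer N" using \<tau>(1) z Q(2) by blast
    have tX: "\<tau> z ` X \<subseteq> C" using z unfolding C_def by blast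
    have "tequiv (X <+> Y) (case_sum id id) (case_sum (\<tau> z) p)"
    proof (rule tequivI)
      fix Z :: "('m + 'm \<Rightarrow> 'm) set" assume Z: "df (X <+> Y) Z"
      have "case_sum (\<tau> z) h \<in> Z \<longleftrightarrow> case_sum id h \<in> Z" if "range h \<subseteq> N" for h
      proof -
        have "case_sum (\<tau> z) h = \<tau> z \<circ> case_sum id h"
          using t that by (rule fixer_case_sum)
        then show ?thesis
          using aut_df[OF fixer_aut[OF t] Z] by simp
      qed
      then have "U {h. case_sum (\<tau> z) h \<in> Z} \<longleftrightarrow> U {h. case_sum id h \<in> Z}"
        by (intro ultra_cong[OF U(1,2)]) simp
      then show "case_sum id id \<in> Z \<longleftrightarrow> case_sum (\<tau> z) p \<in> Z"
        using rlim_tuple[OF p tX Z] U(3)[OF Z] by blast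
    qed
    then obtain \<beta> where \<beta>: "\<beta> \<in> Aut"
      "\<forall>v \<in> X <+> Y. \<beta> (case_sum id id v) = case_sum (\<tau> z) p v"
      by (rule homogeneous[OF small_Plus[OF small]])
    have "\<beta> x = \<tau> z x" if "x \<in> X" for x
      using bspec[OF \<beta>(2), of "Inl x"] that by auto
    then have "inv (\<tau> z) \<circ> \<beta> \<in> fixer X"
      by (intro fixer_comp_inv \<beta>(1) fixer_aut[OF t])
    then have "eqv id (inv (\<tau> z) \<circ> \<beta>)"
      by (rule X)
    then have "eqv (\<tau> z \<circ> id) (\<tau> z \<circ> (inv (\<tau> z) \<circ> \<beta>))"
      by (simp only: eqv_comp[OF fixer_aut[OF t]])
    then have "eqv (\<tau> z) \<beta>"
      by (simp only: comp_assoc[symmetric] aut_inv_comp(1)[OF fixer_aut[OF t]] id_comp comp_id)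
    moreover have "\<beta> y = p y" if "y \<in> Y" for y
      using bspec[OF \<beta>(2), of "Inr y"] that by auto
    ultimately show ?thesis using \<beta>(1) by blast
  qed
  then have "\<forall>z \<in> Q. \<exists>\<beta>. \<beta> \<in> Aut \<and> eqv (\<tau> z) \<beta> \<and> (\<forall>y \<in> Y. \<beta> y = p y)"
    by blast
  then have "\<exists>\<beta>. \<forall>z \<in> Q. \<beta> z \<in> Aut \<and> eqv (\<tau> z) (\<beta> z) \<and> (\<forall>y \<in> Y. \<beta> z y = p y)"
    by (rule bchoice)
  then obtain \<beta> where \<beta>: "\<And>z. z \<in> Q \<Longrightarrow> \<beta> z \<in> Aut" "\<And>z. z \<in> Q \<Longrightarrow> eqv (\<tau> z) (\<beta> z)"
    "\<And>z y. z \<in> Q \<Longrightarrow> y \<in> Y \<Longrightarrow> \<beta> z y = p y"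
    by blast
  have "Q \<noteq> {}" unfolding Q_def by blast
  then obtain z0 where z0: "z0 \<in> Q" by blast
  \<comment> \<open>All \<open>\<beta> z\<close> have the same values on \<open>Y\<close>, so
    translating back by a single one of them lands in \<open>fixer Y\<close>.\<close>
  define g where "g z = F `` {app (inv (\<beta> z0) \<circ> \<beta> z) c}" for z
  have "g ` Q \<subseteq> orb (fixer Y)"
  proof
    fix w assume "w \<in> g ` Q"
    then obtain z where z: "z \<in> Q" "w = g z" by blast
    have "inv (\<beta> z0) \<circ> \<beta> z \<in> fixer Y"
      using \<beta>(3)[OF z(1)] \<beta>(3)[OF z0] by (intro fixer_comp_inv \<beta>(1) z z0) simp
    then show "w \<in> orb (fixer Y)"
      unfolding z(2) g_def orb_def by (rule imageI)
  qed
  moreover have "inj_on g Q"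
  proof (rule inj_onI)
    fix z w assume z: "z \<in> Q" and w: "w \<in> Q" and "g z = g w"
    then have "eqv (\<beta> z) (\<beta> w)"
      unfolding g_def class_eq eqv_comp[OF aut_inv[OF \<beta>(1)[OF z0]]] by blast
    then have "eqv (\<tau> z) (\<tau> w)"
      by (rule eqv_trans[OF eqv_trans[OF \<beta>(2)[OF z]] eqv_sym[OF \<beta>(2)[OF w]]])
    then have "F `` {app (\<tau> z) c} = F `` {app (\<tau> w) c}"
      unfolding class_eq .
    then show "z = w"
      using \<tau>(2)[of z] \<tau>(2)[of w] z w Q(2) by auto
  qed
  ultimately have "inj_on (g \<circ> f) (Pow (orb (fixer Y)))" "(g \<circ> f) ` Pow (orb (fixer Y)) \<subseteq> orb (fixer Y)"
    using f(1) unfolding Q_def by (auto intro: comp_inj_on)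
  then have "|Pow (orb (fixer Y))| \<le>o |orb (fixer Y)|"
    unfolding card_of_ordLeq[symmetric] by blast
  then show False
    using card_of_Pow not_ordLess_ordLeq by blast
qed

text \<open>Weakens "fixed over \<open>X\<close>" to "bounded over \<open>X\<close>":
  \<open>X\<close> is enlarged to an elementary set over which the type of \<open>Y\<close> is still
  finitely satisfiable in \<open>N\<close>, and over an elementary set bounded means fixed.\<close>

lemma bounded_fin_sat:
  assumes fs: "fin_sat X Y N" and NX: "N \<subseteq> X" and small: "small X" "small Y"
    and X: "small (orb (fixer X))" and Y: "small (orb (fixer Y))"
  shows "small (orb (fixer N))"
proof -
  obtain X' where X': "X \<subseteq> X'" "elem X'" "small X'"
    by (rule elem_exists[OF small(1)])
  obtain U where "coheir X Y N U"
    by (rule fin_sat_coheir[OF fs])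
  note U = coheirD[OF this]
  obtain p where p: "rlim X' Y U p"
    by (rule rlim_exists[OF U(1) X'(3) small(2)])
  have "tequiv (X <+> Y) (case_sum id p) (case_sum id id)"
  proof (rule tequivI)
    fix Z :: "('m + 'm \<Rightarrow> 'm) set" assume Z: "df (X <+> Y) Z"
    from rlimD[OF rlim_mono[OF p X'(1)] Z] show "case_sum id p \<in> Z \<longleftrightarrow> case_sum id id \<in> Z"
      using U(3)[OF Z] by blast
  qed
  \<comment> \<open>The limit over \<open>X'\<close> is realized by \<open>p\<close> instead of
    \<open>Y\<close>. Moving \<open>p\<close> back to \<open>Y\<close> over \<open>X\<close> moves
    the elementary set, not \<open>Y\<close>, whose orbit is the one known to be small.\<close>
  then obtain \<alpha> where \<alpha>: "\<alpha> \<in> Aut"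
    "\<forall>v \<in> X <+> Y. \<alpha> (case_sum id p v) = case_sum id id v"
    by (rule homogeneous[OF small_Plus[OF small]])
  have \<alpha>X: "\<alpha> x = x" if "x \<in> X" for x
    using bspec[OF \<alpha>(2), of "Inl x"] that by auto
  have \<alpha>Y: "\<alpha> (p y) = y" if "y \<in> Y" for y
    using bspec[OF \<alpha>(2), of "Inr y"] that by auto
  have inv: "inv \<alpha> (\<alpha> x) = x" "\<alpha> (inv \<alpha> x) = x" for x
    by (simp_all add: aut_inv_apply[OF \<alpha>(1)])
  have sub: "X \<subseteq> \<alpha> ` X'"
    using \<alpha>X X'(1) by (metis image_eqI subset_iff)
  have fs': "fin_sat (\<alpha> ` X') Y N"
    unfolding fin_sat_def
  proof (intro allI impI)
    fix Z :: "('m + 'm \<Rightarrow> 'm) set"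
    assume Z: "df (\<alpha> ` X' <+> Y) Z" and id: "case_sum id id \<in> Z"
    let ?Z = "{k. k \<circ> map_sum (inv \<alpha>) id \<in> Z}"
    have df: "df (X' <+> Y) ?Z"
      by (rule df_vimage[OF Z]) (auto simp: inv)
    have eq: "case_sum id h \<in> ?Z \<longleftrightarrow> case_sum id (\<alpha> \<circ> h) \<in> Z" for h
    proof -
      have "\<alpha> \<circ> (case_sum id h \<circ> map_sum (inv \<alpha>) id) = case_sum id (\<alpha> \<circ> h)"
        by (auto simp: fun_eq_iff inv split: sum.splits)
      then show ?thesis
        using aut_df[OF \<alpha>(1) Z, of "case_sum id h \<circ> map_sum (inv \<alpha>) id"] by simp
    qed
    have "case_sum id (\<alpha> \<circ> p) \<in> Z \<longleftrightarrow> case_sum id id \<in> Z"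
      using \<alpha>Y by (intro df_agree[OF Z]) auto
    then have "case_sum id p \<in> ?Z"
      using id eq by blast
    then have "U {h. case_sum id h \<in> ?Z}"
      using rlimD[OF p df] by blast
    then have "U ({h. range h \<subseteq> N} \<inter> {h. case_sum id h \<in> ?Z})"
      using U(1,2) by (simp add: ultra_Int[OF U(1)])
    then obtain h where h: "range h \<subseteq> N" "case_sum id h \<in> ?Z"
      using ultra_nonempty[OF U(1)] by blast
    \<comment> \<open>Since \<open>N \<subseteq> X\<close> is fixed by \<alpha>, the witnesses in
      \<open>N\<close> stay where they are.\<close>
    have "\<alpha> \<circ> h = h"
      using h(1) NX \<alpha>X by (auto simp: fun_eq_iff)
    then show "\<exists>h. range h \<subseteq> N \<and> case_sum id h \<in> Z"
      using h eq by (metis)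
  qed
  have fixed: "eqv id \<sigma>" if "\<sigma> \<in> fixer (\<alpha> ` X')" for \<sigma>
  proof (rule elem_fixed[OF elem_image[OF \<alpha>(1) X'(2)] small_image[OF X'(3)] _ that])
    have "fixer (\<alpha> ` X') \<subseteq> fixer X"
      using sub unfolding fixer_def by blast
    then show "small (orb (fixer (\<alpha> ` X')))"
      using X by (rule orb_mono)
  qed
  show ?thesis
    by (rule bounded_fixed_fin_sat[OF fs' small_image[OF X'(3)] small(2) fixed Y])
qed

end

section \<open>Hyperimaginary parameters\<close>

locale monster_over = monster L M T \<kappa>
  for L :: "('f, 'r) lang" and M :: "('f, 'r, 'm) struc" and T and \<kappa> :: "'k rel" +
  fixes A :: "('k, 'm) imaginary set"
  assumes hyper: "\<forall>h \<in> A. hyperimaginary L M \<kappa> h" and small_A: "param_card A <o \<kappa>"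
begin

abbreviation AutA :: "('m \<Rightarrow> 'm) set" where
  "AutA \<equiv> aut_over L M A"

definition reps :: "'m set" where
  "reps = (\<Union>(a, E) \<in> A. ran a)"

lemma ran_reps: "(a, E) \<in> A \<Longrightarrow> ran a \<subseteq> reps"
  unfolding reps_def by blast

lemma small_reps: "small reps"
proof -
  have "reps \<subseteq> (\<lambda>(x, k). the (fst x k)) ` (SIGMA x : A. dom (fst x))"
  proof
    fix y assume "y \<in> reps"
    then obtain a E k where "(a, E) \<in> A" "a k = Some y"
      unfolding reps_def ran_def by auto
    then show "y \<in> (\<lambda>(x, k). the (fst x k)) ` (SIGMA x : A. dom (fst x))"
      by (intro image_eqI[of _ _ "((a, E), k)"]) auto
  qed
  moreover have "small (SIGMA x : A. dom (fst x))"
    using small_A by (simp add: small_def param_card_def)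
  ultimately show ?thesis
    using small_subset[OF small_image] by blast
qed

text \<open>With the representative \<open>a\<close> as parameter, \<open>a E q(a)\<close> is a
  partial type in the values of \<open>q\<close> on \<open>ran a\<close>. In this form it survives
  limits and compactness arguments.\<close>

lemma hyper_df:
  assumes "(a, E) \<in> A"
  obtains \<Z> where "\<forall>Z \<in> \<Z>. df (ran a <+> ran a) Z"
    "\<forall>q. (a, app q a) \<in> E \<longleftrightarrow> (\<forall>Z \<in> \<Z>. case_sum id q \<in> Z)"
proof -
  have "type_definable L M (dom a) E"
    using bspec[OF hyper assms] by (simp add: hyperimaginary_def)
  then obtain \<Phi> :: "(('f, 'r) fm \<times> (nat \<Rightarrow> 'k + 'k)) set" where
    wf: "\<forall>(\<phi>, s) \<in> \<Phi>. wf_fm L \<phi> \<and> s ` fv \<phi> \<subseteq> dom a <+> dom a" and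
    E: "E = {(c, d). dom c = dom a \<and> dom d = dom a \<and>
               (\<forall>(\<phi>, s) \<in> \<Phi>. sat M (the \<circ> case_sum c d \<circ> s) \<phi>)}"
    unfolding type_definable_def by blast
  let ?r = "map_sum (the \<circ> a) (the \<circ> a)"
  define \<zeta> where "\<zeta> x = {h. sat M (h \<circ> (?r \<circ> snd x)) (fst x)}" for x :: "('f, 'r) fm \<times> (nat \<Rightarrow> 'k + 'k)"
  have df: "df (ran a <+> ran a) (\<zeta> x)" if "x \<in> \<Phi>" for x
    unfolding \<zeta>_def
  proof (rule dfI)
    have x: "wf_fm L (fst x)" "snd x ` fv (fst x) \<subseteq> dom a <+> dom a"
      using bspec[OF wf that] by (auto simp: case_prod_unfold)
    show "wf_fm L (fst x)" by (rule x)
    have "?r ` (dom a <+> dom a) \<subseteq> ran a <+> ran a"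
      by (auto intro: ranI)
    then show "(?r \<circ> snd x) ` fv (fst x) \<subseteq> ran a <+> ran a"
      using x(2) unfolding image_comp[symmetric] by blast
  qed
  have sat: "sat M (the \<circ> case_sum a (app q a) \<circ> snd x) (fst x) \<longleftrightarrow> case_sum id q \<in> \<zeta> x"
    if "x \<in> \<Phi>" for x q
    unfolding \<zeta>_def mem_Collect_eq
  proof (rule sat_cong)
    fix n assume "n \<in> fv (fst x)"
    then have "snd x n \<in> dom a <+> dom a"
      using bspec[OF wf that] by (auto simp: case_prod_unfold)
    moreover have "the (case_sum a (app q a) y) = case_sum id q (?r y)" if "y \<in> dom a <+> dom a" for y
      using that by (rule PlusE) (simp_all add: the_app)
    ultimately show "(the \<circ> case_sum a (app q a) \<circ> snd x) n = (case_sum id q \<circ> (?r \<circ> snd x)) n"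
      by (simp only: comp_apply)
  qed
  show ?thesis
  proof (rule that[of "\<zeta> ` \<Phi>"])
    show "\<forall>Z \<in> \<zeta> ` \<Phi>. df (ran a <+> ran a) Z"
      using df by (simp only: ball_simps(9)) (rule ballI)
    show "\<forall>q. (a, app q a) \<in> E \<longleftrightarrow> (\<forall>Z \<in> \<zeta> ` \<Phi>. case_sum id q \<in> Z)"
    proof
      fix q
      have "(a, app q a) \<in> E \<longleftrightarrow> (\<forall>x \<in> \<Phi>. sat M (the \<circ> case_sum a (app q a) \<circ> snd x) (fst x))"
        unfolding E by (simp add: case_prod_unfold)
      also have "\<dots> \<longleftrightarrow> (\<forall>x \<in> \<Phi>. case_sum id q \<in> \<zeta> x)"
        by (rule ball_cong[OF refl sat])
      finally show "(a, app q a) \<in> E \<longleftrightarrow> (\<forall>Z \<in> \<zeta> ` \<Phi>. case_sum id q \<in> Z)"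
        by (simp only: ball_simps(9))
    qed
  qed
qed

lemma hyper_equiv: "(a, E) \<in> A \<Longrightarrow> equiv {c. dom c = dom a} E"
  using hyper by (auto simp: hyperimaginary_def)

lemma hyper_aut:
  assumes "(a, E) \<in> A" and \<sigma>: "\<sigma> \<in> Aut" and cd: "(c, d) \<in> E"
  shows "(app \<sigma> c, app \<sigma> d) \<in> E"
proof -
  have "type_definable L M (dom a) E"
    using bspec[OF hyper assms(1)] by (simp add: hyperimaginary_def)
  then obtain \<Phi> :: "(('f, 'r) fm \<times> (nat \<Rightarrow> 'k + 'k)) set" where
    wf: "\<forall>(\<phi>, s) \<in> \<Phi>. wf_fm L \<phi> \<and> s ` fv \<phi> \<subseteq> dom a <+> dom a" and
    E: "E = {(c, d). dom c = dom a \<and> dom d = dom a \<and>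
               (\<forall>(\<phi>, s) \<in> \<Phi>. sat M (the \<circ> case_sum c d \<circ> s) \<phi>)}"
    unfolding type_definable_def by blast
  have dom: "dom c = dom a" "dom d = dom a"
    using cd unfolding E by auto
  have "sat M (the \<circ> case_sum (app \<sigma> c) (app \<sigma> d) \<circ> snd x) (fst x)" if "x \<in> \<Phi>" for x
  proof -
    have x: "wf_fm L (fst x)" "snd x ` fv (fst x) \<subseteq> dom a <+> dom a"
      using bspec[OF wf that] by (auto simp: case_prod_unfold)
    have "sat M (the \<circ> case_sum (app \<sigma> c) (app \<sigma> d) \<circ> snd x) (fst x) =
        sat M (\<sigma> \<circ> (the \<circ> case_sum c d \<circ> snd x)) (fst x)"
    proof (rule sat_cong)
      fix n assume "n \<in> fv (fst x)"
      then have "snd x n \<in> dom a <+> dom a"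
        using x(2) by blast
      moreover have "the (case_sum (app \<sigma> c) (app \<sigma> d) y) = \<sigma> (the (case_sum c d y))"
        if "y \<in> dom a <+> dom a" for y
        using that by (rule PlusE) (simp_all only: sum.case the_app dom)
      ultimately show "(the \<circ> case_sum (app \<sigma> c) (app \<sigma> d) \<circ> snd x) n =
          (\<sigma> \<circ> (the \<circ> case_sum c d \<circ> snd x)) n"
        by (simp only: comp_apply)
    qed
    also have "\<dots> = sat M (the \<circ> case_sum c d \<circ> snd x) (fst x)"
      using \<sigma> x(1) by (rule aut_sat)
    also have "\<dots>"
      using cd that unfolding E by (auto simp: case_prod_unfold)
    finally show ?thesis .
  qed
  then show ?thesis
    unfolding E using dom by (simp add: case_prod_unfold)
qed

lemma AutA_aut: "\<sigma> \<in> AutA \<Longrightarrow> \<sigma> \<in> Aut"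
  by (simp add: aut_over_def)

lemma AutAD: "\<sigma> \<in> AutA \<Longrightarrow> (a, E) \<in> A \<Longrightarrow> (a, app \<sigma> a) \<in> E"
  by (auto simp: aut_over_def)

lemma AutAI: "\<sigma> \<in> Aut \<Longrightarrow> (\<And>a E. (a, E) \<in> A \<Longrightarrow> (a, app \<sigma> a) \<in> E) \<Longrightarrow> \<sigma> \<in> AutA"
  by (auto simp: aut_over_def)

lemma AutA_id: "id \<in> AutA"
proof (rule AutAI[OF aut_id])
  fix a E assume "(a, E) \<in> A"
  from hyper_equiv[OF this] show "(a, app id a) \<in> E"
    by (simp add: equiv_def refl_on_def)
qed

lemma AutA_comp:
  assumes "\<sigma> \<in> AutA" "\<tau> \<in> AutA"
  shows "\<sigma> \<circ> \<tau> \<in> AutA"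
proof (rule AutAI)
  show "\<sigma> \<circ> \<tau> \<in> Aut"
    using assms by (intro aut_comp AutA_aut)
  fix a E assume aE: "(a, E) \<in> A"
  have "(app \<sigma> a, app \<sigma> (app \<tau> a)) \<in> E"
    by (rule hyper_aut[OF aE AutA_aut[OF assms(1)] AutAD[OF assms(2) aE]])
  moreover have "trans E"
    using hyper_equiv[OF aE] by (simp add: equiv_def)
  ultimately show "(a, app (\<sigma> \<circ> \<tau>) a) \<in> E"
    unfolding app_comp using AutAD[OF assms(1) aE] by (meson transD)
qed

lemma AutA_inv:
  assumes "\<sigma> \<in> AutA"
  shows "inv \<sigma> \<in> AutA"
proof (rule AutAI)
  show i: "inv \<sigma> \<in> Aut"
    using assms by (intro aut_inv AutA_aut)
  fix a E assume aE: "(a, E) \<in> A"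
  have "(app (inv \<sigma>) a, app (inv \<sigma>) (app \<sigma> a)) \<in> E"
    by (rule hyper_aut[OF aE i AutAD[OF assms aE]])
  then have "(app (inv \<sigma>) a, a) \<in> E"
    by (simp only: app_comp[symmetric] aut_inv_comp(2)[OF AutA_aut[OF assms]] app_id)
  moreover have "sym E"
    using hyper_equiv[OF aE] by (simp add: equiv_def)
  ultimately show "(a, app (inv \<sigma>) a) \<in> E"
    by (meson symD)
qed

lemma AutA_agree:
  assumes "\<sigma> \<in> Aut" "\<tau> \<in> AutA" "\<And>x. x \<in> reps \<Longrightarrow> \<sigma> x = \<tau> x"
  shows "\<sigma> \<in> AutA"
proof (rule AutAI[OF assms(1)])
  fix a E assume aE: "(a, E) \<in> A"
  have "app \<sigma> a = app \<tau> a"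
    using ran_reps[OF aE] assms(3) by (intro app_cong) blast
  then show "(a, app \<sigma> a) \<in> E"
    using AutAD[OF assms(2) aE] by simp
qed

text \<open>
  A set closed under \<open>orbit_step\<close> has enough self-maps for every conjugate of it to be a limit of them.
\<close>

definition mover :: "('f, 'r) fm \<Rightarrow> ('m + 'm) list \<Rightarrow> 'm \<Rightarrow> 'm" where
  "mover \<phi> vs = (SOME g. g \<in> AutA \<and> sat M (\<lambda>i. case_sum id g (vs ! i)) \<phi>)"

definition orbit_step :: "'m set \<Rightarrow> 'm set" where
  "orbit_step N = (\<lambda>(\<phi>, vs, x). mover \<phi> vs x) ` (WF \<times> lists (N <+> N) \<times> N)"

definition self_maps :: "'m set \<Rightarrow> ('m \<Rightarrow> 'm) set" where
  "self_maps N = {g \<in> AutA. g ` N \<subseteq> N}"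

lemma self_maps_id: "id \<in> self_maps N"
  by (simp add: self_maps_def AutA_id)

lemma self_maps_comp: "f \<in> self_maps N \<Longrightarrow> g \<in> self_maps N \<Longrightarrow> f \<circ> g \<in> self_maps N"
  unfolding self_maps_def by (simp add: AutA_comp image_comp[symmetric]) blast

text \<open>\<open>orbit_step\<close> closes \<open>N\<close> under a mover at all elements of
  \<open>N\<close>, not just at those occurring in the formula. Therefore the mover found is a
  self-map of \<open>N\<close>.\<close>

lemma orbit_step_dense:
  assumes step: "orbit_step N \<subseteq> N" and Z: "df (N <+> N) Z" and g: "g \<in> AutA" "case_sum id g \<in> Z"
  shows "\<exists>\<gamma> \<in> self_maps N. case_sum id \<gamma> \<in> Z"
proof (rule df_list[OF Z])
  fix \<phi> vs
  assume \<phi>: "wf_fm L \<phi>" "set vs \<subseteq> N <+> N" "fv \<phi> \<subseteq> {..<length vs}"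
    "\<And>h. h \<in> Z \<longleftrightarrow> sat M (\<lambda>i. h (vs ! i)) \<phi>"
  have "g \<in> AutA \<and> sat M (\<lambda>i. case_sum id g (vs ! i)) \<phi>"
    using g \<phi>(4) by blast
  then have m: "mover \<phi> vs \<in> AutA \<and> sat M (\<lambda>i. case_sum id (mover \<phi> vs) (vs ! i)) \<phi>"
    unfolding mover_def by (rule someI[of "\<lambda>g. g \<in> AutA \<and> sat M (\<lambda>i. case_sum id g (vs ! i)) \<phi>"])
  have "mover \<phi> vs x \<in> N" if "x \<in> N" for x
  proof -
    have "(\<lambda>(\<phi>, vs, x). mover \<phi> vs x) (\<phi>, vs, x) \<in> orbit_step N"
      unfolding orbit_step_def using \<phi>(1,2) that by (intro imageI) auto
    then show ?thesis using step by auto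
  qed
  then have "mover \<phi> vs \<in> self_maps N"
    using m unfolding self_maps_def by blast
  moreover have "case_sum id (mover \<phi> vs) \<in> Z"
    using m \<phi>(4) by blast
  ultimately show ?thesis by blast
qed

lemma orbit_step_cont:
  fixes f :: "nat \<Rightarrow> 'm set"
  assumes inc: "incseq f"
  shows "orbit_step (\<Union>i. f i) \<subseteq> (\<Union>i. orbit_step (f i))"
proof
  fix y assume "y \<in> orbit_step (\<Union>i. f i)"
  then obtain \<phi> vs x where y: "y = mover \<phi> vs x" "\<phi> \<in> WF"
    and vs: "vs \<in> lists ((\<Union>i. f i) <+> (\<Union>i. f i))" and x: "x \<in> (\<Union>i. f i)"
    unfolding orbit_step_def by auto
  obtain j where j: "x \<in> f j"
    using x by blast
  have inc2: "incseq (\<lambda>i. f i <+> f i)"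
    using inc unfolding incseq_def by (blast intro!: Plus_mono)
  have "(\<Union>i. f i) <+> (\<Union>i. f i) = (\<Union>i. f i <+> f i)"
    by auto
  with vs have "vs \<in> lists (\<Union>i. f i <+> f i)"
    by (simp only:)
  from lists_UN_incseq[OF inc2 this] obtain i where i: "vs \<in> lists (f i <+> f i)"
    by (rule exE)
  have "f i <+> f i \<subseteq> f (max i j) <+> f (max i j)" "f j \<subseteq> f (max i j)"
    using incseqD[OF inc2, of i "max i j"] incseqD[OF inc, of j "max i j"] by simp_all
  then have "vs \<in> lists (f (max i j) <+> f (max i j))" "x \<in> f (max i j)"
    using lists_mono[of "f i <+> f i"] i j by (blast, blast)
  then have "(\<lambda>(\<phi>, vs, x). mover \<phi> vs x) (\<phi>, vs, x) \<in> orbit_step (f (max i j))"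
    unfolding orbit_step_def using y(2) by (intro imageI) blast
  then show "y \<in> (\<Union>i. orbit_step (f i))"
    using y(1) by auto
qed

lemma orbit_step_card:
  assumes Y: "infinite Y" "|WF| \<le>o |Y|" and N: "|N| \<le>o |Y|"
  shows "|orbit_step N| \<le>o |Y|"
proof -
  have "|WF \<times> lists (N <+> N) \<times> N| \<le>o |Y|"
    by (intro card_Times_infinite[OF Y(1)] Y(2) card_lists_infinite[OF Y(1)] card_Plus_infinite[OF Y(1)] N)
  then show ?thesis
    unfolding orbit_step_def by (rule ordLeq_transitive[OF card_of_image])
qed

lemma base_exists:
  assumes "small X"
  obtains N where "X \<subseteq> N" "small N" "elem N" "orbit_step N \<subseteq> N"
proof -
  obtain B :: "('m + ('f, 'r) fm + ('f, 'r) fm) set" where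
    B: "infinite B" "small B" "|X| \<le>o |B|" "|WF| \<le>o |B|" "|T| \<le>o |B|"
    by (rule small_bound[OF assms small_WF])
  show ?thesis
  proof (rule closure_exists[OF B(1,3), of "\<lambda>N. skolem_step N \<union> orbit_step N"])
    show "|skolem_step N \<union> orbit_step N| \<le>o |B|" if "|N| \<le>o |B|" for N
      by (rule card_Un_infinite[OF B(1) skolem_step_card[OF B(1,4) that] orbit_step_card[OF B(1,4) that]])
    show "skolem_step (\<Union>i. f i) \<union> orbit_step (\<Union>i. f i) \<subseteq> (\<Union>i. skolem_step (f i) \<union> orbit_step (f i))"
      if "incseq f" for f :: "nat \<Rightarrow> 'm set"
      using skolem_step_cont[OF that] orbit_step_cont[OF that] by blast
    fix N assume N: "X \<subseteq> N" "skolem_step N \<union> orbit_step N \<subseteq> N" "|N| \<le>o |B|"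
    have "skolem_step N \<subseteq> N" "orbit_step N \<subseteq> N"
      using N(2) by blast+
    then show ?thesis
      by (rule that[OF N(1) small_card[OF N(3) B(2)] elemI])
  qed
qed

end

section \<open>Reindexing a base along ultrafilters\<close>

locale base = monster_over L M T \<kappa> A
  for L :: "('f, 'r) lang" and M :: "('f, 'r, 'm) struc" and T and \<kappa> :: "'k rel"
    and A :: "('k, 'm) imaginary set" +
  fixes N :: "'m set" and u :: "('m \<Rightarrow> 'm) set \<Rightarrow> bool"
  assumes reps_N: "reps \<subseteq> N" and small_N: "small N" and elem_N: "elem N"
    and step_N: "orbit_step N \<subseteq> N"
    and ultra_u: "ultra u" and u_self: "u (self_maps N)" and u_idem: "u \<star> u = u"
    and u_inv: "\<And>w. ultra w \<Longrightarrow> w (self_maps N) \<Longrightarrow>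
      \<exists>v. ultra v \<and> v (self_maps N) \<and> v \<star> (w \<star> u) = u"
begin

definition ultras :: "(('m \<Rightarrow> 'm) set \<Rightarrow> bool) set" where
  "ultras = {w. ultra w \<and> w (self_maps N)}"

lemma ultrasD: "w \<in> ultras \<Longrightarrow> ultra w" "w \<in> ultras \<Longrightarrow> w (self_maps N)"
  by (simp_all add: ultras_def)

lemma u_ultras: "u \<in> ultras"
  by (simp add: ultras_def ultra_u u_self)

text \<open>\<open>clim C w q p\<close>: over \<open>C\<close>, the copy \<open>p\<close> of \<open>N\<close> is the limit along \<open>w\<close> of the
  reindexings \<open>q \<circ> \<gamma>\<close> of the copy \<open>q\<close>.\<close>

definition clim :: "'m set \<Rightarrow> (('m \<Rightarrow> 'm) set \<Rightarrow> bool) \<Rightarrow> ('m \<Rightarrow> 'm) \<Rightarrow> ('m \<Rightarrow> 'm) \<Rightarrow> bool" where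
  "clim C w q p \<longleftrightarrow> rlim C N (\<lambda>S. w {\<gamma>. q \<circ> \<gamma> \<in> S}) p"

lemma clim_tuple:
  assumes "clim C w q p" "c ` V \<subseteq> C" "df (V <+> N) Z"
  shows "case_sum c p \<in> Z \<longleftrightarrow> w {\<gamma>. case_sum c (q \<circ> \<gamma>) \<in> Z}"
  using rlim_tuple[OF assms(1)[unfolded clim_def] assms(2,3)] by simp

lemma clim_id:
  assumes "clim C w q p" "df (C <+> N) Z"
  shows "case_sum id p \<in> Z \<longleftrightarrow> w {\<gamma>. case_sum id (q \<circ> \<gamma>) \<in> Z}"
  by (rule clim_tuple[OF assms(1) _ assms(2)]) simp

lemma climI:
  "(\<And>Z. df (C <+> N) Z \<Longrightarrow> case_sum id p \<in> Z \<longleftrightarrow> w {\<gamma>. case_sum id (q \<circ> \<gamma>) \<in> Z}) \<Longrightarrow> clim C w q p"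
  unfolding clim_def rlim_def by simp

lemma clim_mono: "clim C w q p \<Longrightarrow> C' \<subseteq> C \<Longrightarrow> clim C' w q p"
  unfolding clim_def by (rule rlim_mono)

lemma clim_exists:
  assumes "w \<in> ultras" "small C"
  obtains p where "clim C w q p"
proof -
  have "ultra (\<lambda>S. w {\<gamma>. q \<circ> \<gamma> \<in> S})"
    using ultra_image[OF ultrasD(1)[OF assms(1)], of "\<lambda>\<gamma>. q \<circ> \<gamma>"] unfolding vimage_def .
  then obtain p where "rlim C N (\<lambda>S. w {\<gamma>. q \<circ> \<gamma> \<in> S}) p"
    by (rule rlim_exists[OF _ assms(2) small_N])
  then show ?thesis
    unfolding clim_def[symmetric] by (rule that)
qed

lemma self_mapsD: "\<gamma> \<in> self_maps N \<Longrightarrow> \<gamma> \<in> AutA" "\<gamma> \<in> self_maps N \<Longrightarrow> x \<in> N \<Longrightarrow> \<gamma> x \<in> N"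
  by (auto simp: self_maps_def)

text \<open>Iterated limits are limits along the product. A self-map \<open>g\<close> drawn from
  \<open>v\<close> only reindexes \<open>p\<close>, so the type of \<open>p \<circ> g\<close> over
  \<open>C\<close> is computed along \<open>w\<close> from
  \<open>q \<circ> f \<circ> g\<close>.\<close>

lemma clim_comp:
  assumes 1: "clim C w q p" and 2: "clim D v p r" and CD: "C \<subseteq> D"
    and v: "v \<in> ultras"
  shows "clim C (w \<star> v) q r"
proof (rule climI)
  fix Z :: "('m + 'm \<Rightarrow> 'm) set" assume Z: "df (C <+> N) Z"
  have "case_sum id r \<in> Z \<longleftrightarrow> v {g. case_sum id (p \<circ> g) \<in> Z}"
    by (rule clim_id[OF clim_mono[OF 2 CD] Z])
  also have "\<dots> \<longleftrightarrow> v {g. w {f. f \<circ> g \<in> {k. case_sum id (q \<circ> k) \<in> Z}}}"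
  proof (rule ultra_cong[OF ultrasD[OF v]])
    fix g assume g: "g \<in> self_maps N"
    have "df (C <+> N) {k. k \<circ> map_sum id g \<in> Z}"
      using self_mapsD(2)[OF g] by (intro df_vimage[OF Z]) auto
    moreover have "case_sum id h \<circ> map_sum id g = case_sum id (h \<circ> g)" for h :: "'m \<Rightarrow> 'm"
      by (auto simp: fun_eq_iff split: sum.splits)
    ultimately have "case_sum id (p \<circ> g) \<in> Z \<longleftrightarrow> w {f. case_sum id (q \<circ> f \<circ> g) \<in> Z}"
      using clim_id[OF 1, of "{k. k \<circ> map_sum id g \<in> Z}"] by (simp only: mem_Collect_eq)
    then show "g \<in> {g. case_sum id (p \<circ> g) \<in> Z} \<longleftrightarrow>
        g \<in> {g. w {f. f \<circ> g \<in> {k. case_sum id (q \<circ> k) \<in> Z}}}"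
      by (simp only: mem_Collect_eq comp_assoc)
  qed
  finally show "case_sum id r \<in> Z \<longleftrightarrow> (w \<star> v) {\<gamma>. case_sum id (q \<circ> \<gamma>) \<in> Z}"
    by (simp only: ultra_comp_def)
qed

text \<open>The type of a limit over a tuple which contains the previous copy is determined by
  \<open>w\<close> and the type of that tuple. The map \<open>e\<close> tells where in the tuple the
  previous copy sits.\<close>

lemma clim_transfer:
  assumes 1: "clim C w q p" "c ` V \<subseteq> C" "\<And>x. x \<in> N \<Longrightarrow> q x = c (e x)"
    and 2: "clim C' w q' p'" "c' ` V \<subseteq> C'" "\<And>x. x \<in> N \<Longrightarrow> q' x = c' (e x)"
    and e: "e ` N \<subseteq> V" and w: "w \<in> ultras" and eq: "tequiv V c c'"
  shows "tequiv (V <+> N) (case_sum c p) (case_sum c' p')"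
proof (rule tequivI)
  fix Z :: "('a + 'm \<Rightarrow> 'm) set" assume Z: "df (V <+> N) Z"
  have key: "case_sum k (r \<circ> g) \<in> Z \<longleftrightarrow> k \<circ> case_sum id (e \<circ> g) \<in> Z"
    if "\<And>x. x \<in> N \<Longrightarrow> r x = k (e x)" "g \<in> self_maps N" for k r g
  proof (rule df_agree[OF Z])
    fix v assume "v \<in> V <+> N"
    then show "case_sum k (r \<circ> g) v = (k \<circ> case_sum id (e \<circ> g)) v"
      using that(1) self_mapsD(2)[OF that(2)] by (elim PlusE) simp_all
  qed
  have "case_sum c p \<in> Z \<longleftrightarrow> w {\<gamma>. case_sum c (q \<circ> \<gamma>) \<in> Z}"
    by (rule clim_tuple[OF 1(1,2) Z])
  also have "\<dots> \<longleftrightarrow> w {\<gamma>. case_sum c' (q' \<circ> \<gamma>) \<in> Z}"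
  proof (rule ultra_cong[OF ultrasD[OF w]])
    fix g assume g: "g \<in> self_maps N"
    have "df V {h. h \<circ> case_sum id (e \<circ> g) \<in> Z}"
      using e self_mapsD(2)[OF g] by (intro df_vimage[OF Z]) auto
    from tequivD[OF eq this] show "g \<in> {\<gamma>. case_sum c (q \<circ> \<gamma>) \<in> Z} \<longleftrightarrow> g \<in> {\<gamma>. case_sum c' (q' \<circ> \<gamma>) \<in> Z}"
      by (simp only: mem_Collect_eq key[of q c, OF 1(3) g] key[of q' c', OF 2(3) g])
  qed
  also have "\<dots> \<longleftrightarrow> case_sum c' p' \<in> Z"
    by (rule clim_tuple[OF 2(1,2) Z, symmetric])
  finally show "case_sum c p \<in> Z \<longleftrightarrow> case_sum c' p' \<in> Z" .
qed

lemma clim_unique: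
  assumes "clim C w q p" "clim C w q p'"
  shows "tequiv (C <+> N) (case_sum id p) (case_sum id p')"
  by (rule tequivI) (simp only: clim_id[OF assms(1)] clim_id[OF assms(2)])

definition copy :: "('m \<Rightarrow> 'm) \<Rightarrow> bool" where
  "copy p \<longleftrightarrow> (\<exists>\<tau> \<in> AutA. \<forall>x \<in> N. p x = \<tau> x)"

lemma copyE: assumes "copy p" obtains \<tau> where "\<tau> \<in> AutA" "\<forall>x \<in> N. p x = \<tau> x"
  using assms unfolding copy_def by (rule bexE) (rule that)

lemma copy_AutA: "\<tau> \<in> AutA \<Longrightarrow> copy \<tau>"
  unfolding copy_def by blast

lemma copy_id: "copy id"
  by (rule copy_AutA[OF AutA_id])

lemma copy_tequiv: "copy p \<Longrightarrow> tequiv N p id"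
proof (erule copyE)
  fix \<tau> assume \<tau>: "\<tau> \<in> AutA" "\<forall>x \<in> N. p x = \<tau> x"
  have "tequiv N p \<tau>"
    using \<tau>(2) by (intro tequiv_agree) simp
  moreover have "tequiv N \<tau> id"
    using aut_tequiv[OF AutA_aut[OF \<tau>(1)], of N id] by simp
  ultimately show ?thesis by (rule tequiv_trans)
qed

lemma copyI:
  assumes eq: "tequiv N p id"
    and E: "\<And>a E. (a, E) \<in> A \<Longrightarrow> (a, app p a) \<in> E"
  shows "copy p"
proof -
  obtain \<tau> where \<tau>: "\<tau> \<in> Aut" "\<forall>x \<in> N. \<tau> (id x) = p x"
    by (rule homogeneous[OF small_N tequiv_sym[OF eq]])
  have "\<tau> \<in> AutA"
  proof (rule AutAI[OF \<tau>(1)])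
    fix a E assume aE: "(a, E) \<in> A"
    have "app \<tau> a = app p a"
      using \<tau>(2) ran_reps[OF aE] reps_N by (intro app_cong) auto
    then show "(a, app \<tau> a) \<in> E"
      using E[OF aE] by simp
  qed
  moreover have "\<forall>x \<in> N. p x = \<tau> x"
    using \<tau>(2) by simp
  ultimately show ?thesis
    unfolding copy_def by blast
qed

text \<open>The relation \<open>a E q(a)\<close> passes to limits because \<open>E\<close> is type-definable.\<close>

lemma clim_copy:
  assumes clim: "clim C w q p" and C: "N \<subseteq> C" and w: "w \<in> ultras" and q: "copy q"
  shows "copy p"
proof (rule copyI)
  obtain \<sigma> where \<sigma>: "\<sigma> \<in> AutA" "\<forall>x \<in> N. q x = \<sigma> x"
    by (rule copyE[OF q])
  have q_eq: "(q \<circ> g) x = (\<sigma> \<circ> g) x" if "g \<in> self_maps N" "x \<in> N" for g x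
    using \<sigma>(2) self_mapsD(2)[OF that] by simp
  show "tequiv N p id"
  proof (rule tequivI)
    fix Z :: "('m \<Rightarrow> 'm) set" assume Z: "df N Z"
    have "df ({} <+> N) {k. k \<circ> Inr \<in> Z}"
      by (rule df_vimage[OF Z]) blast
    from clim_tuple[OF clim _ this, of id] have "p \<in> Z \<longleftrightarrow> w {g. q \<circ> g \<in> Z}"
      by (simp add: comp_def)
    also have "\<dots> \<longleftrightarrow> w {g. id \<in> Z}"
    proof (rule ultra_cong[OF ultrasD[OF w]])
      fix g assume g: "g \<in> self_maps N"
      have "q \<circ> g \<in> Z \<longleftrightarrow> \<sigma> \<circ> g \<in> Z"
        using q_eq[OF g] by (rule df_agree[OF Z])
      also have "\<dots> \<longleftrightarrow> id \<in> Z"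
        using aut_df[OF AutA_aut[OF AutA_comp[OF \<sigma>(1) self_mapsD(1)[OF g]]] Z, of id] by simp
      finally show "g \<in> {g. q \<circ> g \<in> Z} \<longleftrightarrow> g \<in> {g. id \<in> Z}"
        by simp
    qed
    also have "\<dots> \<longleftrightarrow> id \<in> Z"
      using ultra_UNIV[OF ultrasD(1)[OF w]] ultra_empty[OF ultrasD(1)[OF w]] by simp
    finally show "p \<in> Z \<longleftrightarrow> id \<in> Z" .
  qed
  fix a E assume aE: "(a, E) \<in> A"
  have ran: "ran a \<subseteq> N"
    using ran_reps[OF aE] reps_N by blast
  obtain \<Z> where \<Z>: "\<forall>Z \<in> \<Z>. df (ran a <+> ran a) Z"
    "\<forall>q. (a, app q a) \<in> E \<longleftrightarrow> (\<forall>Z \<in> \<Z>. case_sum id q \<in> Z)"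
    by (rule hyper_df[OF aE])
  have "case_sum id p \<in> Z" if Zin: "Z \<in> \<Z>" for Z
  proof -
    have Z: "df (C <+> N) Z"
      using bspec[OF \<Z>(1) Zin] by (rule df_mono) (use ran C in \<open>auto intro!: Plus_mono\<close>)
    have "case_sum id (q \<circ> g) \<in> Z" if g: "g \<in> self_maps N" for g
    proof -
      have "app (q \<circ> g) a = app (\<sigma> \<circ> g) a"
        using q_eq[OF g] ran by (intro app_cong) blast
      then have "(a, app (q \<circ> g) a) \<in> E"
        using AutAD[OF AutA_comp[OF \<sigma>(1) self_mapsD(1)[OF g]] aE] by simp
      then show ?thesis
        using \<Z>(2) Zin by blast
    qed
    then have "self_maps N \<subseteq> {g. case_sum id (q \<circ> g) \<in> Z}"
      by blast
    then have "w {g. case_sum id (q \<circ> g) \<in> Z}"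
      by (rule ultra_mono[OF ultrasD[OF w]])
    then show ?thesis
      using clim_id[OF clim Z] by blast
  qed
  then show "(a, app p a) \<in> E"
    using \<Z>(2) by blast
qed

text \<open>Density gives the finite intersection property for sets of self-maps approximating
  \<open>g\<close>. An arbitrary conjugate of \<open>N\<close> is so brought within reach of
  \<open>u_inv\<close>.\<close>

lemma AutA_clim:
  assumes g: "g \<in> AutA"
  obtains w where "w \<in> ultras" "clim N w id g"
proof -
  let ?P = "\<lambda>Z. {\<gamma> \<in> self_maps N. case_sum id \<gamma> \<in> Z}"
  let ?\<Z> = "{Z :: ('m + 'm \<Rightarrow> 'm) set. df (N <+> N) Z \<and> case_sum id g \<in> Z}"
  have "\<exists>w. ultra w \<and> (\<forall>S \<in> ?P ` ?\<Z>. w S)"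
  proof (rule ultra_extension)
    fix G assume "finite G" "G \<subseteq> ?P ` ?\<Z>"
    then obtain \<Q> where \<Q>: "finite \<Q>" "\<Q> \<subseteq> ?\<Z>" "G = ?P ` \<Q>"
      by (metis (no_types, lifting) finite_subset_image)
    have "df (N <+> N) (\<Inter> \<Q>)"
      using \<Q> by (intro df_Inter) auto
    moreover have "case_sum id g \<in> \<Inter> \<Q>"
      using \<Q>(2) by auto
    ultimately obtain \<gamma> where "\<gamma> \<in> self_maps N" "case_sum id \<gamma> \<in> \<Inter> \<Q>"
      using orbit_step_dense[OF step_N _ g] by blast
    then have "\<gamma> \<in> \<Inter> G"
      unfolding \<Q>(3) by auto
    then show "\<Inter> G \<noteq> {}" by blast
  qed
  then obtain w where w: "ultra w \<and> (\<forall>S \<in> ?P ` ?\<Z>. w S)"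
    by (rule exE)
  have UP: "w (?P Z)" if "Z \<in> ?\<Z>" for Z
    using w that by blast
  note uw = conjunct1[OF w]
  have 1: "w {\<gamma>. case_sum id \<gamma> \<in> Z}" if "Z \<in> ?\<Z>" for Z
    by (rule ultra_mono[OF uw UP[OF that]]) blast
  show ?thesis
  proof (rule that)
    have "UNIV \<in> ?\<Z>" using df_UNIV by blast
    from UP[OF this] show "w \<in> ultras"
      using uw by (simp add: ultras_def)
    show "clim N w id g"
    proof (rule climI)
      fix Z :: "('m + 'm \<Rightarrow> 'm) set" assume Z: "df (N <+> N) Z"
      show "case_sum id g \<in> Z \<longleftrightarrow> w {\<gamma>. case_sum id (id \<circ> \<gamma>) \<in> Z}"
        unfolding id_comp
      proof (cases "case_sum id g \<in> Z")
        case True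
        then show "case_sum id g \<in> Z \<longleftrightarrow> w {\<gamma>. case_sum id \<gamma> \<in> Z}" using 1 Z by blast
      next
        case False
        then have "w {h. case_sum id h \<in> - Z}"
          using Z df_Compl by (intro 1) blast
        moreover have "{h. case_sum id h \<in> - Z} = - {h. case_sum id h \<in> Z}"
          by blast
        ultimately show "case_sum id g \<in> Z \<longleftrightarrow> w {\<gamma>. case_sum id \<gamma> \<in> Z}"
          using False by (simp add: ultra_Compl[OF uw])
      qed
    qed
  qed
qed

end

section \<open>Ultraimaginaries fixed by two consecutive copies\<close>

locale base_im = base L M T \<kappa> A N u + ultra_im L M T \<kappa> c F
  for L :: "('f, 'r) lang" and M :: "('f, 'r, 'm) struc" and T and \<kappa> :: "'k rel"
    and A :: "('k, 'm) imaginary set" and N u c F +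
  fixes n1 :: "'m \<Rightarrow> 'm"
  assumes n1: "clim N u id n1"
    and fix0: "\<And>\<sigma>. \<sigma> \<in> fixer N \<Longrightarrow> eqv id \<sigma>"
    and fix1: "\<And>\<sigma>. \<sigma> \<in> fixer (n1 ` N) \<Longrightarrow> eqv id \<sigma>"
begin

text \<open>By \<open>fix0\<close>, the conjugate of the ultraimaginary can be read off the copy of
  \<open>N\<close>; one may thus speak of its value at a copy.\<close>

lemma eqv_agree:
  assumes "\<sigma> \<in> Aut" "\<tau> \<in> Aut" "\<And>x. x \<in> N \<Longrightarrow> \<sigma> x = \<tau> x"
  shows "eqv \<sigma> \<tau>"
proof -
  have "eqv id (inv \<tau> \<circ> \<sigma>)"
    by (rule fix0[OF fixer_comp_inv[OF assms]])
  then have "eqv (\<tau> \<circ> id) (\<tau> \<circ> (inv \<tau> \<circ> \<sigma>))"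
    by (simp only: eqv_comp[OF assms(2)])
  then have "eqv \<tau> \<sigma>"
    by (simp only: comp_assoc[symmetric] aut_inv_comp(1)[OF assms(2)] id_comp comp_id)
  then show ?thesis by (rule eqv_sym)
qed

lemma lift_pair:
  assumes "tequiv (N <+> N) (case_sum p q) (case_sum p' q')"
  obtains \<rho> where "\<rho> \<in> Aut" "\<forall>x \<in> N. \<rho> (p x) = p' x" "\<forall>x \<in> N. \<rho> (q x) = q' x"
proof -
  obtain \<rho> where \<rho>: "\<rho> \<in> Aut" "\<forall>v \<in> N <+> N. \<rho> (case_sum p q v) = case_sum p' q' v"
    by (rule homogeneous[OF small_Plus[OF small_N small_N] assms])
  show ?thesis
  proof (rule that[OF \<rho>(1)])
    show "\<forall>x \<in> N. \<rho> (p x) = p' x"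
      using bspec[OF \<rho>(2) InlI] by simp
    show "\<forall>x \<in> N. \<rho> (q x) = q' x"
      using bspec[OF \<rho>(2) InrI] by simp
  qed
qed

text \<open>Let \<open>n2\<close> be one more \<open>u\<close>-step after \<open>n1\<close>. By
  idempotence, the pairs (\<open>id\<close>, \<open>n1\<close>), (\<open>id\<close>,
  \<open>n2\<close>) and (\<open>n1\<close>, \<open>n2\<close>) have the same type. Hence the
  ultraimaginary is also fixed over \<open>n2\<close>, and some automorphism fixing
  \<open>n2\<close> moves \<open>N\<close> to \<open>n1\<close>.\<close>

lemma eqv_n1:
  assumes g: "g \<in> AutA" "\<forall>x \<in> N. n1 x = g x"
  shows "eqv id g"
proof -
  have "small (N \<union> n1 ` N)"
    by (intro small_Un small_image small_N)
  then obtain n2 where n2: "clim (N \<union> n1 ` N) u n1 n2"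
    by (rule clim_exists[OF u_ultras])
  have n2': "clim N u id n2"
    using clim_comp[OF n1 n2 _ u_ultras] u_idem by simp
  have "tequiv (N <+> N) (case_sum id n1) (case_sum id n2)"
    by (rule clim_unique[OF n1 n2'])
  then obtain \<rho> where \<rho>: "\<rho> \<in> Aut" "\<forall>x \<in> N. \<rho> (id x) = id x" "\<forall>x \<in> N. \<rho> (n1 x) = n2 x"
    by (rule lift_pair)
  have \<rho>1: "eqv id \<rho>"
    using \<rho> by (intro fix0 fixerI) simp_all
  have fix2: "eqv id \<sigma>" if \<sigma>: "\<sigma> \<in> fixer (n2 ` N)" for \<sigma>
  proof -
    have "inv \<rho> \<circ> (\<sigma> \<circ> \<rho>) \<in> fixer (n1 ` N)"
    proof (rule fixer_comp_inv[OF aut_comp[OF fixer_aut[OF \<sigma>] \<rho>(1)] \<rho>(1)])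
      fix y assume "y \<in> n1 ` N"
      then obtain x where "x \<in> N" "y = n1 x" by (rule imageE)
      then have "\<rho> y \<in> n2 ` N"
        using \<rho>(3) by simp
      then show "(\<sigma> \<circ> \<rho>) y = \<rho> y"
        using fixerD[OF \<sigma>] by simp
    qed
    then have "eqv id (inv \<rho> \<circ> (\<sigma> \<circ> \<rho>))"
      by (rule fix1)
    then have "eqv (\<rho> \<circ> id) (\<rho> \<circ> (inv \<rho> \<circ> (\<sigma> \<circ> \<rho>)))"
      by (simp only: eqv_comp[OF \<rho>(1)])
    then have "eqv \<rho> (\<sigma> \<circ> \<rho>)"
      unfolding comp_assoc[symmetric, of \<rho> "inv \<rho>"] aut_inv_comp(1)[OF \<rho>(1)] id_comp comp_id .
    moreover have "eqv (\<sigma> \<circ> id) (\<sigma> \<circ> \<rho>)"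
      using \<rho>1 by (simp only: eqv_comp[OF fixer_aut[OF \<sigma>]])
    ultimately have "eqv \<rho> \<sigma>"
      unfolding comp_id by (rule eqv_trans[OF _ eqv_sym])
    with \<rho>1 show ?thesis by (rule eqv_trans)
  qed
  have cn1: "copy n1"
    by (rule clim_copy[OF n1 order_refl u_ultras copy_id])
  have "tequiv (N <+> N) (case_sum id n1) (case_sum n1 n2)"
    by (rule clim_transfer[OF n1 _ _ n2, where e = id])
       (use copy_tequiv[OF cn1] u_ultras in \<open>auto intro: tequiv_sym\<close>)
  moreover have "tequiv (N <+> N) (case_sum id n2) (case_sum id n1)"
    by (rule clim_unique[OF n2' n1])
  ultimately have "tequiv (N <+> N) (case_sum id n2) (case_sum n1 n2)"
    by (rule tequiv_trans[rotated])
  then obtain \<rho>' where \<rho>': "\<rho>' \<in> Aut" "\<forall>x \<in> N. \<rho>' (id x) = n1 x" "\<forall>x \<in> N. \<rho>' (n2 x) = n2 x"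
    by (rule lift_pair)
  have "eqv id \<rho>'"
    using \<rho>' by (intro fix2 fixerI) auto
  moreover have "eqv \<rho>' g"
    using \<rho>' g by (intro eqv_agree AutA_aut[OF g(1)]) simp_all
  ultimately show ?thesis by (rule eqv_trans)
qed

lemma eqv_consecutive:
  assumes \<sigma>: "\<sigma> \<in> AutA" and \<tau>: "\<tau> \<in> AutA" and p: "\<forall>x \<in> N. p x = \<sigma> x" and q: "\<forall>x \<in> N. q x = \<tau> x"
    and eq: "tequiv (N <+> N) (case_sum id n1) (case_sum p q)"
  shows "eqv \<sigma> \<tau>"
proof -
  obtain g where g: "g \<in> AutA" "\<forall>x \<in> N. n1 x = g x"
    by (rule copyE[OF clim_copy[OF n1 order_refl u_ultras copy_id]])
  obtain h where h: "h \<in> Aut" "\<forall>x \<in> N. h (id x) = p x" "\<forall>x \<in> N. h (n1 x) = q x"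
    by (rule lift_pair[OF eq])
  have "eqv \<sigma> h"
    using h p by (intro eqv_agree AutA_aut[OF \<sigma>]) simp_all
  also have "eqv (h \<circ> id) (h \<circ> g)"
    unfolding eqv_comp[OF h(1)] by (rule eqv_n1[OF g])
  then have "eqv h (h \<circ> g)" by simp
  finally (eqv_trans) have "eqv \<sigma> (h \<circ> g)" .
  moreover have "eqv (h \<circ> g) \<tau>"
    using h g q by (intro eqv_agree aut_comp AutA_aut[OF \<tau>] AutA_aut[OF g(1)]) simp_all
  ultimately show ?thesis by (rule eqv_trans)
qed

text \<open>After one more \<open>u\<close>-step from \<open>p\<close> to \<open>r\<close>,
  \<open>vwu\<close> makes \<open>r\<close> a direct \<open>u\<close>-step from the identity. The
  value at \<open>r\<close> thus equals both the value at \<open>p\<close> and that at the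
  identity.\<close>

lemma eqv_clim:
  assumes v: "v \<in> ultras" and w: "w \<in> ultras" and vwu: "v \<star> (w \<star> u) = u"
    and q: "clim N v id q" and p: "clim D w q p" and D: "N \<union> q ` N \<subseteq> D" "small D"
    and \<tau>: "\<tau> \<in> AutA" "\<forall>x \<in> N. p x = \<tau> x"
  shows "eqv id \<tau>"
proof -
  have "small (D \<union> p ` N)"
    by (intro small_Un small_image small_N D)
  then obtain r where r: "clim (D \<union> p ` N) u p r"
    by (rule clim_exists[OF u_ultras])
  have cp: "copy p"
    unfolding copy_def using \<tau> by blast
  obtain \<rho> where \<rho>: "\<rho> \<in> AutA" "\<forall>x \<in> N. r x = \<rho> x"
    by (rule copyE[OF clim_copy[OF r _ u_ultras cp]]) (use D in blast)
  have "clim N (v \<star> w) id p"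
    by (rule clim_comp[OF q p _ w]) (use D in blast)
  then have "clim N ((v \<star> w) \<star> u) id r"
    by (rule clim_comp[OF _ r _ u_ultras]) (use D in blast)
  moreover have "(v \<star> w) \<star> u = u"
    using vwu by (simp add: fun_eq_iff ultra_comp_def comp_assoc)
  ultimately have "clim N u id r" by simp
  then have "eqv id \<rho>"
    by (intro eqv_consecutive[OF AutA_id \<rho>(1) _ \<rho>(2), of id] clim_unique[OF n1]) simp_all
  moreover have "tequiv (N <+> N) (case_sum id n1) (case_sum p r)"
    by (rule clim_transfer[OF n1 _ _ r, where e = id])
       (use copy_tequiv[OF cp] u_ultras in \<open>auto intro: tequiv_sym\<close>)
  then have "eqv \<tau> \<rho>"
    by (rule eqv_consecutive[OF \<tau>(1) \<rho>(1) \<tau>(2) \<rho>(2)])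
  ultimately show ?thesis
    by (rule eqv_trans[OF _ eqv_sym])
qed

text \<open>
  As \<open>v * w * u = u\<close> for some \<open>v\<close>, the ultraimaginary does not change along a step of type \<open>v\<close> followed by
  one of type \<open>w\<close>. Two steps of type \<open>w\<close> from the same copy thus lead to equal ultraimaginaries.
\<close>

lemma eqv_type:
  assumes g: "g \<in> AutA" and g': "g' \<in> AutA"
    and eq: "tequiv (N <+> N) (case_sum id g) (case_sum id g')"
  shows "eqv g g'"
proof -
  obtain w where w: "w \<in> ultras" "clim N w id g"
    by (rule AutA_clim[OF g])
  have "clim N w id g'"
  proof (rule climI)
    fix Z :: "('m + 'm \<Rightarrow> 'm) set" assume Z: "df (N <+> N) Z"
    show "case_sum id g' \<in> Z \<longleftrightarrow> w {\<gamma>. case_sum id (id \<circ> \<gamma>) \<in> Z}"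
      using tequivD[OF eq Z] clim_id[OF w(2) Z] by blast
  qed
  note wg = w(2) this
  obtain v where v: "v \<in> ultras" "v \<star> (w \<star> u) = u"
    using u_inv[OF ultrasD[OF w(1)]] unfolding ultras_def by blast
  obtain q where q: "clim N v id q"
    by (rule clim_exists[OF v(1) small_N])
  have cq: "copy q"
    by (rule clim_copy[OF q order_refl v(1) copy_id])
  define D where "D = N \<union> q ` N"
  have D: "small D"
    unfolding D_def by (intro small_Un small_image small_N)
  obtain p where p: "clim D w q p"
    by (rule clim_exists[OF w(1) D])
  define D' where "D' = D \<union> p ` N"
  have D': "small D'"
    unfolding D'_def by (intro small_Un small_image small_N D)
  obtain p' where p': "clim D' w q p'"
    by (rule clim_exists[OF w(1) D'])
  obtain \<tau> where \<tau>: "\<tau> \<in> AutA" "\<forall>x \<in> N. p x = \<tau> x"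
    by (rule copyE[OF clim_copy[OF p _ w(1) cq]]) (simp add: D_def)
  obtain \<tau>' where \<tau>': "\<tau>' \<in> AutA" "\<forall>x \<in> N. p' x = \<tau>' x"
    by (rule copyE[OF clim_copy[OF p' _ w(1) cq]]) (auto simp: D_def D'_def)
  have x: "eqv id \<tau>"
    by (rule eqv_clim[OF v(1) w(1) v(2) q p _ D \<tau>]) (simp add: D_def)
  have x': "eqv id \<tau>'"
    by (rule eqv_clim[OF v(1) w(1) v(2) q p' _ D' \<tau>']) (auto simp: D_def D'_def)
  \<comment> \<open>\<open>s\<close> is a step of type \<open>w\<close> from the identity over both
    \<open>g\<close> and \<open>g'\<close>, a common term of comparison for the two.\<close>
  define C where "C = N \<union> g ` N \<union> g' ` N"
  have "small C"
    unfolding C_def by (intro small_Un small_image small_N)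
  then obtain s where s: "clim C w id s"
    by (rule clim_exists[OF w(1)])
  obtain \<pi> where \<pi>: "\<pi> \<in> AutA" "\<forall>x \<in> N. s x = \<pi> x"
    by (rule copyE[OF clim_copy[OF s _ w(1) copy_id]]) (auto simp: C_def)
  \<comment> \<open>The triple (\<open>q\<close>, \<open>p\<close>, \<open>p'\<close>) has the type
    of (\<open>id\<close>, \<open>k\<close>, \<open>s\<close>). The values at \<open>p\<close> and
    \<open>p'\<close> agree, both being the original one, so those at \<open>k\<close> and
    \<open>s\<close> agree as well.\<close>
  have main: "eqv k \<pi>" if k: "k \<in> AutA" "clim N w id k" "k ` N \<subseteq> C" for k
  proof -
    have "tequiv (N <+> N) (case_sum q p) (case_sum id k)"
      by (rule clim_transfer[OF p _ _ k(2), where e = id])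
         (use copy_tequiv[OF cq] w(1) in \<open>auto simp: D_def\<close>)
    then have "tequiv ((N <+> N) <+> N) (case_sum (case_sum q p) p') (case_sum (case_sum id k) s)"
      by (intro clim_transfer[OF p' _ _ s, where e = Inl])
         (use k(3) w(1) in \<open>auto simp: D_def D'_def C_def\<close>)
    then obtain h where h: "h \<in> Aut" "\<forall>y \<in> (N <+> N) <+> N.
        h (case_sum (case_sum q p) p' y) = case_sum (case_sum id k) s y"
      by (rule homogeneous[OF small_Plus[OF small_Plus[OF small_N small_N] small_N]])
    have hp: "h (p x) = k x" "h (p' x) = s x" if "x \<in> N" for x
      using bspec[OF h(2), of "Inl (Inr x)"] bspec[OF h(2), of "Inr x"] that by auto
    have "eqv (h \<circ> \<tau>) k"
      using hp(1) \<tau>(2) by (intro eqv_agree aut_comp h(1) AutA_aut \<tau>(1) k(1)) simp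
    moreover have "eqv (h \<circ> \<tau>') \<pi>"
      using hp(2) \<tau>'(2) \<pi>(2) by (intro eqv_agree aut_comp h(1) AutA_aut \<tau>'(1) \<pi>(1)) simp
    moreover have "eqv (h \<circ> id) (h \<circ> \<tau>)" "eqv (h \<circ> id) (h \<circ> \<tau>')"
      unfolding eqv_comp[OF h(1)] by (rule x, rule x')
    ultimately show ?thesis
      by (meson eqv_sym eqv_trans)
  qed
  have "eqv g \<pi>"
    by (rule main[OF g wg(1)]) (auto simp: C_def)
  moreover have "eqv g' \<pi>"
    by (rule main[OF g' wg(2)]) (auto simp: C_def)
  ultimately show ?thesis
    by (rule eqv_trans[OF _ eqv_sym])
qed

theorem bounded_orbit: "small (orb AutA)"
proof -
  \<comment> \<open>A set of codes determines the type over \<open>N\<close> of the conjugate of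
    \<open>N\<close>; there are at most as many types as subsets of a small set.\<close>
  define tp where "tp g = {(\<phi>, vs). (\<phi>, vs) \<in> WF \<times> lists (N <+> N) \<and> sat M (\<lambda>i. case_sum id g (vs ! i)) \<phi>}"
    for g :: "'m \<Rightarrow> 'm"
  have tp_eq: "eqv g g'" if "g \<in> AutA" "g' \<in> AutA" "tp g = tp g'" for g g'
  proof (rule eqv_type[OF that(1,2)], rule tequivI)
    fix Z :: "('m + 'm \<Rightarrow> 'm) set" assume Z: "df (N <+> N) Z"
    show "case_sum id g \<in> Z \<longleftrightarrow> case_sum id g' \<in> Z"
    proof (rule df_list[OF Z])
      fix \<phi> vs
      assume \<phi>: "wf_fm L \<phi>" "set vs \<subseteq> N <+> N" "fv \<phi> \<subseteq> {..<length vs}"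
        "\<And>h. h \<in> Z \<longleftrightarrow> sat M (\<lambda>i. h (vs ! i)) \<phi>"
      have "(\<phi>, vs) \<in> tp k \<longleftrightarrow> case_sum id k \<in> Z" for k
        using \<phi>(1,2) unfolding \<phi>(4) by (auto simp: tp_def)
      then show ?thesis using that(3) by blast
    qed
  qed
  define pick where "pick t = (SOME g. g \<in> AutA \<and> tp g = t)" for t
  have "orb AutA \<subseteq> (\<lambda>t. F `` {app (pick t) c}) ` Pow (WF \<times> lists (N <+> N))"
  proof
    fix z assume "z \<in> orb AutA"
    then obtain g where g: "g \<in> AutA" "z = F `` {app g c}"
      unfolding orb_def by (rule imageE)
    have "pick (tp g) \<in> AutA \<and> tp (pick (tp g)) = tp g"
      unfolding pick_def by (rule someI[of "\<lambda>h. h \<in> AutA \<and> tp h = tp g" g]) (simp add: g(1))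
    then have "eqv g (pick (tp g))"
      by (intro tp_eq g(1)) simp_all
    then have "z = F `` {app (pick (tp g)) c}"
      unfolding g(2) class_eq .
    moreover have "tp g \<in> Pow (WF \<times> lists (N <+> N))"
      unfolding tp_def by blast
    ultimately show "z \<in> (\<lambda>t. F `` {app (pick t) c}) ` Pow (WF \<times> lists (N <+> N))"
      by (rule image_eqI)
  qed
  moreover have "small (Pow (WF \<times> lists (N <+> N)))"
    by (intro small_Pow small_Times small_WF small_lists small_Plus small_N)
  ultimately show ?thesis
    using small_subset[OF small_image] by blast
qed

end

section \<open>The sequence of copies\<close>

context base
begin

lemma seq_exists:
  obtains n :: "nat \<Rightarrow> 'm \<Rightarrow> 'm" where "n 0 = id" "\<forall>k. clim (N \<union> (\<Union>i \<le> k. n i ` N)) u (n k) (n (Suc k))"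
proof -
  define P where "P f k r \<longleftrightarrow> (case k of 0 \<Rightarrow> r = id | Suc j \<Rightarrow> clim (N \<union> (\<Union>i \<le> j. f i ` N)) u (f j) r)"
    for f :: "nat \<Rightarrow> 'm \<Rightarrow> 'm" and k r
  have "\<exists>f. \<forall>k. P f k (f k)"
  proof (rule dependent_wf_choice[OF wf_less])
    fix f g :: "nat \<Rightarrow> 'm \<Rightarrow> 'm" and k r
    assume fg: "\<And>z. (z, k) \<in> {(x, y). x < y} \<Longrightarrow> f z = g z"
    show "P f k r = P g k r"
    proof (cases k)
      case (Suc j)
      have "f i = g i" if "i \<le> j" for i
        using fg[of i] that Suc by simp
      then have "f j = g j" "(\<Union>i \<le> j. f i ` N) = (\<Union>i \<le> j. g i ` N)"
        by simp_all
      then show ?thesis by (simp only: P_def Suc nat.case)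
    qed (simp add: P_def)
  next
    fix k f
    show "\<exists>r. P f k r"
    proof (cases k)
      case (Suc j)
      have "small (N \<union> (\<Union>i \<in> {..j}. f i ` N))"
        by (intro small_Un small_N small_UN_image small_finite) simp
      then obtain r where "clim (N \<union> (\<Union>i \<in> {..j}. f i ` N)) u (f j) r"
        by (rule clim_exists[OF u_ultras])
      then show ?thesis
        unfolding P_def Suc nat.case by blast
    qed (simp add: P_def)
  qed
  then obtain f where f: "\<forall>k. P f k (f k)"
    by (rule exE)
  show ?thesis
  proof (rule that)
    show "f 0 = id"
      using spec[OF f, of 0] by (simp add: P_def)
    show "\<forall>k. clim (N \<union> (\<Union>i \<le> k. f i ` N)) u (f k) (f (Suc k))"
    proof
      fix k
      show "clim (N \<union> (\<Union>i \<le> k. f i ` N)) u (f k) (f (Suc k))"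
        using spec[OF f, of "Suc k"] unfolding P_def nat.case .
    qed
  qed
qed

end

locale copy_seq = base L M T \<kappa> A N u
  for L :: "('f, 'r) lang" and M :: "('f, 'r, 'm) struc" and T and \<kappa> :: "'k rel"
    and A :: "('k, 'm) imaginary set" and N u +
  fixes n :: "nat \<Rightarrow> 'm \<Rightarrow> 'm"
  assumes n_0: "n 0 = id" and n_Suc: "\<forall>k. clim (N \<union> (\<Union>i \<le> k. n i ` N)) u (n k) (n (Suc k))"
begin

definition below :: "nat \<Rightarrow> 'm set" where
  "below k = N \<union> (\<Union>i \<le> k. n i ` N)"

lemma n_below: "i \<le> k \<Longrightarrow> n i ` N \<subseteq> below k"
  unfolding below_def by blast

lemma below_mono: "i \<le> k \<Longrightarrow> below i \<subseteq> below k"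
  unfolding below_def by (intro Un_mono order_refl UN_mono) auto

text \<open>Here idempotence enters: a chain of \<open>u\<close>-steps is a \<open>u\<close>-step,
  over everything up to its starting point.\<close>

lemma n_clim: "y < x \<Longrightarrow> clim (below y) u (n y) (n x)"
proof (induction x)
  case (Suc x)
  have S: "clim (below x) u (n x) (n (Suc x))"
    using spec[OF n_Suc, of x] by (simp only: below_def)
  show ?case
  proof (cases "y = x")
    case True
    then show ?thesis using S by simp
  next
    case False
    then have "y < x" using Suc.prems by simp
    then have "clim (below y) (u \<star> u) (n y) (n (Suc x))"
      by (intro clim_comp[OF Suc.IH S below_mono u_ultras]) simp_all
    then show ?thesis by (simp only: u_idem)
  qed
qed simp

lemma n_copy: "copy (n i)"
proof (induction i)
  case 0
  show ?case by (simp only: n_0 copy_id)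
next
  case (Suc i)
  show ?case
    by (rule clim_copy[OF n_clim[of i "Suc i"] _ u_ultras Suc]) (simp_all add: below_def)
qed

abbreviation arr :: "('j \<Rightarrow> 'm \<Rightarrow> 'm) \<Rightarrow> 'j \<times> 'm \<Rightarrow> 'm" where
  "arr m \<equiv> \<lambda>(i, a). m i a"

text \<open>The last copy is a \<open>u\<close>-limit of the last but one over all earlier ones,
  whatever the gap between them, so its type over the others carries over by
  \<open>clim_transfer\<close>.\<close>

lemma n_indiscernible:
  fixes D :: "nat set"
  assumes "finite D" "\<forall>i \<in> D. \<forall>j \<in> D. i < j \<longrightarrow> f i < f j"
  shows "tequiv (D \<times> N) (arr n) (arr (\<lambda>i. n (f i)))"
  using assms
proof (induction D rule: finite_linorder_max_induct)
  case empty
  show ?case by (rule tequiv_agree) simp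
next
  case (insert x D)
  show ?case
  proof (cases "D = {}")
    case True
    have "tequiv N (n x) (n (f x))"
      by (rule tequiv_trans[OF copy_tequiv[OF n_copy] tequiv_sym[OF copy_tequiv[OF n_copy]]])
    then have 1: "tequiv ({x} \<times> N) (n x \<circ> snd) (n (f x) \<circ> snd)"
      by (rule tequiv_comp) auto
    have 2: "tequiv ({x} \<times> N) (arr n) (n x \<circ> snd)"
      by (rule tequiv_agree) auto
    have 3: "tequiv ({x} \<times> N) (n (f x) \<circ> snd) (arr (\<lambda>i. n (f i)))"
      by (rule tequiv_agree) auto
    have "tequiv ({x} \<times> N) (arr n) (arr (\<lambda>i. n (f i)))"
      by (rule tequiv_trans[OF tequiv_trans[OF 2 1] 3])
    then show ?thesis using True by simp
  next
    case False
    let ?V = "D \<times> N"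
    define y where "y = Max D"
    have y: "y \<in> D" "\<And>i. i \<in> D \<Longrightarrow> i \<le> y"
      using insert.hyps(1) False by (simp_all add: y_def)
    have f: "f i \<le> f y" if "i \<in> D" for i
    proof (cases "i = y")
      case False
      then have "i < y" using y(2)[OF that] by simp
      then show ?thesis using insert.prems that y(1) by (simp add: less_imp_le)
    qed simp
    have xy: "y < x" "f y < f x"
      using insert.hyps(2) insert.prems y(1) by auto
    have "tequiv ?V (arr n) (arr (\<lambda>i. n (f i)))"
      using insert.prems by (intro insert.IH) simp
    then have "tequiv (?V <+> N) (case_sum (arr n) (n x)) (case_sum (arr (\<lambda>i. n (f i))) (n (f x)))"
    proof (rule clim_transfer[OF n_clim[OF xy(1)] _ _ n_clim[OF xy(2)], where e = "Pair y", rotated -1])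
      show "arr n ` ?V \<subseteq> below y"
        using y(2) n_below by fastforce
      show "arr (\<lambda>i. n (f i)) ` ?V \<subseteq> below (f y)"
        using f n_below by fastforce
    qed (use y(1) u_ultras in auto)
    then have "tequiv (insert x D \<times> N)
        (case_sum (arr n) (n x) \<circ> (\<lambda>(i, a). if i = x then Inr a else Inl (i, a)))
        (case_sum (arr (\<lambda>i. n (f i))) (n (f x)) \<circ> (\<lambda>(i, a). if i = x then Inr a else Inl (i, a)))"
      by (rule tequiv_comp) auto
    moreover have "case_sum (arr n) (n x) \<circ> (\<lambda>(i, a). if i = x then Inr a else Inl (i, a)) = arr n"
      "case_sum (arr (\<lambda>i. n (f i))) (n (f x)) \<circ> (\<lambda>(i, a). if i = x then Inr a else Inl (i, a)) =
        arr (\<lambda>i. n (f i))"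
      by (auto simp: fun_eq_iff)
    ultimately show ?thesis by (simp only:)
  qed
qed

text \<open>A definable condition on copies up to \<open>Suc l\<close> remains true when the last
  copy is replaced by \<open>n l \<circ> \<gamma>\<close>, for \<open>u\<close>-many self-maps
  \<gamma>. Repeating this pushes all copies above \<open>k\<close> down into
  \<open>n k\<close>.\<close>

lemma n_fin_sat_aux:
  assumes "df ({..l} \<times> N) Z" "arr n \<in> Z"
  shows "\<exists>\<rho>. (\<forall>i. \<forall>a \<in> N. \<rho> i a \<in> N) \<and> arr (\<lambda>i a. if i \<le> k then n i a else n k (\<rho> i a)) \<in> Z"
  using assms
proof (induction l arbitrary: Z)
  case 0
  have "arr (\<lambda>i a. if i \<le> k then n i a else n k a) \<in> Z"
    using 0(2) df_agree[OF 0(1), of "arr n" "arr (\<lambda>i a. if i \<le> k then n i a else n k a)"] by auto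
  then show ?case
    by (intro exI[of _ "\<lambda>i a. a"]) simp
next
  case (Suc l)
  show ?case
  proof (cases "l < k")
    case True
    have "arr (\<lambda>i a. if i \<le> k then n i a else n k a) \<in> Z"
      using Suc.prems(2) True
        df_agree[OF Suc.prems(1), of "arr n" "arr (\<lambda>i a. if i \<le> k then n i a else n k a)"] by auto
    then show ?thesis
      by (intro exI[of _ "\<lambda>i a. a"]) simp
  next
    case False
    let ?r = "\<lambda>(i, a). if i = Suc l then Inr a else Inl (i, a)"
    have df1: "df (({..l} \<times> N) <+> N) {h. h \<circ> ?r \<in> Z}"
      by (rule df_vimage[OF Suc.prems(1)]) (auto simp: le_Suc_eq)
    have "case_sum (arr n) (n (Suc l)) \<circ> ?r = arr n"
      by (auto simp: fun_eq_iff)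
    then have "case_sum (arr n) (n (Suc l)) \<in> {h. h \<circ> ?r \<in> Z}"
      using Suc.prems(2) by simp
    moreover have "arr n ` ({..l} \<times> N) \<subseteq> below l"
      using n_below by fastforce
    ultimately have "u {\<gamma>. case_sum (arr n) (n l \<circ> \<gamma>) \<in> {h. h \<circ> ?r \<in> Z}}"
      using clim_tuple[OF n_clim[OF lessI] _ df1] by blast
    then have "u (self_maps N \<inter> {\<gamma>. case_sum (arr n) (n l \<circ> \<gamma>) \<in> {h. h \<circ> ?r \<in> Z}})"
      using u_self by (simp add: ultra_Int[OF ultra_u])
    then obtain \<gamma> where \<gamma>: "\<gamma> \<in> self_maps N" "case_sum (arr n) (n l \<circ> \<gamma>) \<circ> ?r \<in> Z"
      using ultra_nonempty[OF ultra_u] by blast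
    let ?s = "\<lambda>(i, a). if i = Suc l then (l, \<gamma> a) else (i, a)"
    have "df ({..l} \<times> N) {h. h \<circ> ?s \<in> Z}"
      using self_mapsD(2)[OF \<gamma>(1)] by (intro df_vimage[OF Suc.prems(1)]) (auto simp: le_Suc_eq)
    moreover have "arr n \<circ> ?s = case_sum (arr n) (n l \<circ> \<gamma>) \<circ> ?r"
      by (auto simp: fun_eq_iff)
    then have "arr n \<in> {h. h \<circ> ?s \<in> Z}"
      using \<gamma>(2) by (simp only: mem_Collect_eq)
    ultimately have "\<exists>\<rho>. (\<forall>i. \<forall>a \<in> N. \<rho> i a \<in> N) \<and>
        arr (\<lambda>i a. if i \<le> k then n i a else n k (\<rho> i a)) \<in> {h. h \<circ> ?s \<in> Z}"
      by (rule Suc.IH)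
    then obtain \<rho> where \<rho>': "(\<forall>i. \<forall>a \<in> N. \<rho> i a \<in> N) \<and>
        arr (\<lambda>i a. if i \<le> k then n i a else n k (\<rho> i a)) \<in> {h. h \<circ> ?s \<in> Z}"
      by (rule exE)
    note \<rho> = conjunct1[OF this] conjunct2[OF this, unfolded mem_Collect_eq]
    \<comment> \<open>If \<open>l \<le> k\<close> then \<open>l = k\<close>, and the replaced copy
      already lies in \<open>n k\<close>; otherwise copy \<open>l\<close> is pushed down further by
      \<rho>.\<close>
    define \<rho>' where "\<rho>' = \<rho>(Suc l := (\<lambda>a. if l \<le> k then \<gamma> a else \<rho> l (\<gamma> a)))"
    have "arr (\<lambda>i a. if i \<le> k then n i a else n k (\<rho>' i a)) \<in> Z \<longleftrightarrow>
        arr (\<lambda>i a. if i \<le> k then n i a else n k (\<rho> i a)) \<circ> ?s \<in> Z"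
    proof (rule df_agree[OF Suc.prems(1)])
      fix v assume "v \<in> {..Suc l} \<times> N"
      have "l = k" if "l \<le> k" using that False by simp
      then show "arr (\<lambda>i a. if i \<le> k then n i a else n k (\<rho>' i a)) v =
          (arr (\<lambda>i a. if i \<le> k then n i a else n k (\<rho> i a)) \<circ> ?s) v"
        using False by (cases v) (auto simp: \<rho>'_def)
    qed
    moreover have "\<forall>i. \<forall>a \<in> N. \<rho>' i a \<in> N"
      using \<rho>(1) self_mapsD(2)[OF \<gamma>(1)] by (simp add: \<rho>'_def)
    ultimately show ?thesis using \<rho>(2) by (intro exI[of _ \<rho>']) simp
  qed
qed

lemma n_fin_sat:
  assumes "finite D" "df (D \<times> N) Z" "arr n \<in> Z"
  shows "\<exists>\<rho>. (\<forall>i. \<forall>a \<in> N. \<rho> i a \<in> N) \<and> arr (\<lambda>i a. if i \<le> k then n i a else n k (\<rho> i a)) \<in> Z"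
proof -
  obtain l where "D \<subseteq> {..l}"
    using assms(1) finite_nat_iff_bounded_le by blast
  then have "df ({..l} \<times> N) Z"
    by (intro df_mono[OF assms(2)]) auto
  then show ?thesis using assms(3) by (rule n_fin_sat_aux)
qed

end

section \<open>Stretching to other order types\<close>

text \<open>Copies of \<open>N\<close> are sought along the order \<open>Q\<close>; at the places in
  \<open>P\<close> the image of \<open>b\<close> is prescribed by \<open>b'\<close>, at the others
  it is free. The assumption \<open>em\<close> is the equality of EM-types, for finite parts of
  \<open>Q\<close> embedded into the natural numbers.\<close>

locale stretch = copy_seq L M T \<kappa> A N u n
  for L :: "('f, 'r) lang" and M :: "('f, 'r, 'm) struc" and T and \<kappa> :: "'k rel"
    and A :: "('k, 'm) imaginary set" and N u n +
  fixes Q P :: "'j set" and lt :: "'j \<Rightarrow> 'j \<Rightarrow> bool" and b :: "('k, 'm) tuple" and b' :: "'j \<Rightarrow> ('k, 'm) tuple"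
  assumes small_Q: "small Q" and PQ: "P \<subseteq> Q" and small_b: "small (dom b)" and ran_b: "ran b \<subseteq> N"
    and irrefl: "\<not> lt i i"
    and trans: "i \<in> Q \<Longrightarrow> j \<in> Q \<Longrightarrow> k \<in> Q \<Longrightarrow> lt i j \<Longrightarrow> lt j k \<Longrightarrow> lt i k"
    and total: "i \<in> Q \<Longrightarrow> j \<in> Q \<Longrightarrow> i \<noteq> j \<Longrightarrow> lt i j \<or> lt j i"
    and em: "finite D \<Longrightarrow> D \<subseteq> Q \<Longrightarrow> \<forall>i \<in> D. \<forall>j \<in> D. lt i j \<longrightarrow> f i < f j \<Longrightarrow>
      \<exists>\<sigma> \<in> AutA. \<forall>i \<in> D \<inter> P. app \<sigma> (b' i) = app (n (f i)) b"
begin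

definition smono :: "'j set \<Rightarrow> ('j \<Rightarrow> nat) \<Rightarrow> bool" where
  "smono D f \<longleftrightarrow> (\<forall>i \<in> D. \<forall>j \<in> D. lt i j \<longrightarrow> f i < f j)"

lemma smonoD: "smono D f \<Longrightarrow> i \<in> D \<Longrightarrow> j \<in> D \<Longrightarrow> lt i j \<Longrightarrow> f i < f j"
  by (simp add: smono_def)

lemma smono_iff:
  assumes "smono D f" "D \<subseteq> Q" "i \<in> D" "j \<in> D"
  shows "f i < f j \<longleftrightarrow> lt i j"
  using assms(1,3,4) total[of i j] subsetD[OF assms(2)] smonoD[OF assms(1)] by (metis less_asym less_irrefl)

lemma smono_exists:
  assumes "finite D" "D \<subseteq> Q"
  obtains f where "smono D f"
proof
  show "smono D (\<lambda>i. card {j \<in> D. lt j i})"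
    unfolding smono_def
  proof (intro ballI impI)
    fix i j assume ij: "i \<in> D" "j \<in> D" "lt i j"
    have "{k \<in> D. lt k i} \<subset> {k \<in> D. lt k j}"
      using ij irrefl trans[OF subsetD[OF assms(2)] subsetD[OF assms(2)] subsetD[OF assms(2)]] by blast
    then show "card {k \<in> D. lt k i} < card {k \<in> D. lt k j}"
      using assms(1) by (intro psubset_card_mono) simp_all
  qed
qed

lemma smono_tequiv:
  assumes D: "finite D" "D \<subseteq> Q" and f: "smono D f" and g: "smono D g"
  shows "tequiv (D \<times> N) (arr (\<lambda>i. n (f i))) (arr (\<lambda>i. n (g i)))"
proof -
  have inj: "inj_on f D"
  proof (rule inj_onI)
    fix i j assume ij: "i \<in> D" "j \<in> D" "f i = f j"
    then show "i = j"
      using smonoD[OF f, of i j] smonoD[OF f, of j i] total[OF subsetD[OF D(2)] subsetD[OF D(2)], of i j] by auto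
  qed
  define e where "e = g \<circ> inv_into D f"
  have e: "e (f i) = g i" if "i \<in> D" for i
    using that by (simp add: e_def inv_into_f_f[OF inj])
  have "tequiv (f ` D \<times> N) (arr n) (arr (\<lambda>i. n (e i)))"
  proof (rule n_indiscernible)
    show "finite (f ` D)" using D(1) by simp
    show "\<forall>x \<in> f ` D. \<forall>y \<in> f ` D. x < y \<longrightarrow> e x < e y"
    proof (intro ballI impI)
      fix x y assume "x \<in> f ` D" "y \<in> f ` D" "x < y"
      then obtain i j where ij: "i \<in> D" "j \<in> D" "x = f i" "y = f j" by blast
      then have "lt i j"
        using smono_iff[OF f D(2) ij(1,2)] \<open>x < y\<close> by simp
      then show "e x < e y"
        using smonoD[OF g ij(1,2)] by (simp add: ij e)
    qed
  qed
  then have "tequiv (D \<times> N) (arr n \<circ> map_prod f id) (arr (\<lambda>i. n (e i)) \<circ> map_prod f id)"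
    by (rule tequiv_comp) auto
  moreover have "tequiv (D \<times> N) (arr (\<lambda>i. n (e i)) \<circ> map_prod f id) (arr (\<lambda>i. n (g i)))"
    by (rule tequiv_agree) (auto simp: e)
  moreover have "arr n \<circ> map_prod f id = arr (\<lambda>i. n (f i))"
    by (auto simp: fun_eq_iff)
  ultimately show ?thesis
    by (metis tequiv_trans)
qed

lemma dom_b': "i \<in> P \<Longrightarrow> dom (b' i) = dom b"
proof -
  assume i: "i \<in> P"
  obtain \<sigma> where "\<sigma> \<in> AutA" "\<forall>j \<in> {i} \<inter> P. app \<sigma> (b' j) = app (n 0) b"
    using em[of "{i}" "\<lambda>_. 0"] i PQ irrefl by auto
  then have "dom (app \<sigma> (b' i)) = dom (app (n 0) b)"
    using i by simp
  then show ?thesis by simp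
qed

definition constants :: "'m set" where
  "constants = reps \<union> (\<Union>i \<in> P. (\<lambda>k. the (b' i k)) ` dom b)"

text \<open>Assignments that solve the problem on the finite part \<open>D\<close>. Since
  \<open>Inl x\<close> has value \<open>x\<close>, the prescribed tuples and the representatives of
  \<open>A\<close> can occur as constants in definable conditions.\<close>

definition approx :: "'j set \<Rightarrow> ('m + 'j \<times> 'm \<Rightarrow> 'm) set" where
  "approx D = {h. (\<forall>x. h (Inl x) = x) \<and>
     (\<exists>\<sigma> \<in> AutA. \<exists>f. smono D f \<and> (\<forall>i \<in> D. \<forall>a \<in> N. h (Inr (i, a)) = \<sigma> (n (f i) a))) \<and>
     (\<forall>i \<in> D \<inter> P. b' i = app (\<lambda>a. h (Inr (i, a))) b)}"

lemma approx_nonempty: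
  assumes D: "finite D" "D \<subseteq> Q"
  shows "\<exists>h. h \<in> approx D"
proof -
  obtain f where f: "smono D f"
    by (rule smono_exists[OF D])
  obtain \<sigma> where \<sigma>: "\<sigma> \<in> AutA" "\<forall>i \<in> D \<inter> P. app \<sigma> (b' i) = app (n (f i)) b"
    using em[OF D f[unfolded smono_def]] by (rule bexE)
  define h where "h = case_sum id (arr (\<lambda>i a. inv \<sigma> (n (f i) a)))"
  have "b' i = app (\<lambda>a. h (Inr (i, a))) b" if i: "i \<in> D \<inter> P" for i
  proof -
    have "app (\<lambda>a. h (Inr (i, a))) b = app (inv \<sigma>) (app (n (f i)) b)"
      unfolding app_comp[symmetric] by (rule app_cong) (simp add: h_def)
    also have "\<dots> = app (inv \<sigma>) (app \<sigma> (b' i))"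
      using bspec[OF \<sigma>(2) i] by simp
    also have "\<dots> = b' i"
      unfolding app_comp[symmetric] aut_inv_comp(2)[OF AutA_aut[OF \<sigma>(1)]] app_id ..
    finally show ?thesis ..
  qed
  moreover have "\<forall>i \<in> D. \<forall>a \<in> N. h (Inr (i, a)) = inv \<sigma> (n (f i) a)" "\<forall>x. h (Inl x) = x"
    by (simp_all add: h_def)
  ultimately have "h \<in> approx D"
    unfolding approx_def using AutA_inv[OF \<sigma>(1)] f by blast
  then show ?thesis by (rule exI[of _ h])
qed

lemma approx_antimono:
  assumes "D \<subseteq> D'"
  shows "approx D' \<subseteq> approx D"
proof
  fix h assume h: "h \<in> approx D'"
  then obtain \<sigma> f where \<sigma>: "\<sigma> \<in> AutA" "smono D' f"
    "\<forall>i \<in> D'. \<forall>a \<in> N. h (Inr (i, a)) = \<sigma> (n (f i) a)"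
    unfolding approx_def by blast
  have "smono D f"
    using \<sigma>(2) assms unfolding smono_def by blast
  moreover have "\<forall>i \<in> D. \<forall>a \<in> N. h (Inr (i, a)) = \<sigma> (n (f i) a)"
    using \<sigma>(3) assms by blast
  ultimately have "\<exists>\<sigma> \<in> AutA. \<exists>f. smono D f \<and> (\<forall>i \<in> D. \<forall>a \<in> N. h (Inr (i, a)) = \<sigma> (n (f i) a))"
    using \<sigma>(1) by (intro bexI[of _ \<sigma>] exI[of _ f] conjI)
  moreover have "\<forall>x. h (Inl x) = x" "\<forall>i \<in> D \<inter> P. b' i = app (\<lambda>a. h (Inr (i, a))) b"
    using h assms unfolding approx_def mem_Collect_eq by (simp_all add: subset_iff)
  ultimately show "h \<in> approx D"
    unfolding approx_def by simp
qed

lemma stretch_exists: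
  obtains m :: "'j \<Rightarrow> 'm \<Rightarrow> 'm" where "\<forall>i \<in> Q. copy (m i)"
    "\<forall>D f. finite D \<and> D \<subseteq> Q \<and> smono D f \<longrightarrow> tequiv (D \<times> N) (arr m) (arr (\<lambda>i. n (f i)))"
    "\<forall>i \<in> P. b' i = app (m i) b"
proof -
  let ?V = "constants <+> (Q \<times> N)"
  have "\<exists>U. ultra U \<and> (\<forall>S \<in> approx ` {D. finite D \<and> D \<subseteq> Q}. U S)"
  proof (rule ultra_extension)
    fix G assume "finite G" "G \<subseteq> approx ` {D. finite D \<and> D \<subseteq> Q}"
    then obtain \<D> where \<D>: "finite \<D>" "\<D> \<subseteq> {D. finite D \<and> D \<subseteq> Q}" "G = approx ` \<D>"
      by (metis (no_types, lifting) finite_subset_image)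
    have "finite (\<Union> \<D>)" "\<Union> \<D> \<subseteq> Q"
      using \<D>(1,2) by auto
    from approx_nonempty[OF this] obtain h where h: "h \<in> approx (\<Union> \<D>)"
      by (rule exE)
    have "h \<in> approx D" if "D \<in> \<D>" for D
      using approx_antimono[of D "\<Union> \<D>"] that h by blast
    then have "h \<in> \<Inter> G"
      unfolding \<D>(3) by blast
    then show "\<Inter> G \<noteq> {}" by blast
  qed
  then obtain U where U': "ultra U \<and> (\<forall>S \<in> approx ` {D. finite D \<and> D \<subseteq> Q}. U S)"
    by (rule exE)
  note U = conjunct1[OF U']
  have UA: "U (approx D)" if "finite D" "D \<subseteq> Q" for D
    using U' that by blast
  have "small constants"
    unfolding constants_def
    by (rule small_Un[OF small_reps small_UN_image[OF small_subset[OF small_Q PQ] small_b]])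
  then have V: "small ?V"
    by (intro small_Plus small_Times small_Q small_N)
  have W: "Inl ` constants \<subseteq> ?V"
    by blast
  have g0: "case_sum id undefined \<in> Z \<longleftrightarrow> U Z" if Z: "df (Inl ` constants) Z" for Z :: "('m + 'j \<times> 'm \<Rightarrow> 'm) set"
  proof -
    have "h \<in> Z \<longleftrightarrow> case_sum id undefined \<in> Z" if "h \<in> approx {}" for h
    proof (rule df_agree[OF Z])
      fix v :: "'m + 'j \<times> 'm" assume "v \<in> Inl ` constants"
      then show "h v = case_sum id undefined v"
        using that by (auto simp: approx_def)
    qed
    then have "U Z \<longleftrightarrow> U {h. case_sum id undefined \<in> Z}"
      by (intro ultra_cong[OF U UA[of "{}"]]) simp_all
    then show ?thesis
      using ultra_UNIV[OF U] ultra_empty[OF U] by (cases "case_sum id undefined \<in> Z") simp_all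
  qed
  show ?thesis
  proof (rule realize[OF U V W g0])
    fix g :: "'m + 'j \<times> 'm \<Rightarrow> 'm"
    assume g_c: "\<And>v. v \<in> Inl ` constants \<Longrightarrow> g v = case_sum id undefined v"
      and g_U: "\<And>Z. df ?V Z \<Longrightarrow> g \<in> Z \<longleftrightarrow> U Z"
    have gI: "g (Inl x) = x" if "x \<in> constants" for x
      using g_c[of "Inl x"] that by simp
    \<comment> \<open>Whatever definable condition all approximations on a finite part satisfy
      passes to the realization \<open>g\<close>; the three properties of the copies are obtained in
      this way.\<close>
    have tr: "g \<in> Z" if "df ?V Z" "finite D" "D \<subseteq> Q" "approx D \<subseteq> Z" for Z D
      using g_U[OF that(1)] ultra_mono[OF U UA[OF that(2,3)] that(4)] by blast
    define m where "m i a = g (Inr (i, a))" for i a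
    have arr_m: "arr m = g \<circ> Inr"
      by (auto simp: m_def fun_eq_iff)
    have 2: "tequiv (D \<times> N) (arr m) (arr (\<lambda>i. n (f i)))" if D: "finite D" "D \<subseteq> Q" and f: "smono D f" for D f
    proof (rule tequivI)
      fix Z :: "('j \<times> 'm \<Rightarrow> 'm) set" assume Z: "df (D \<times> N) Z"
      have eq: "h \<circ> Inr \<in> Z \<longleftrightarrow> arr (\<lambda>i. n (f i)) \<in> Z" if "h \<in> approx D" for h
      proof -
        from that obtain \<sigma> f' where h: "\<sigma> \<in> AutA" "smono D f'"
          "\<forall>i \<in> D. \<forall>a \<in> N. h (Inr (i, a)) = \<sigma> (n (f' i) a)"
          unfolding approx_def by blast
        have "h \<circ> Inr \<in> Z \<longleftrightarrow> \<sigma> \<circ> arr (\<lambda>i. n (f' i)) \<in> Z"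
          by (rule df_agree[OF Z]) (use h(3) in auto)
        also have "\<dots> \<longleftrightarrow> arr (\<lambda>i. n (f' i)) \<in> Z"
          by (rule aut_df[OF AutA_aut[OF h(1)] Z])
        also have "\<dots> \<longleftrightarrow> arr (\<lambda>i. n (f i)) \<in> Z"
          by (rule tequivD[OF smono_tequiv[OF D h(2) f] Z])
        finally show ?thesis .
      qed
      have df: "df ?V {h. h \<circ> Inr \<in> Z}"
        by (rule df_vimage[OF Z]) (use D in auto)
      show "arr m \<in> Z \<longleftrightarrow> arr (\<lambda>i. n (f i)) \<in> Z"
      proof (cases "arr (\<lambda>i. n (f i)) \<in> Z")
        case True
        then have "g \<in> {h. h \<circ> Inr \<in> Z}"
          by (intro tr[OF df D]) (use eq in blast)
        then show ?thesis using True by (simp add: arr_m)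
      next
        case False
        then have "g \<in> - {h. h \<circ> Inr \<in> Z}"
          by (intro tr[OF df_Compl[OF df] D]) (use eq in blast)
        then show ?thesis using False by (simp add: arr_m)
      qed
    qed
    have 3: "b' i = app (m i) b" if i: "i \<in> P" for i
    proof
      fix k
      have iQ: "{i} \<subseteq> Q" "i \<in> Q" using i PQ by auto
      show "b' i k = app (m i) b k"
      proof (cases "k \<in> dom b")
        case True
        have c: "the (b' i k) \<in> constants"
          unfolding constants_def using i True by blast
        have "df ?V {h. h (Inl (the (b' i k))) = h (Inr (i, the (b k)))}"
          using c iQ(2) the_in_ran[OF True] ran_b by (intro df_eq) auto
        moreover have "approx {i} \<subseteq> {h. h (Inl (the (b' i k))) = h (Inr (i, the (b k)))}"
        proof
          fix h assume h: "h \<in> approx {i}"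
          then have "b' i = app (\<lambda>a. h (Inr (i, a))) b" "\<forall>x. h (Inl x) = x"
            unfolding approx_def using i by auto
          then show "h \<in> {h. h (Inl (the (b' i k))) = h (Inr (i, the (b k)))}"
            using the_app[OF True, of "\<lambda>a. h (Inr (i, a))"] by simp
        qed
        ultimately have "g (Inl (the (b' i k))) = g (Inr (i, the (b k)))"
          using tr[of _ "{i}"] iQ(1) by blast
        then have "the (b' i k) = the (app (m i) b k)"
          using gI[OF c] the_app[OF True, of "m i"] by (simp add: m_def)
        moreover have "k \<in> dom (b' i)" "k \<in> dom (app (m i) b)"
          using True dom_b'[OF i] by simp_all
        ultimately show ?thesis
          by (metis domD option.sel)
      next
        case False
        then show ?thesis
          using dom_b'[OF i] by (metis dom_app domIff)
      qed
    qed
    have 1: "copy (m i)" if i: "i \<in> Q" for i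
    proof (rule copyI)
      have iQ: "finite {i}" "{i} \<subseteq> Q" using i by auto
      have "tequiv ({i} \<times> N) (arr m) (arr (\<lambda>i. n 0))"
        by (rule 2[OF iQ]) (simp add: smono_def irrefl)
      then have "tequiv N (arr m \<circ> Pair i) (arr (\<lambda>i. n 0) \<circ> Pair i)"
        by (rule tequiv_comp) auto
      moreover have "arr m \<circ> Pair i = m i" "arr (\<lambda>i. n 0) \<circ> Pair i = id"
        by (auto simp: n_0 fun_eq_iff)
      ultimately show "tequiv N (m i) id" by (simp only:)
      fix a E assume aE: "(a, E) \<in> A"
      have ran: "ran a \<subseteq> N" "ran a \<subseteq> constants"
        using ran_reps[OF aE] reps_N unfolding constants_def by auto
      obtain \<Z> where \<Z>: "\<forall>Z \<in> \<Z>. df (ran a <+> ran a) Z"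
        "\<forall>q. (a, app q a) \<in> E \<longleftrightarrow> (\<forall>Z \<in> \<Z>. case_sum id q \<in> Z)"
        by (rule hyper_df[OF aE])
      have "case_sum id (m i) \<in> Z" if Zin: "Z \<in> \<Z>" for Z
      proof -
        have Z: "df (ran a <+> ran a) Z"
          by (rule bspec[OF \<Z>(1) Zin])
        let ?r = "map_sum id (Pair i)"
        have df: "df ?V {h. h \<circ> ?r \<in> Z}"
          by (rule df_vimage[OF Z]) (use ran i in auto)
        have "approx {i} \<subseteq> {h. h \<circ> ?r \<in> Z}"
        proof
          fix h assume "h \<in> approx {i}"
          then obtain \<sigma> f where h: "\<forall>x. h (Inl x) = x" "\<sigma> \<in> AutA"
            "\<forall>a \<in> N. h (Inr (i, a)) = \<sigma> (n (f i) a)"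
            unfolding approx_def by blast
          obtain \<tau> where \<tau>: "\<tau> \<in> AutA" "\<forall>x \<in> N. n (f i) x = \<tau> x"
            by (rule copyE[OF n_copy])
          have "h \<circ> ?r \<in> Z \<longleftrightarrow> case_sum id (\<sigma> \<circ> \<tau>) \<in> Z"
          proof (rule df_agree[OF Z])
            fix v assume "v \<in> ran a <+> ran a"
            then show "(h \<circ> ?r) v = case_sum id (\<sigma> \<circ> \<tau>) v"
              using h(1,3) \<tau>(2) subsetD[OF ran(1)] by (elim PlusE) simp_all
          qed
          moreover have "case_sum id (\<sigma> \<circ> \<tau>) \<in> Z"
            using \<Z>(2) Zin AutAD[OF AutA_comp[OF h(2) \<tau>(1)] aE] by blast
          ultimately show "h \<in> {h. h \<circ> ?r \<in> Z}" by blast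
        qed
        then have "g \<circ> ?r \<in> Z"
          using tr[OF df iQ] by blast
        moreover have "g \<circ> ?r \<in> Z \<longleftrightarrow> case_sum id (m i) \<in> Z"
        proof (rule df_agree[OF Z])
          fix v assume "v \<in> ran a <+> ran a"
          then show "(g \<circ> ?r) v = case_sum id (m i) v"
            using gI subsetD[OF ran(2)] by (elim PlusE) (simp_all add: m_def)
        qed
        ultimately show ?thesis by blast
      qed
      then show "(a, app (m i) a) \<in> E"
        using \<Z>(2) by blast
    qed
    show ?thesis
      by (rule that[of m]) (use 1 2 3 in blast)+
  qed
qed

lemma stretch_fin_sat:
  fixes m :: "'j \<Rightarrow> 'm \<Rightarrow> 'm"
  assumes m: "\<forall>D f. finite D \<and> D \<subseteq> Q \<and> smono D f \<longrightarrow> tequiv (D \<times> N) (arr m) (arr (\<lambda>i. n (f i)))"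
    and p: "p \<in> Q"
  shows "fin_sat (\<Union>i \<in> {i \<in> Q. \<not> lt p i}. m i ` N) (\<Union>i \<in> {i \<in> Q. lt p i}. m i ` N) (m p ` N)"
    (is "fin_sat ?X ?Y _")
  unfolding fin_sat_def
proof (intro allI impI)
  fix Z :: "('m + 'm \<Rightarrow> 'm) set"
  assume Z: "df (?X <+> ?Y) Z" and id: "case_sum id id \<in> Z"
  \<comment> \<open>An element may occur in several copies. One occurrence is chosen for each, so
    that a condition on elements becomes one on coordinates of the copies.\<close>
  have "\<forall>x \<in> ?X. \<exists>v. v \<in> {i \<in> Q. \<not> lt p i} \<times> N \<and> arr m v = x"
  proof
    fix x assume "x \<in> ?X"
    then obtain i a where "i \<in> {i \<in> Q. \<not> lt p i}" "a \<in> N" "x = m i a" by blast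
    then show "\<exists>v. v \<in> {i \<in> Q. \<not> lt p i} \<times> N \<and> arr m v = x"
      by (intro exI[of _ "(i, a)"]) simp
  qed
  then have "\<exists>ix. \<forall>x \<in> ?X. ix x \<in> {i \<in> Q. \<not> lt p i} \<times> N \<and> arr m (ix x) = x"
    by (rule bchoice)
  then obtain ix where ix: "\<forall>x \<in> ?X. ix x \<in> {i \<in> Q. \<not> lt p i} \<times> N \<and> arr m (ix x) = x"
    by (rule exE)
  have "\<forall>y \<in> ?Y. \<exists>v. v \<in> {i \<in> Q. lt p i} \<times> N \<and> arr m v = y"
  proof
    fix y assume "y \<in> ?Y"
    then obtain i a where "i \<in> {i \<in> Q. lt p i}" "a \<in> N" "y = m i a" by blast
    then show "\<exists>v. v \<in> {i \<in> Q. lt p i} \<times> N \<and> arr m v = y"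
      by (intro exI[of _ "(i, a)"]) simp
  qed
  then have "\<exists>iy. \<forall>y \<in> ?Y. iy y \<in> {i \<in> Q. lt p i} \<times> N \<and> arr m (iy y) = y"
    by (rule bchoice)
  then obtain iy where iy: "\<forall>y \<in> ?Y. iy y \<in> {i \<in> Q. lt p i} \<times> N \<and> arr m (iy y) = y"
    by (rule exE)
  define Z1 where "Z1 = {h. h \<circ> case_sum ix iy \<in> Z}"
  have Z1: "h \<in> Z1 \<longleftrightarrow> h \<circ> case_sum ix iy \<in> Z" for h
    unfolding Z1_def by (rule mem_Collect_eq)
  have dfQ: "df (Q \<times> N) Z1"
    unfolding Z1_def
  proof (rule df_vimage[OF Z])
    show "case_sum ix iy ` (?X <+> ?Y) \<subseteq> Q \<times> N"
    proof (rule image_subsetI)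
      fix v assume "v \<in> ?X <+> ?Y"
      then show "case_sum ix iy v \<in> Q \<times> N"
      proof (rule PlusE)
        fix x assume x: "x \<in> ?X" "v = Inl x"
        have "ix x \<in> {i \<in> Q. \<not> lt p i} \<times> N" using bspec[OF ix x(1)] by (rule conjunct1)
        then show ?thesis unfolding x(2) sum.case mem_Times_iff by blast
      next
        fix y assume y: "y \<in> ?Y" "v = Inr y"
        have "iy y \<in> {i \<in> Q. lt p i} \<times> N" using bspec[OF iy y(1)] by (rule conjunct1)
        then show ?thesis unfolding y(2) sum.case mem_Times_iff by blast
      qed
    qed
  qed
  have "arr m \<circ> case_sum ix iy \<in> Z \<longleftrightarrow> case_sum id id \<in> Z"
  proof (rule df_agree[OF Z])
    fix v assume "v \<in> ?X <+> ?Y"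
    then show "(arr m \<circ> case_sum ix iy) v = case_sum id id v"
    proof (rule PlusE)
      fix x assume x: "x \<in> ?X" "v = Inl x"
      show ?thesis
        unfolding x(2) comp_apply sum.case id_apply using bspec[OF ix x(1)] by (rule conjunct2)
    next
      fix y assume y: "y \<in> ?Y" "v = Inr y"
      show ?thesis
        unfolding y(2) comp_apply sum.case id_apply using bspec[OF iy y(1)] by (rule conjunct2)
    qed
  qed
  then have mZ: "arr m \<in> Z1"
    using id unfolding Z1 by (rule iffD2)
  obtain V0 where V0: "finite V0" "V0 \<subseteq> Q \<times> N" "df V0 Z1"
    by (rule df_finite[OF dfQ])
  define D where "D = insert p (fst ` V0)"
  have D: "finite D" "D \<subseteq> Q"
    using V0 p unfolding D_def by auto
  have "V0 \<subseteq> D \<times> N"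
    using V0(2) unfolding D_def by force
  then have dfD: "df (D \<times> N) Z1"
    by (rule df_mono[OF V0(3)])
  obtain f where f: "smono D f"
    by (rule smono_exists[OF D])
  have eq: "tequiv (D \<times> N) (arr m) (arr (\<lambda>i. n (f i)))"
    using m D f by blast
  have pD: "p \<in> D" unfolding D_def by simp
  have fp: "f i \<le> f p \<longleftrightarrow> \<not> lt p i" if "i \<in> D" for i
    using smono_iff[OF f D(2) pD that] by auto
  have "arr (\<lambda>i. n (f i)) \<in> Z1"
    using tequivD[OF eq dfD] mZ by blast
  moreover have "arr n \<circ> map_prod f id = arr (\<lambda>i. n (f i))"
    by (auto simp: fun_eq_iff)
  moreover define Z2 where "Z2 = {h. h \<circ> map_prod f id \<in> Z1}"
  have Z2: "h \<in> Z2 \<longleftrightarrow> h \<circ> map_prod f id \<in> Z1" for h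
    unfolding Z2_def by (rule mem_Collect_eq)
  ultimately have "arr n \<in> Z2"
    unfolding Z2 by (simp only:)
  moreover have "df (f ` D \<times> N) Z2"
    unfolding Z2_def by (rule df_vimage[OF dfD]) auto
  moreover have "finite (f ` D)"
    using D(1) by simp
  ultimately have "\<exists>\<rho>. (\<forall>i. \<forall>a \<in> N. \<rho> i a \<in> N) \<and>
      arr (\<lambda>i a. if i \<le> f p then n i a else n (f p) (\<rho> i a)) \<in> Z2"
    by (intro n_fin_sat)
  then obtain \<rho> where "(\<forall>i. \<forall>a \<in> N. \<rho> i a \<in> N) \<and>
      arr (\<lambda>i a. if i \<le> f p then n i a else n (f p) (\<rho> i a)) \<in> Z2"
    by (rule exE)
  note \<rho> = conjunct1[OF this] conjunct2[OF this, unfolded Z2]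
  \<comment> \<open>The descent into one copy found in the sequence \<open>n\<close> is written as a
    substitution of variables. It is then a definable condition on finitely many copies and carries
    over to \<open>m\<close>.\<close>
  let ?r = "\<lambda>(i, a). if lt p i then (p, \<rho> (f i) a) else (i, a)"
  have "arr (\<lambda>i a. if i \<le> f p then n i a else n (f p) (\<rho> i a)) \<circ> map_prod f id \<in> Z1 \<longleftrightarrow>
      arr (\<lambda>i. n (f i)) \<circ> ?r \<in> Z1"
    by (rule df_agree[OF dfD]) (auto simp: fp split: if_splits)
  then have "arr (\<lambda>i. n (f i)) \<circ> ?r \<in> Z1"
    using \<rho>(2) by (rule iffD1)
  moreover define Z3 where "Z3 = {h. h \<circ> ?r \<in> Z1}"
  have Z3: "h \<in> Z3 \<longleftrightarrow> h \<circ> ?r \<in> Z1" for h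
    unfolding Z3_def by (rule mem_Collect_eq)
  ultimately have "arr (\<lambda>i. n (f i)) \<in> Z3"
    unfolding Z3 by (simp only:)
  moreover have "df (D \<times> N) Z3"
    unfolding Z3_def by (rule df_vimage[OF dfD]) (use \<rho>(1) pD in \<open>auto split: if_splits\<close>)
  ultimately have "arr m \<in> Z3"
    using tequivD[OF eq, of Z3] by blast
  then have r: "arr m \<circ> ?r \<in> Z1"
    unfolding Z3 .
  obtain x0 where x0: "x0 \<in> N"
  proof -
    have "\<exists>h :: 'm \<Rightarrow> 'm. range h \<subseteq> N \<and> case_sum id h \<in> UNIV"
      using elem_N[unfolded elem_def fin_sat_def, rule_format, OF df_UNIV UNIV_I] .
    then obtain h :: "'m \<Rightarrow> 'm" where "range h \<subseteq> N \<and> case_sum id h \<in> UNIV"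
      by (rule exE)
    then have "h undefined \<in> N" by blast
    then show ?thesis by (rule that)
  qed
  \<comment> \<open>The whole range of \<open>h\<close> has to lie in copy \<open>p\<close>, hence
    the default value \<open>m p x0\<close> outside \<open>?Y\<close>.\<close>
  define h where "h y = (if y \<in> ?Y then (arr m \<circ> ?r) (iy y) else m p x0)" for y
  have "(arr m \<circ> ?r) \<circ> case_sum ix iy \<in> Z \<longleftrightarrow> case_sum id h \<in> Z"
  proof (rule df_agree[OF Z])
    fix v assume "v \<in> ?X <+> ?Y"
    then show "((arr m \<circ> ?r) \<circ> case_sum ix iy) v = case_sum id h v"
    proof (rule PlusE)
      fix x assume x: "x \<in> ?X" "v = Inl x"
      obtain i a where ia: "ix x = (i, a)" by (rule prod.exhaust)
      have "\<not> lt p i" "m i a = x"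
        using bspec[OF ix x(1)] unfolding ia by (simp_all del: UN_iff)
      then show ?thesis unfolding x(2) comp_apply sum.case ia by simp
    next
      fix y assume y: "y \<in> ?Y" "v = Inr y"
      then show ?thesis by (simp only: h_def comp_apply sum.case if_True)
    qed
  qed
  then have "case_sum id h \<in> Z"
    using r[unfolded Z1] by (rule iffD1)
  moreover have "h y \<in> m p ` N" for y
  proof (cases "y \<in> ?Y")
    case True
    obtain i a where ia: "iy y = (i, a)" by (rule prod.exhaust)
    have "lt p i" "a \<in> N"
      using bspec[OF iy True] unfolding ia by (simp_all del: UN_iff)
    then show ?thesis
      using True \<rho>(1) by (simp only: h_def comp_apply ia if_True split) simp
  next
    case False
    then show ?thesis using x0 by (simp only: h_def if_False) blast
  qed
  ultimately show "\<exists>h. range h \<subseteq> m p ` N \<and> case_sum id h \<in> Z"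
    by blast
qed

end

section \<open>Independence of the two parts\<close>

context stretch
begin

text \<open>The copy is the restriction to \<open>N\<close> of some \<tau> over \<open>A\<close>,
  and \<sigma> fixes the images of the representatives under \<tau>. So
  \<open>\<sigma> \<circ> \<tau>\<close> agrees with \<tau> on them and is over \<open>A\<close>,
  and then so is \<sigma>.\<close>

lemma stretch_fixer_AutA:
  assumes "copy q" "q ` N \<subseteq> X" "\<sigma> \<in> fixer X"
  shows "\<sigma> \<in> AutA"
proof -
  obtain \<tau> where \<tau>: "\<tau> \<in> AutA" "\<forall>x \<in> N. q x = \<tau> x"
    by (rule copyE[OF assms(1)])
  have "\<sigma> (\<tau> x) = \<tau> x" if "x \<in> N" for x
    using fixerD[OF assms(3), of "q x"] \<tau>(2) assms(2) that by auto
  then have "\<sigma> \<circ> \<tau> \<in> AutA"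
    using reps_N by (intro AutA_agree[OF aut_comp[OF fixer_aut[OF assms(3)] AutA_aut[OF \<tau>(1)]] \<tau>(1)]) auto
  then have "(\<sigma> \<circ> \<tau>) \<circ> inv \<tau> \<in> AutA"
    by (rule AutA_comp[OF _ AutA_inv[OF \<tau>(1)]])
  then show ?thesis
    by (simp only: comp_assoc aut_inv_comp(1)[OF AutA_aut[OF \<tau>(1)]] comp_id)
qed

lemma fixer_aut_over:
  assumes \<sigma>: "\<sigma> \<in> fixer X" and "copy q" "q ` N \<subseteq> X"
    and K: "\<And>k. k \<in> K \<Longrightarrow> k \<in> P \<and> b' k = app (m k) b \<and> m k ` N \<subseteq> X"
  shows "\<sigma> \<in> aut_over L M (A \<union> {real_im (b' k) | k. k \<in> K})"
proof -
  have A: "\<sigma> \<in> AutA"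
    by (rule stretch_fixer_AutA[OF assms(2,3) \<sigma>])
  have "(b' k, app \<sigma> (b' k)) \<in> Id_on {d. dom d = dom (b' k)}" if k: "k \<in> K" for k
  proof -
    have "app \<sigma> (app (m k) b) = app (m k) b"
      unfolding app_comp[symmetric]
    proof (rule app_cong)
      fix x assume "x \<in> ran b"
      then have "m k x \<in> X" using K[OF k] ran_b by blast
      then show "(\<sigma> \<circ> m k) x = m k x" using fixerD[OF \<sigma>] by simp
    qed
    then show ?thesis using K[OF k] by (simp add: Id_on_def)
  qed
  then show ?thesis
    using A unfolding aut_over_def by (auto simp: real_im_def)
qed

theorem stretch_indep:
  assumes P: "P = K1 \<union> K2" and e: "{e0, e1, e2} \<subseteq> Q" "lt e0 e1" "lt e1 e2"
    and K1: "\<And>k. k \<in> K1 \<Longrightarrow> lt k e0" and K2: "\<And>k. k \<in> K2 \<Longrightarrow> lt e2 k"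
    and x: "x \<in> bddu L M \<kappa> (A \<union> {real_im (b' k) | k. k \<in> K1})"
      "x \<in> bddu L M \<kappa> (A \<union> {real_im (b' k) | k. k \<in> K2})"
  shows "x \<in> bddu L M \<kappa> A"
proof -
  obtain c F where cF: "x = (c, F)" by (rule prod.exhaust)
  have ui: "ultraimaginary L M \<kappa> (c, F)"
    using x(1) by (simp add: bddu_def cF)
  interpret im: ultra_im L M T \<kappa> c F
    by unfold_locales (rule ui)
  have b1: "small (im.orb (aut_over L M (A \<union> {real_im (b' k) | k. k \<in> K1})))"
    and b2: "small (im.orb (aut_over L M (A \<union> {real_im (b' k) | k. k \<in> K2})))"
    using x by (simp_all add: bddu_def cF im.orbit_eq small_def)
  obtain m :: "'j \<Rightarrow> 'm \<Rightarrow> 'm" where m: "\<forall>i \<in> Q. copy (m i)"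
    "\<forall>D f. finite D \<and> D \<subseteq> Q \<and> smono D f \<longrightarrow> tequiv (D \<times> N) (arr m) (arr (\<lambda>i. n (f i)))"
    "\<forall>i \<in> P. b' i = app (m i) b"
    by (rule stretch_exists)
  \<comment> \<open>Cutting just after \<open>p\<close> puts \<open>K1\<close> to the left and
    \<open>K2\<close> to the right. The right part is finitely satisfiable in copy \<open>p\<close>
    over the left part, so boundedness over both parts descends to this copy.\<close>
  have fixed: "im.eqv id \<sigma>" if p: "p \<in> {e0, e1}" and \<sigma>: "\<sigma> \<in> fixer (m p ` N)" for p \<sigma>
  proof -
    have pQ: "p \<in> Q" using p e by blast
    have pe: "p = e0 \<or> lt e0 p" "lt p e2"
      using p e trans[of e0 e1 e2] by auto
    let ?I = "{i \<in> Q. \<not> lt p i}" and ?J = "{i \<in> Q. lt p i}"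
    let ?X = "\<Union>i \<in> ?I. m i ` N" and ?Y = "\<Union>i \<in> ?J. m i ` N"
    have pI: "p \<in> ?I" using pQ irrefl by blast
    \<comment> \<open>The copy at \<open>e2\<close> is part of the right side for either choice of
      \<open>p\<close>. Without it, fixing the right side might not mean being over \<open>A\<close>
      when \<open>K2\<close> is empty.\<close>
    have eJ: "e2 \<in> ?J" using pe e by blast
    have kI: "k \<in> ?I" if "k \<in> K1" for k
    proof -
      have "k \<in> Q" using that P PQ by blast
      moreover have "lt k p"
        using K1[OF that] pe trans[of k e0 p] \<open>k \<in> Q\<close> e pQ by auto
      ultimately show ?thesis
        using trans[of k p k] irrefl pQ by blast
    qed
    have kJ: "k \<in> ?J" if "k \<in> K2" for k
    proof -
      have "k \<in> Q" using that P PQ by blast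
      then show ?thesis
        using K2[OF that] pe trans[of p e2 k] e pQ by auto
    qed
    have pX: "m p ` N \<subseteq> ?X" using pI by (rule UN_upper)
    have small: "small ?X" "small ?Y"
      by (rule small_UN_image[OF small_subset[OF small_Q] small_N], blast)+
    have "fixer ?X \<subseteq> aut_over L M (A \<union> {real_im (b' k) | k. k \<in> K1})"
    proof
      fix \<tau> assume "\<tau> \<in> fixer ?X"
      then show "\<tau> \<in> aut_over L M (A \<union> {real_im (b' k) | k. k \<in> K1})"
      proof (rule fixer_aut_over[OF _ bspec[OF m(1) pQ] pX, where m = m])
        fix k assume k: "k \<in> K1"
        show "k \<in> P \<and> b' k = app (m k) b \<and> m k ` N \<subseteq> ?X"
        proof (intro conjI)
          show "k \<in> P" using k P by blast
          then show "b' k = app (m k) b" by (rule bspec[OF m(3)])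
        qed (rule UN_upper[OF kI[OF k]])
      qed
    qed
    then have bX: "small (im.orb (fixer ?X))"
      using b1 by (rule im.orb_mono)
    have "fixer ?Y \<subseteq> aut_over L M (A \<union> {real_im (b' k) | k. k \<in> K2})"
    proof
      fix \<tau> assume "\<tau> \<in> fixer ?Y"
      then show "\<tau> \<in> aut_over L M (A \<union> {real_im (b' k) | k. k \<in> K2})"
      proof (rule fixer_aut_over[OF _ _ UN_upper[OF eJ], where m = m])
        show "copy (m e2)" using m(1) e(1) by blast
        fix k assume k: "k \<in> K2"
        show "k \<in> P \<and> b' k = app (m k) b \<and> m k ` N \<subseteq> ?Y"
        proof (intro conjI)
          show "k \<in> P" using k P by blast
          then show "b' k = app (m k) b" by (rule bspec[OF m(3)])
        qed (rule UN_upper[OF kJ[OF k]])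
      qed
    qed
    then have bY: "small (im.orb (fixer ?Y))"
      using b2 by (rule im.orb_mono)
    have "small (im.orb (fixer (m p ` N)))"
      by (rule im.bounded_fin_sat[OF stretch_fin_sat[OF m(2) pQ] pX small bX bY])
    moreover have "elem (m p ` N)"
    proof -
      obtain \<tau> where \<tau>: "\<tau> \<in> AutA" "\<forall>x \<in> N. m p x = \<tau> x"
        by (rule copyE[OF bspec[OF m(1) pQ]])
      have "m p ` N = \<tau> ` N"
        using \<tau>(2) by (intro image_cong) simp_all
      then show ?thesis
        using elem_image[OF AutA_aut[OF \<tau>(1)] elem_N] by simp
    qed
    ultimately show ?thesis
      using im.elem_fixed[OF _ small_image[OF small_N] _ \<sigma>] by blast
  qed
  \<comment> \<open>The copies at \<open>e0\<close> and \<open>e1\<close> have the type of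
    \<open>n 0\<close> and \<open>n 1\<close>. Moving them there by an automorphism over
    \<open>A\<close>, together with the ultraimaginary, gives the situation of
    \<open>base_im\<close>.\<close>
  define f :: "'j \<Rightarrow> nat" where "f i = (if i = e0 then 0 else 1)" for i
  have ne: "e0 \<noteq> e1" using e(2) irrefl by blast
  have D: "finite {e0, e1}" "{e0, e1} \<subseteq> Q" "smono {e0, e1} f"
    using e ne irrefl trans[of e0 e1 e0] by (auto simp: smono_def f_def)
  have "tequiv ({e0, e1} \<times> N) (arr (\<lambda>i. n (f i))) (arr m)"
    by (rule tequiv_sym[OF mp[OF spec[OF spec[OF m(2)]]]]) (intro conjI D)
  then obtain \<tau> where \<tau>: "\<tau> \<in> Aut" "\<forall>v \<in> {e0, e1} \<times> N. \<tau> (arr (\<lambda>i. n (f i)) v) = arr m v"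
    by (rule homogeneous[OF small_Times[OF small_finite[OF D(1)] small_N]])
  have \<tau>0: "\<tau> x = m e0 x" if "x \<in> N" for x
    using bspec[OF \<tau>(2), of "(e0, x)"] that by (simp add: f_def n_0)
  have \<tau>1: "\<tau> (n 1 x) = m e1 x" if "x \<in> N" for x
    using bspec[OF \<tau>(2), of "(e1, x)"] that ne by (simp add: f_def)
  have \<tau>A: "\<tau> \<in> AutA"
  proof -
    have "copy (m e0)" using m(1) e(1) by blast
    then obtain \<rho> where \<rho>: "\<rho> \<in> AutA" "\<forall>x \<in> N. m e0 x = \<rho> x"
      by (rule copyE)
    show ?thesis
    proof (rule AutA_agree[OF \<tau>(1) \<rho>(1)])
      show "\<tau> x = \<rho> x" if "x \<in> reps" for x
        using \<tau>0 bspec[OF \<rho>(2)] subsetD[OF reps_N that] by simp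
    qed
  qed
  define c' where "c' = app (inv \<tau>) c"
  have c: "c = app \<tau> c'"
    unfolding c'_def app_comp[symmetric] aut_inv_comp(1)[OF \<tau>(1)] by simp
  have conj: "(c', app \<sigma> c') \<in> F"
    if s: "\<sigma> \<in> fixer Y" and p: "p \<in> {e0, e1}" and Y: "\<And>x. x \<in> N \<Longrightarrow> \<exists>y \<in> Y. \<tau> y = m p x" for \<sigma> Y p
  proof -
    have "\<tau> \<circ> (\<sigma> \<circ> inv \<tau>) \<in> fixer (m p ` N)"
    proof (rule fixerI)
      show "\<tau> \<circ> (\<sigma> \<circ> inv \<tau>) \<in> Aut"
        by (intro aut_comp aut_inv \<tau>(1) fixer_aut[OF s])
      fix z assume "z \<in> m p ` N"
      then obtain x where "x \<in> N" "z = m p x" by (rule imageE)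
      with Y[of x] obtain y where y: "y \<in> Y" "\<tau> y = z" by auto
      have "inv \<tau> z = y"
        using aut_inv_apply(2)[OF \<tau>(1), of y] y(2) by simp
      then show "(\<tau> \<circ> (\<sigma> \<circ> inv \<tau>)) z = z"
        using fixerD[OF s y(1)] y(2) by simp
    qed
    then have "im.eqv id (\<tau> \<circ> (\<sigma> \<circ> inv \<tau>))"
      by (rule fixed[OF p])
    then have "(app (inv \<tau>) c, app (inv \<tau>) (app (\<tau> \<circ> (\<sigma> \<circ> inv \<tau>)) c)) \<in> F"
      unfolding im.eqv_def using im.F_aut[OF aut_inv[OF \<tau>(1)], of c "app (\<tau> \<circ> (\<sigma> \<circ> inv \<tau>)) c"] by simp
    moreover have "app (inv \<tau>) (app (\<tau> \<circ> (\<sigma> \<circ> inv \<tau>)) c) = app \<sigma> c'"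
      unfolding c'_def app_comp[symmetric] comp_assoc[symmetric, of "inv \<tau>" \<tau>] aut_inv_comp(2)[OF \<tau>(1)] id_comp ..
    ultimately show ?thesis unfolding c'_def by simp
  qed
  have ui': "ultraimaginary L M \<kappa> (c', F)"
    using ui by (simp add: ultraimaginary_def c'_def)
  have n1: "clim N u id (n 1)"
    using clim_mono[OF n_clim[of 0 1]] by (simp add: n_0 below_def)
  interpret im': ultra_im L M T \<kappa> c' F
    by unfold_locales (rule ui')
  interpret bi: base_im L M T \<kappa> A N u c' F "n 1"
  proof
    show "clim N u id (n 1)" by (rule n1)
    show "im'.eqv id \<sigma>" if "\<sigma> \<in> fixer N" for \<sigma>
      unfolding im'.eqv_def app_id by (rule conj[OF that, of e0]) (simp, rule bexI, erule \<tau>0)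
    show "im'.eqv id \<sigma>" if "\<sigma> \<in> fixer (n 1 ` N)" for \<sigma>
      unfolding im'.eqv_def app_id by (rule conj[OF that, of e1]) (simp, rule bexI, erule \<tau>1, erule imageI)
  qed
  \<comment> \<open>Since \<tau> is over \<open>A\<close>, replacing \<open>c\<close> by its image
    under the inverse of \<tau> does not leave the orbit over \<open>A\<close>.\<close>
  have "im.orb AutA \<subseteq> im'.orb AutA"
  proof
    fix z assume "z \<in> im.orb AutA"
    then obtain g where g: "g \<in> AutA" "z = F `` {app g c}"
      unfolding im.orb_def by (rule imageE)
    have "z = F `` {app (g \<circ> \<tau>) c'}"
      unfolding g(2) app_comp c[symmetric] ..
    then show "z \<in> im'.orb AutA"
      unfolding im'.orb_def using AutA_comp[OF g(1) \<tau>A] by (rule image_eqI)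
  qed
  then have "small (im.orb AutA)"
    by (rule small_subset[OF bi.bounded_orbit])
  then show ?thesis
    using ui by (simp add: bddu_def cF im.orbit_eq small_def)
qed

end

section \<open>Auxiliary facts on boundedness and linear orders\<close>

lemma bddu_mono: "bddu L M \<kappa> A \<subseteq> bddu L M \<kappa> (A \<union> B)"
proof
  fix x assume x: "x \<in> bddu L M \<kappa> A"
  have "aut_over L M (A \<union> B) \<subseteq> aut_over L M A"
    unfolding aut_over_def by blast
  then have "orbit L M (A \<union> B) x \<subseteq> orbit L M A x"
    unfolding orbit_def by (cases x) auto
  then have "|orbit L M (A \<union> B) x| \<le>o |orbit L M A x|"
    by (rule card_of_mono1)
  moreover have "|orbit L M A x| <o \<kappa>" "ultraimaginary L M \<kappa> x"
    using x by (simp_all add: bddu_def)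
  ultimately show "x \<in> bddu L M \<kappa> (A \<union> B)"
    using ordLeq_ordLess_trans by (auto simp: bddu_def)
qed

lemma sorted_list_exists:
  assumes "finite D" and trans: "\<And>i j k. i \<in> D \<Longrightarrow> j \<in> D \<Longrightarrow> k \<in> D \<Longrightarrow> lt i j \<Longrightarrow> lt j k \<Longrightarrow> lt i k"
    and total: "\<And>i j. i \<in> D \<Longrightarrow> j \<in> D \<Longrightarrow> i \<noteq> j \<Longrightarrow> lt i j \<or> lt j i"
  shows "\<exists>xs. set xs = D \<and> sorted_wrt lt xs"
  using assms
proof (induction D rule: finite_induct)
  case (insert x D)
  have "\<exists>xs. set xs = D \<and> sorted_wrt lt xs"
  proof (rule insert.IH)
    fix i j k assume "i \<in> D" "j \<in> D" "k \<in> D" "lt i j" "lt j k"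
    then show "lt i k" using insert.prems(1)[of i j k] by simp
  next
    fix i j assume "i \<in> D" "j \<in> D" "i \<noteq> j"
    then show "lt i j \<or> lt j i" using insert.prems(2)[of i j] by simp
  qed
  then obtain xs where xs: "set xs = D" "sorted_wrt lt xs" by blast
  let ?ys = "filter (\<lambda>y. lt y x) xs @ x # filter (\<lambda>y. \<not> lt y x) xs"
  have gt: "lt x z" if "z \<in> D" "\<not> lt z x" for z
    using insert.prems(2)[of x z] insert.hyps(2) that by auto
  have "sorted_wrt lt ?ys"
    unfolding sorted_wrt_append sorted_wrt.simps
  proof (intro conjI ballI sorted_wrt_filter xs(2))
    fix z assume "z \<in> set (filter (\<lambda>y. \<not> lt y x) xs)"
    then show "lt x z" using gt xs(1) by auto
  next
    fix y z assume y: "y \<in> set (filter (\<lambda>y. lt y x) xs)" and z: "z \<in> set (x # filter (\<lambda>y. \<not> lt y x) xs)"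
    show "lt y z"
    proof (cases "z = x")
      case True
      then show ?thesis using y by simp
    next
      case False
      then have "lt x z" "z \<in> D" using z gt xs(1) by auto
      moreover have "lt y x" "y \<in> D" using y xs(1) by auto
      ultimately show ?thesis using insert.prems(1)[of y x z] by simp
    qed
  qed
  moreover have "set ?ys = insert x D" using xs(1) by auto
  ultimately show ?case by blast
qed simp

lemma ord_sum_iff [simp]:
  "(Inl x, Inl y) \<in> ord_sum r s \<longleftrightarrow> (x, y) \<in> r"
  "(Inr z, Inr w) \<in> ord_sum r s \<longleftrightarrow> (z, w) \<in> s"
  "(Inl x, Inr w) \<in> ord_sum r s \<longleftrightarrow> x \<in> Field r \<and> w \<in> Field s"
  "(Inr z, Inl y) \<notin> ord_sum r s"
  by (auto simp: ord_sum_def)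

lemma Field_ord_sum:
  assumes "Linear_order r" "Linear_order s"
  shows "Field (ord_sum r s) = Field r <+> Field s"
proof -
  have refl: "(x, x) \<in> r" if "x \<in> Field r" for x
    using assms(1) that by (auto simp: order_on_defs refl_on_def)
  have refl': "(x, x) \<in> s" if "x \<in> Field s" for x
    using assms(2) that by (auto simp: order_on_defs refl_on_def)
  have "Inl x \<in> Field (ord_sum r s)" if "x \<in> Field r" for x
    using refl[OF that] FieldI1[of "Inl x" "Inl x" "ord_sum r s"] by simp
  moreover have "Inr x \<in> Field (ord_sum r s)" if "x \<in> Field s" for x
    using refl'[OF that] FieldI1[of "Inr x" "Inr x" "ord_sum r s"] by simp
  moreover have "Field (ord_sum r s) \<subseteq> Field r <+> Field s"
    by (auto simp: ord_sum_def Field_def Domain_unfold Range.simps)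
  ultimately show ?thesis by blast
qed

text \<open>The strict order of \<open>I + J\<close> with room made at the cut for the numbers that
  index the middle copies.\<close>

fun insert_mid :: "('i + 'j) rel \<Rightarrow> ('i + 'j) + nat \<Rightarrow> ('i + 'j) + nat \<Rightarrow> bool" where
  "insert_mid r (Inl x) (Inl y) \<longleftrightarrow> (x, y) \<in> r \<and> x \<noteq> y"
| "insert_mid r (Inl (Inl x)) (Inr k) \<longleftrightarrow> True"
| "insert_mid r (Inl (Inr x)) (Inr k) \<longleftrightarrow> False"
| "insert_mid r (Inr k) (Inl (Inl x)) \<longleftrightarrow> False"
| "insert_mid r (Inr k) (Inl (Inr x)) \<longleftrightarrow> True"
| "insert_mid r (Inr k) (Inr l) \<longleftrightarrow> k < l"

lemma insert_mid_linear:
  fixes r :: "'i rel" and s :: "'j rel" and K :: "nat set"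
  assumes r: "Linear_order r" and s: "Linear_order s"
  defines "Q \<equiv> Inl ` (Field r <+> Field s) \<union> Inr ` K"
  shows "\<not> insert_mid (ord_sum r s) i i"
    "\<lbrakk>i \<in> Q; j \<in> Q; k \<in> Q; insert_mid (ord_sum r s) i j; insert_mid (ord_sum r s) j k\<rbrakk>
      \<Longrightarrow> insert_mid (ord_sum r s) i k"
    "\<lbrakk>i \<in> Q; j \<in> Q; i \<noteq> j\<rbrakk> \<Longrightarrow> insert_mid (ord_sum r s) i j \<or> insert_mid (ord_sum r s) j i"
proof -
  let ?lt = "insert_mid (ord_sum r s)"
  have trI: "(x, z) \<in> r" if "(x, y) \<in> r" "(y, z) \<in> r" for x y z
    using r that unfolding order_on_defs by (meson transD)
  have trJ: "(x, z) \<in> s" if "(x, y) \<in> s" "(y, z) \<in> s" for x y z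
    using s that unfolding order_on_defs by (meson transD)
  have asI: "x = y" if "(x, y) \<in> r" "(y, x) \<in> r" for x y
    using r that unfolding order_on_defs by (meson antisymD)
  have asJ: "x = y" if "(x, y) \<in> s" "(y, x) \<in> s" for x y
    using s that unfolding order_on_defs by (meson antisymD)
  have toI: "(x, y) \<in> r \<or> (y, x) \<in> r" if "x \<in> Field r" "y \<in> Field r" "x \<noteq> y" for x y
    using r that unfolding order_on_defs total_on_def by blast
  have toJ: "(x, y) \<in> s \<or> (y, x) \<in> s" if "x \<in> Field s" "y \<in> Field s" "x \<noteq> y" for x y
    using s that unfolding order_on_defs total_on_def by blast
  have t3I: "(x, z) \<in> r \<and> x \<noteq> z"
    if "(x, y) \<in> r" "x \<noteq> y" "(y, z) \<in> r" "y \<noteq> z" for x y z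
    using trI[OF that(1,3)] asI[of x y] that by blast
  have t3J: "(x, z) \<in> s \<and> x \<noteq> z"
    if "(x, y) \<in> s" "x \<noteq> y" "(y, z) \<in> s" "y \<noteq> z" for x y z
    using trJ[OF that(1,3)] asJ[of x y] that by blast
  have shape: "(\<exists>x \<in> Field r. i = Inl (Inl x)) \<or> (\<exists>y \<in> Field s. i = Inl (Inr y)) \<or> (\<exists>l. i = Inr l)"
    if "i \<in> Q" for i
    using that unfolding Q_def by auto
  show "\<not> ?lt i i"
    by (cases i) simp_all
  show "?lt i k" if Q: "i \<in> Q" "j \<in> Q" "k \<in> Q" and lt: "?lt i j" "?lt j k"
    using shape[OF Q(1)] shape[OF Q(2)] shape[OF Q(3)] lt
    by (elim disjE bexE exE; hypsubst; simp; (use t3I in blast | use t3J in blast))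
  show "?lt i j \<or> ?lt j i" if Q: "i \<in> Q" "j \<in> Q" and ne: "i \<noteq> j"
    using shape[OF Q(1)] shape[OF Q(2)] ne
    by (elim disjE bexE exE; hypsubst; simp; (use toI in blast | use toJ in blast | linarith))
qed

section \<open>The images of b form a total Morley sequence\<close>

context copy_seq
begin

theorem total_Morley:
  fixes b :: "('k, 'm) tuple"
  assumes small_b: "small (dom b)" and ran_b: "ran b \<subseteq> N"
  shows "total_bu_Morley L M \<kappa> A (\<lambda>i. app (n i) b)"
  unfolding total_bu_Morley_def
proof (intro conjI allI impI)
  let ?B = "\<lambda>i. app (n i) b"
  show "indiscernible L M A (natLeq, ?B)"
    unfolding indiscernible_def em_equiv_def
  proof (intro allI impI)
    fix xs ys :: "nat list"
    assume *: "Defs.increasing (fst (natLeq, ?B)) xs \<and> Defs.increasing (fst (natLeq, ?B)) ys \<and> length xs = length ys"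
    have lt: "(\<lambda>x y. (x, y) \<in> natLeq \<and> x \<noteq> y) = (<)"
      by (intro ext) (auto simp: natLeq_def)
    have xs: "sorted_wrt (<) xs" and ys: "sorted_wrt (<) ys" and len: "length xs = length ys"
      using * unfolding Defs.increasing_def fst_conv lt by simp_all
    show "\<exists>\<sigma> \<in> AutA. \<forall>k < length xs. app \<sigma> (snd (natLeq, ?B) (xs ! k)) = snd (natLeq, ?B) (ys ! k)"
    \<comment> \<open>For empty tuples the identity must be taken: homogeneity for no coordinates
      yields an automorphism that need not be over \<open>A\<close>.\<close>
    proof (cases "xs = []")
      case True
      then show ?thesis using AutA_id by auto
    next
      case False
      have dist: "distinct xs"
        using xs by (simp add: strict_sorted_iff)
      define f where "f x = ys ! (THE k. k < length xs \<and> xs ! k = x)" for x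
      have f: "f (xs ! k) = ys ! k" if "k < length xs" for k
      proof -
        have "(THE l. l < length xs \<and> xs ! l = xs ! k) = k"
          using that dist by (intro the_equality) (auto simp: nth_eq_iff_index_eq)
        then show ?thesis by (simp add: f_def)
      qed
      have "tequiv (set xs \<times> N) (arr n) (arr (\<lambda>i. n (f i)))"
      proof (rule n_indiscernible)
        show "\<forall>i \<in> set xs. \<forall>j \<in> set xs. i < j \<longrightarrow> f i < f j"
        proof (intro ballI impI)
          fix i j assume "i \<in> set xs" "j \<in> set xs" "i < j"
          then obtain k l where kl: "k < length xs" "l < length xs" "i = xs ! k" "j = xs ! l"
            by (auto simp: in_set_conv_nth)
          have "k < l"
          proof (rule ccontr)
            assume "\<not> k < l"
            then have "l = k \<or> l < k" by auto
            then show False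
              using sorted_wrt_nth_less[OF xs, of l k] kl \<open>i < j\<close> by auto
          qed
          then show "f i < f j"
            using sorted_wrt_nth_less[OF ys, of k l] kl len by (simp add: f)
        qed
      qed simp
      then obtain \<sigma> where \<sigma>: "\<sigma> \<in> Aut" "\<forall>v \<in> set xs \<times> N. \<sigma> (arr n v) = arr (\<lambda>i. n (f i)) v"
        by (rule homogeneous[OF small_Times[OF small_finite[OF finite_set] small_N]])
      have \<sigma>n: "\<sigma> (n (xs ! k) x) = n (ys ! k) x" if "k < length xs" "x \<in> N" for k x
        using bspec[OF \<sigma>(2), of "(xs ! k, x)"] that by (simp add: f)
      \<comment> \<open>Homogeneity alone does not take \<open>A\<close> into account, but \<sigma>
        maps a copy of \<open>N\<close> to another one, and both copies are conjugates of
        \<open>N\<close> over \<open>A\<close>.\<close>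
      have "\<sigma> \<in> AutA"
      proof -
        have l: "0 < length xs" using False by simp
        obtain \<tau> where \<tau>: "\<tau> \<in> AutA" "\<forall>x \<in> N. n (xs ! 0) x = \<tau> x"
          by (rule copyE[OF n_copy])
        obtain \<rho> where \<rho>: "\<rho> \<in> AutA" "\<forall>x \<in> N. n (ys ! 0) x = \<rho> x"
          by (rule copyE[OF n_copy])
        have "(\<sigma> \<circ> \<tau>) x = \<rho> x" if "x \<in> reps" for x
          using \<sigma>n[OF l, of x] \<tau>(2) \<rho>(2) subsetD[OF reps_N that] by simp
        then have "\<sigma> \<circ> \<tau> \<in> AutA"
          by (rule AutA_agree[OF aut_comp[OF \<sigma>(1) AutA_aut[OF \<tau>(1)]] \<rho>(1)])
        then have "(\<sigma> \<circ> \<tau>) \<circ> inv \<tau> \<in> AutA"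
          by (rule AutA_comp[OF _ AutA_inv[OF \<tau>(1)]])
        then show ?thesis
          by (simp only: comp_assoc aut_inv_comp(1)[OF AutA_aut[OF \<tau>(1)]] comp_id)
      qed
      moreover have "app \<sigma> (app (n (xs ! k)) b) = app (n (ys ! k)) b" if "k < length xs" for k
        unfolding app_comp[symmetric]
        using \<sigma>n[OF that] ran_b by (intro app_cong) auto
      ultimately show ?thesis by auto
    qed
  qed
  fix I J :: "('k, 'k, 'm) seq"
  assume *: "Linear_order (fst I) \<and> |Field (fst I)| <o \<kappa> \<and>
    Linear_order (fst J) \<and> |Field (fst J)| <o \<kappa> \<and>
    em_equiv L M A (seq_append I J) (natLeq, ?B)"
  then have linI: "Linear_order (fst I)" and linJ: "Linear_order (fst J)"
    and small: "small (Field (fst I))" "small (Field (fst J))"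
    and em: "em_equiv L M A (seq_append I J) (natLeq, ?B)"
    by (simp_all add: small_def)
  let ?r = "ord_sum (fst I) (fst J)"
  let ?lt = "insert_mid ?r"
  let ?F = "Field (fst I) <+> Field (fst J)"
  let ?Q = "Inl ` ?F \<union> Inr ` {0, 1, 2 :: nat}"
  \<comment> \<open>\<open>Map.empty\<close> is a dummy at the three middle places, which lie
    outside the set of prescribed places.\<close>
  let ?b = "case_sum (case_sum (snd I) (snd J)) (\<lambda>_ :: nat. Map.empty)"
  note lin = insert_mid_linear[OF linI linJ]
  note irrefl = lin(1) and trans = lin(2)[where K = "{0, 1, 2}"] and total = lin(3)[where K = "{0, 1, 2}"]
  have FQ: "Inl x \<in> ?Q" if "x \<in> ?F" for x
    using that by blast
  have em': "\<exists>\<sigma> \<in> AutA. \<forall>i \<in> D \<inter> Inl ` ?F. app \<sigma> (?b i) = app (n (f i)) b"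
    if D: "finite D" "D \<subseteq> ?Q" and f: "\<forall>i \<in> D. \<forall>j \<in> D. ?lt i j \<longrightarrow> f i < f j" for D and f :: "_ \<Rightarrow> nat"
  proof -
    \<comment> \<open>Only the members of \<open>D\<close> coming from \<open>I + J\<close> are
      constrained by the EM-type; listed in increasing order they form a tuple to which
      \<open>em\<close> applies.\<close>
    define E where "E = {x \<in> ?F. Inl x \<in> D}"
    have "finite (Inl -` D)"
      using D(1) by (rule finite_vimageI) simp
    then have finE: "finite E"
      by (rule rev_finite_subset) (auto simp: E_def)
    have "\<exists>xs. set xs = E \<and> sorted_wrt (\<lambda>x y. (x, y) \<in> ?r \<and> x \<noteq> y) xs"
    proof (rule sorted_list_exists[OF finE])
      fix x y z assume E: "x \<in> E" "y \<in> E" "z \<in> E"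
        and lt: "(x, y) \<in> ?r \<and> x \<noteq> y" "(y, z) \<in> ?r \<and> y \<noteq> z"
      have "?lt (Inl x) (Inl z)"
      proof (rule trans)
        show "Inl x \<in> ?Q" "Inl y \<in> ?Q" "Inl z \<in> ?Q" using E FQ unfolding E_def by blast+
        show "?lt (Inl x) (Inl y)" "?lt (Inl y) (Inl z)" using lt by simp_all
      qed
      then show "(x, z) \<in> ?r \<and> x \<noteq> z" by simp
    next
      fix x y assume "x \<in> E" "y \<in> E" "x \<noteq> y"
      then have "?lt (Inl x) (Inl y) \<or> ?lt (Inl y) (Inl x)"
        by (intro total FQ) (simp_all add: E_def)
      then show "(x, y) \<in> ?r \<and> x \<noteq> y \<or> (y, x) \<in> ?r \<and> y \<noteq> x" by simp
    qed
    then obtain xs where xs: "set xs = E" "sorted_wrt (\<lambda>x y. (x, y) \<in> ?r \<and> x \<noteq> y) xs"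
      by (elim exE conjE)
    let ?ys = "map (\<lambda>x. f (Inl x)) xs"
    have "Defs.increasing (fst (seq_append I J)) xs"
      unfolding Defs.increasing_def seq_append_def fst_conv Field_ord_sum[OF linI linJ]
      using xs by (auto simp: E_def)
    moreover have "Defs.increasing (fst (natLeq, ?B)) ?ys"
      unfolding Defs.increasing_def fst_conv Field_natLeq sorted_wrt_map
    proof
      show "sorted_wrt (\<lambda>x y. (f (Inl x), f (Inl y)) \<in> natLeq \<and> f (Inl x) \<noteq> f (Inl y)) xs"
        using xs(2)
      proof (rule sorted_wrt_mono_rel[rotated])
        fix x y assume "x \<in> set xs" "y \<in> set xs" "(x, y) \<in> ?r \<and> x \<noteq> y"
        then have "f (Inl x) < f (Inl y)"
          using f xs(1) by (simp add: E_def)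
        then show "(f (Inl x), f (Inl y)) \<in> natLeq \<and> f (Inl x) \<noteq> f (Inl y)"
          by (simp add: natLeq_def)
      qed
    qed simp
    moreover have "length xs = length ?ys" by simp
    ultimately have "\<exists>\<sigma> \<in> AutA. \<forall>k < length xs. app \<sigma> (snd (seq_append I J) (xs ! k)) = snd (natLeq, ?B) (?ys ! k)"
      using em unfolding em_equiv_def by blast
    then obtain \<sigma> where \<sigma>: "\<sigma> \<in> AutA"
      "\<forall>k < length xs. app \<sigma> (snd (seq_append I J) (xs ! k)) = snd (natLeq, ?B) (?ys ! k)"
      by (rule bexE)
    have "app \<sigma> (?b i) = app (n (f i)) b" if "i \<in> D \<inter> Inl ` ?F" for i
    proof -
      obtain x where x: "i = Inl x" "x \<in> E"
        using \<open>i \<in> D \<inter> Inl ` ?F\<close> by (auto simp: E_def)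
      then obtain k where k: "k < length xs" "xs ! k = x"
        using xs(1) by (metis in_set_conv_nth)
      then show ?thesis
        using \<sigma>(2) x(1) by (auto simp: seq_append_def)
    qed
    then show ?thesis using \<sigma>(1) by blast
  qed
  have "small ?Q"
    by (intro small_Un small_image small_Plus small small_finite) simp
  then interpret st: stretch L M T \<kappa> A N u n ?Q "Inl ` ?F" ?lt b ?b
  proof unfold_locales
    show "Inl ` ?F \<subseteq> ?Q" by (rule Un_upper1)
    show "small (dom b)" by (rule small_b)
    show "ran b \<subseteq> N" by (rule ran_b)
    show "\<not> ?lt i i" for i by (rule irrefl)
    show "?lt i k" if "i \<in> ?Q" "j \<in> ?Q" "k \<in> ?Q" "?lt i j" "?lt j k" for i j k
      by (rule trans[OF that])
    show "?lt i j \<or> ?lt j i" if "i \<in> ?Q" "j \<in> ?Q" "i \<noteq> j" for i j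
      by (rule total[OF that])
    show "\<exists>\<sigma> \<in> AutA. \<forall>i \<in> D \<inter> Inl ` ?F. app \<sigma> (?b i) = app (n (f i)) b"
      if "finite D" "D \<subseteq> ?Q" "\<forall>i \<in> D. \<forall>j \<in> D. ?lt i j \<longrightarrow> f i < f j" for D f
      by (rule em'[OF that])
  qed
  let ?K1 = "Inl ` Inl ` Field (fst I)" and ?K2 = "Inl ` Inr ` Field (fst J)"
  have S1: "seq_params I = {real_im (?b k) | k. k \<in> ?K1}" and S2: "seq_params J = {real_im (?b k) | k. k \<in> ?K2}"
    unfolding seq_params_def by (simp_all add: Setcompr_eq_image image_image)
  have "x \<in> bddu L M \<kappa> A"
    if "x \<in> bddu L M \<kappa> (A \<union> seq_params I)" "x \<in> bddu L M \<kappa> (A \<union> seq_params J)" for x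
  proof (rule st.stretch_indep[where ?K1.0 = ?K1 and ?K2.0 = ?K2 and ?e0.0 = "Inr 0" and ?e1.0 = "Inr 1" and ?e2.0 = "Inr 2"])
    show "Inl ` ?F = ?K1 \<union> ?K2" by auto
    show "x \<in> bddu L M \<kappa> (A \<union> {real_im (?b k) | k. k \<in> ?K1})"
      using that(1) unfolding S1 .
    show "x \<in> bddu L M \<kappa> (A \<union> {real_im (?b k) | k. k \<in> ?K2})"
      using that(2) unfolding S2 .
  qed auto
  then show "bu_indep L M \<kappa> A (seq_params I) (seq_params J)"
    unfolding bu_indep_def using bddu_mono by blast
qed

end

theorem theorem4p21:
  fixes L :: "('f, 'r) lang"
    and T :: "('f, 'r) fm set"
    and M :: "('f, 'r, 'm) struc"
    and \<kappa> :: "'k rel"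
    and A :: "('k, 'm) imaginary set"
    and b :: "('k, 'm) tuple"
  assumes "complete_theory L T"
    and "monster_model L T M \<kappa>"
    and "\<forall>h \<in> A. hyperimaginary L M \<kappa> h"
    and "param_card A <o \<kappa>"
    and "|dom b| <o \<kappa>"
  shows "((\<exists>lam :: 'l rel. Card_order lam \<and>
              partition_rel lam omega_plus_one (ctwo ^c ((param_card A +c |dom b| ) +c |T| ))) \<longrightarrow>
            (\<exists>B :: nat \<Rightarrow> ('k, 'm) tuple. total_bu_Morley L M \<kappa> A B \<and> B 0 = b))
       \<and> ((\<exists>(\<mu> :: 'e rel) (\<alpha> :: 'o rel).
              limit_ordinal \<alpha> \<and> natLeq \<le>o \<alpha> \<and> Erdos_cardinal \<mu> \<alpha> \<and>
              (param_card A +c |dom b| ) +c |T| <o \<mu>) \<longrightarrow>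
            (\<exists>B :: nat \<Rightarrow> ('k, 'm) tuple. total_bu_Morley L M \<kappa> A B \<and> B 0 = b))"
proof -
  interpret monster_over L M T \<kappa> A
    using assms by unfold_locales
  have small_b: "small (dom b)"
    using assms(5) by (simp add: small_def)
  \<comment> \<open>With \<open>b\<close> inside the base, each copy of \<open>N\<close> carries an
    image of \<open>b\<close>; the first copy is the identity, so the first image is
    \<open>b\<close> itself.\<close>
  have "small (reps \<union> ran b)"
    unfolding ran_eq by (rule small_Un[OF small_reps small_image[OF small_b]])
  then obtain N where N: "reps \<union> ran b \<subseteq> N" "small N" "elem N" "orbit_step N \<subseteq> N"
    by (rule base_exists)
  have "\<exists>B :: nat \<Rightarrow> ('k, 'm) tuple. total_bu_Morley L M \<kappa> A B \<and> B 0 = b"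
  proof (rule minimal_idempotent_ultra[of "self_maps N", OF self_maps_id self_maps_comp])
    fix u
    assume u: "ultra u" "u (self_maps N)" "u \<star> u = u"
      "\<And>w. ultra w \<Longrightarrow> w (self_maps N) \<Longrightarrow> \<exists>v. ultra v \<and> v (self_maps N) \<and> v \<star> (w \<star> u) = u"
    interpret base L M T \<kappa> A N u
    proof
      show "reps \<subseteq> N" using N(1) by blast
      show "small N" by (rule N(2))
      show "elem N" by (rule N(3))
      show "orbit_step N \<subseteq> N" by (rule N(4))
      show "ultra u" by (rule u(1))
      show "u (self_maps N)" by (rule u(2))
      show "u \<star> u = u" by (rule u(3))
      show "\<exists>v. ultra v \<and> v (self_maps N) \<and> v \<star> (w \<star> u) = u" if "ultra w" "w (self_maps N)" for w
        by (rule u(4)[OF that])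
    qed
    obtain n where n: "n 0 = id" "\<forall>k. clim (N \<union> (\<Union>i \<le> k. n i ` N)) u (n k) (n (Suc k))"
      by (rule seq_exists)
    interpret copy_seq L M T \<kappa> A N u n
      by unfold_locales (rule n)+
    have "ran b \<subseteq> N" using N(1) by blast
    from total_Morley[OF small_b this] have "total_bu_Morley L M \<kappa> A (\<lambda>i. app (n i) b)" .
    moreover have "app (n 0) b = b" by (simp only: n(1) app_id)
    ultimately show "\<exists>B :: nat \<Rightarrow> ('k, 'm) tuple. total_bu_Morley L M \<kappa> A B \<and> B 0 = b"
      by (intro exI[of _ "\<lambda>i. app (n i) b"] conjI)
  qed
  then show ?thesis by (intro conjI impI)
qed

end
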